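(* Let $E$ be a universally complete Archimedean complex vector lattice, and let $S(z):=\sum_{n=0}^\infty a_n(z-c)^n$ be a power series on $E$ (with $c\in E$ and $a_n\in E$ for all $n\ge 0$). (i) If $(|a_n|^{1/n})_{n\geq 1}$ is order bounded, then for $L:=\limsup_{n\to\infty}|a_n|^{1/n}$ the set $\mathbb{P}_L(\Omega_S)$ is order bounded and $L^\ast=\sup_{r\in\Omega_S}\mathbb{P}_L(r)$. (ii) If $\Omega_S$ is order bounded, then $\bigl(\mathbb{P}_{\rho_S}(|a_n|^{1/n})\bigr)_{n\geq 1}$ is order bounded and furthermore $\limsup_{n\to\infty}\mathbb{P}_{\rho_S}(|a_n|^{1/n})=\rho_S^\ast$. (iii) $(|a_n|^{1/n})_{n\geq 1}$ is order bounded and $L:=\limsup_{n\to\infty}|a_n|^{1/n}$ is a weak order unit if and only if $\Omega_S$ is order bounded and $\rho_S$ is a weak order unit. In either case, $L^{-1}=\rho_S$. (iv) $\limsup_{n\to\infty}|a_n|^{1/n}=0$ if and only if $\Omega_S=E_+$.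
   Context: Complex vector lattices. An Archimedean real vector lattice $F$ is square mean closed if $f\boxplus g:=\sup\{(\cos\theta)f+(\sin\theta)g:\theta\in[0,2\pi]\}$ exists in $F$ for all $f,g\in F$. An Archimedean complex vector lattice is a complexification $E=E_\rho\oplus iE_\rho$ of a square mean closed Archimedean real vector lattice $E_\rho$ (its real part), with modulus $|f+ig|:=f\boxplus g$ for $f,g\in E_\rho$. Its positive cone is $E_+=\{f\in E:|f|=f\}$, which is also the positive cone of $E_\rho$; order relations, suprema and infima are taken in $E_\rho$. $E$ is universally complete if $E_\rho$ is, i.e. $E_\rho$ is Dedekind complete and every set of pairwise disjoint positive elements has a supremum (such $E_\rho$ is automatically square mean closed). Multiplication. Every universally complete Archimedean real vector lattice is a $\Phi$-algebra, i.e. an $f$-algebra with a multiplicative identity. The multiplication of $E_\rho$ is extended canonically (complex bilinearly) to $E$, written by juxtaposition; $e$ denotes the multiplicative identity and $a^0=e$ for all $a\in E$. For $a\in E_+$ and $n\in\mathbb{N}=\{1,2,\dots\}$, $a^{1/n}$ denotes the unique $r\in E_+$ with $r^n=a$. A weak order unit is an element $u\in E_+$ such that $u\wedge|x|=0$ implies $x=0$; in a universally complete $E$ every weak order unit is invertible. Bands and $a^\ast$. For $a\in E$, $B_a$ is the principal band generated by $a$ in $E$ and $\mathbb{P}_a$ is the associated band (order) projection of $E$ onto $B_a$. For $a\ne 0$, $B_a$ is a universally complete $f$-subalgebra of $E$ with multiplicative identity $\mathbb{P}_a(e)$, and $a$ is invertible in $B_a$; $a^\ast$ denotes the multiplicative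 inverse of $a$ in $B_a$. Moreover $0^\ast:=0$. Convergence. A sequence $(x_n)_{n\ge 0}$ in $E$ converges in order to $x\in E$ if there is a decreasing sequence $(p_n)_{n\geq 0}$ in $E_+$ with $\inf_n p_n=0$ (written $p_n\downarrow 0$) and $|x_n-x|\le p_n$ for all $n$. A series converges in order if its sequence of partial sums converges in order in $E$. For an order bounded sequence $(x_n)$ in $E_\rho$, $\limsup_{n\to\infty}x_n:=\inf_{n}\sup_{m\ge n}x_m$; the $\limsup$ is defined only for order bounded sequences, so an assertion about its value includes order boundedness. Power series. A power series on $E$ centered at $c\in E$ is a series $S(z)=\sum_{n=0}^\infty a_n(z-c)^n$ with $a_n\in E$ and $z$ a variable in $E$. It converges uniformly in order on $D\subseteq E$ if there is a sequence $p_m\downarrow 0$ with $\sup_{z\in D}\left|\sum_{n=0}^m a_n(z-c)^n-S(z)\right|\le p_m$ for every $m\ge 0$ (where $S(z)$ denotes the order sum). For $r\in E_+$ put $\bar\Delta(c,r):=\{z\in E:|z-c|\le r\}$ and $\Omega_S:=\{r\in E_+: S(z)\text{ converges uniformly in order on }\bar\Delta(c,r)\}$. If $\Omega_S$ is order bounded, then $\rho_S:=\sup\Omega_S$ is called the radius of convergence of $S$. *)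

theory Defs
  imports Complex_Main
begin

section \<open>Universally complete real vector lattices and f-algebras with unit\<close>

text \<open>
  Dedekind completeness is the class \<^class>\<open>conditionally_complete_lattice\<close>. The Archimedean property
  and square mean closedness follow; see \<open>archimedean_vector_lattice\<close> and
  \<open>square_mean_closed\<close> below.
\<close>

class universally_complete_vector_lattice = ordered_real_vector + conditionally_complete_lattice +
  assumes disjoint_sup_ex:
    "A \<noteq> {} \<Longrightarrow> (\<And>x. x \<in> A \<Longrightarrow> 0 \<le> x) \<Longrightarrow>
     (\<And>x y. x \<in> A \<Longrightarrow> y \<in> A \<Longrightarrow> x \<noteq> y \<Longrightarrow> inf x y = 0) \<Longrightarrow>
     \<exists>s. (\<forall>x\<in>A. x \<le> s) \<and> (\<forall>u. (\<forall>x\<in>A. x \<le> u) \<longrightarrow> s \<le> u)"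

text \<open>
  Commutativity of the multiplication is a theorem for Archimedean f-algebras and is not an axiom.
  Using \<^class>\<open>monoid_mult\<close> rather than \<open>ring_1\<close> for the unit \<open>e = 1\<close> avoids
  \<open>0 \<noteq> 1\<close>, so that the zero space is not excluded.
\<close>

class phi_algebra = ordered_real_vector + lattice + real_algebra + monoid_mult +
  assumes mult_pos_pos_le: "0 \<le> a \<Longrightarrow> 0 \<le> b \<Longrightarrow> 0 \<le> a * b"
    and f_algebra_right: "inf a b = 0 \<Longrightarrow> 0 \<le> d \<Longrightarrow> inf (a * d) b = 0"
    and f_algebra_left: "inf a b = 0 \<Longrightarrow> 0 \<le> d \<Longrightarrow> inf (d * a) b = 0"

lemma archimedean_vector_lattice:
  fixes x y :: "'a :: universally_complete_vector_lattice"
  assumes "\<And>n::nat. real n *\<^sub>R x \<le> y"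
  shows "x \<le> 0"
proof -
  let ?A = "range (\<lambda>n::nat. real n *\<^sub>R x)"
  have bdd: "bdd_above ?A"
    using assms by (rule bdd_aboveI2)
  have "real n *\<^sub>R x \<le> Sup ?A - x" for n
  proof -
    have "real (Suc n) *\<^sub>R x \<le> Sup ?A"
      using bdd by (intro cSup_upper rangeI)
    then show ?thesis
      by (simp add: scaleR_left_distrib algebra_simps)
  qed
  then have "Sup ?A \<le> Sup ?A - x"
    by (intro cSup_least) auto
  then show ?thesis
    by simp
qed


section \<open>The complexification\<close>

datatype 'a complexification = Cpl (re: 'a) (im: 'a)

lemma complexification_eqI: "re x = re y \<Longrightarrow> im x = im y \<Longrightarrow> x = y"
  by (cases x; cases y) simp

instantiation complexification :: (real_algebra) real_algebra
begin

definition "0 = Cpl 0 0"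
definition "x + y = Cpl (re x + re y) (im x + im y)"
definition "- x = Cpl (- re x) (- im x)"
definition "x - y = Cpl (re x - re y) (im x - im y)"
definition "x * y = Cpl (re x * re y - im x * im y) (re x * im y + im x * re y)"
definition "t *\<^sub>R x = Cpl (t *\<^sub>R re x) (t *\<^sub>R im x)"

instance
  by standard
    (simp_all add: zero_complexification_def plus_complexification_def uminus_complexification_def
      minus_complexification_def times_complexification_def scaleR_complexification_def algebra_simps)

end

instantiation complexification :: ("{real_algebra, monoid_mult}") monoid_mult
begin

definition "1 = Cpl 1 0"

instance
  by standard (simp_all add: one_complexification_def times_complexification_def)

end

text \<open>The embedding of \<open>E\<^sub>\<rho>\<close> into \<open>E\<close>, and multiplication by complex scalars.\<close>

definition of_rho :: "'a :: zero \<Rightarrow> 'a complexification" where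
  "of_rho f = Cpl f 0"

definition scaleC :: "complex \<Rightarrow> 'a :: real_vector complexification \<Rightarrow> 'a complexification" where
  "scaleC t x = Cpl (Re t *\<^sub>R re x - Im t *\<^sub>R im x) (Re t *\<^sub>R im x + Im t *\<^sub>R re x)"

definition modulus ::
    "'a :: {ordered_real_vector, conditionally_complete_lattice} complexification \<Rightarrow> 'a" where
  "modulus x = (SUP \<theta>\<in>{0..2 * pi}. cos \<theta> *\<^sub>R re x + sin \<theta> *\<^sub>R im x)"

lemma square_mean_closed:
  fixes f g :: "'a :: {ordered_real_vector, conditionally_complete_lattice}"
  shows "bdd_above ((\<lambda>\<theta>. cos \<theta> *\<^sub>R f + sin \<theta> *\<^sub>R g) ` {0..2 * pi})"
proof -
  have *: "t *\<^sub>R h \<le> sup h 0 + sup (- h) 0" if "\<bar>t\<bar> \<le> 1" for t :: real and h :: 'a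
  proof (cases "0 \<le> t")
    case True
    have "t *\<^sub>R h \<le> t *\<^sub>R sup h 0"
      using True by (intro scaleR_left_mono) auto
    also have "\<dots> \<le> 1 *\<^sub>R sup h 0"
      using True that by (intro scaleR_right_mono) auto
    finally show ?thesis
      by (simp add: add_increasing2)
  next
    case False
    have "t *\<^sub>R h = (- t) *\<^sub>R (- h)"
      by simp
    also have "\<dots> \<le> (- t) *\<^sub>R sup (- h) 0"
      using False by (intro scaleR_left_mono) auto
    also have "\<dots> \<le> 1 *\<^sub>R sup (- h) 0"
      using False that by (intro scaleR_right_mono) auto
    finally show ?thesis
      by (simp add: add_increasing)
  qed
  show ?thesis
    by (rule bdd_aboveI2[where M = "(sup f 0 + sup (- f) 0) + (sup g 0 + sup (- g) 0)"])
      (intro add_mono * abs_cos_le_one abs_sin_le_one)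
qed


section \<open>Order boundedness, limit superior, order convergence\<close>

definition order_bounded :: "'a :: order set \<Rightarrow> bool" where
  "order_bounded A \<longleftrightarrow> bdd_below A \<and> bdd_above A"

text \<open>Order bounded subset of \<open>E\<^sub>\<rho>\<close>, the latter regarded as a subset of \<open>E\<close>.\<close>

definition order_bounded_rho :: "'a :: {order, zero} complexification set \<Rightarrow> bool" where
  "order_bounded_rho A \<longleftrightarrow> (\<exists>l u. A \<subseteq> of_rho ` {l..u})"

text \<open>Limit superior of a sequence indexed by \<open>n \<ge> 1\<close>; meaningful for order bounded ones.\<close>

definition order_limsup :: "(nat \<Rightarrow> 'a :: conditionally_complete_lattice) \<Rightarrow> 'a" where
  "order_limsup x = (INF n\<in>{1..}. SUP m\<in>{n..}. x m)"

definition decreases_to_0 :: "(nat \<Rightarrow> 'a :: {conditionally_complete_lattice, zero}) \<Rightarrow> bool" where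
  "decreases_to_0 p \<longleftrightarrow> decseq p \<and> (\<forall>n. 0 \<le> p n) \<and> (INF n. p n) = 0"

definition order_converges ::
    "(nat \<Rightarrow> 'a :: {universally_complete_vector_lattice, phi_algebra} complexification) \<Rightarrow>
     'a complexification \<Rightarrow> bool" where
  "order_converges x l \<longleftrightarrow> (\<exists>p. decreases_to_0 p \<and> (\<forall>n. modulus (x n - l) \<le> p n))"


section \<open>Bands, band projections, weak order units and roots\<close>

definition order_ideal ::
    "'a :: {ordered_real_vector, conditionally_complete_lattice, real_algebra} complexification set \<Rightarrow> bool" where
  "order_ideal I \<longleftrightarrow> 0 \<in> I \<and> (\<forall>x\<in>I. \<forall>y\<in>I. x + y \<in> I) \<and> (\<forall>t. \<forall>x\<in>I. scaleC t x \<in> I) \<and>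
     (\<forall>x y. y \<in> I \<longrightarrow> modulus x \<le> modulus y \<longrightarrow> x \<in> I)"

text \<open>A band is an order ideal closed under those suprema of real elements that exist in \<open>E\<^sub>\<rho>\<close>.\<close>

definition band ::
    "'a :: {ordered_real_vector, conditionally_complete_lattice, real_algebra} complexification set \<Rightarrow> bool" where
  "band B \<longleftrightarrow> order_ideal B \<and>
     (\<forall>A. A \<noteq> {} \<longrightarrow> bdd_above A \<longrightarrow> of_rho ` A \<subseteq> B \<longrightarrow> of_rho (Sup A) \<in> B)"

definition principal_band ::
    "'a :: {ordered_real_vector, conditionally_complete_lattice, real_algebra} complexification \<Rightarrow>
     'a complexification set" where
  "principal_band a = \<Inter>{B. band B \<and> a \<in> B}"

definition disjoint_complement ::
    "'a :: {ordered_real_vector, conditionally_complete_lattice} complexification set \<Rightarrow>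
     'a complexification set" where
  "disjoint_complement B = {x. \<forall>y\<in>B. inf (modulus x) (modulus y) = 0}"

text \<open>\<open>\<P>\<^sub>a x\<close> is the component in \<open>B\<^sub>a\<close> of \<open>x\<close> with respect to \<open>E = B\<^sub>a \<oplus> B\<^sub>a\<^sup>d\<close>.\<close>

definition band_proj ::
    "'a :: {ordered_real_vector, conditionally_complete_lattice, real_algebra} complexification \<Rightarrow>
     'a complexification \<Rightarrow> 'a complexification" where
  "band_proj a x = (THE y. y \<in> principal_band a \<and> x - y \<in> disjoint_complement (principal_band a))"

definition band_inverse ::
    "'a :: {universally_complete_vector_lattice, phi_algebra} complexification \<Rightarrow>
     'a complexification" where
  "band_inverse a = (if a = 0 then 0 else
     (THE b. b \<in> principal_band a \<and> a * b = band_proj a 1 \<and> b * a = band_proj a 1))"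

definition weak_order_unit ::
    "'a :: {universally_complete_vector_lattice, phi_algebra} \<Rightarrow> bool" where
  "weak_order_unit u \<longleftrightarrow>
     0 \<le> u \<and> (\<forall>x :: 'a complexification. inf u (modulus x) = 0 \<longrightarrow> x = 0)"

definition pos_root :: "nat \<Rightarrow> 'a :: {universally_complete_vector_lattice, phi_algebra} \<Rightarrow> 'a" where
  "pos_root n a = (THE r. 0 \<le> r \<and> r ^ n = a)"


section \<open>Power series\<close>

definition partial_sum ::
    "(nat \<Rightarrow> 'a :: {real_algebra, monoid_mult} complexification) \<Rightarrow> 'a complexification \<Rightarrow>
     nat \<Rightarrow> 'a complexification \<Rightarrow> 'a complexification" where
  "partial_sum a c m z = (\<Sum>n\<le>m. a n * (z - c) ^ n)"

text \<open>
  \<open>S\<close> is the order sum on \<open>D\<close>. That the supremum over \<open>z \<in> D\<close> is at most \<open>p m\<close> is written out as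
  \<open>p m\<close> being an upper bound.
\<close>

definition uniformly_order_convergent_on ::
    "(nat \<Rightarrow> 'a :: {universally_complete_vector_lattice, phi_algebra} complexification) \<Rightarrow>
     'a complexification \<Rightarrow> 'a complexification set \<Rightarrow> bool" where
  "uniformly_order_convergent_on a c D \<longleftrightarrow>
     (\<exists>S. (\<forall>z\<in>D. order_converges (\<lambda>m. partial_sum a c m z) (S z)) \<and>
          (\<exists>p. decreases_to_0 p \<and> (\<forall>m. \<forall>z\<in>D. modulus (partial_sum a c m z - S z) \<le> p m)))"

definition closed_disc ::
    "'a :: {universally_complete_vector_lattice, phi_algebra} complexification \<Rightarrow> 'a \<Rightarrow>
     'a complexification set" where
  "closed_disc c r = {z. modulus (z - c) \<le> r}"

definition convergence_radii ::
    "(nat \<Rightarrow> 'a :: {universally_complete_vector_lattice, phi_algebra} complexification) \<Rightarrow>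
     'a complexification \<Rightarrow> 'a set" where
  "convergence_radii a c = {r. 0 \<le> r \<and> uniformly_order_convergent_on a c (closed_disc c r)}"

definition radius_of_convergence ::
    "(nat \<Rightarrow> 'a :: {universally_complete_vector_lattice, phi_algebra} complexification) \<Rightarrow>
     'a complexification \<Rightarrow> 'a" where
  "radius_of_convergence a c = Sup (convergence_radii a c)"

definition coeff_root ::
    "(nat \<Rightarrow> 'a :: {universally_complete_vector_lattice, phi_algebra} complexification) \<Rightarrow>
     nat \<Rightarrow> 'a" where
  "coeff_root a n = pos_root n (modulus (a n))"

end

theory Submission
  imports Defs "HOL-Library.Lattice_Algebras"
begin

text \<open>
  A universally complete \<open>\<Phi>\<close>-algebra is an algebra of extended continuous functions, and the theorem is
  the Cauchy-Hadamard formula applied at each point. The proof follows this idea with the Boolean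
  algebra of components of \<open>1\<close> (idempotents \<open>p\<close> with \<open>0 \<le> p \<le> 1\<close>) in place of the function
  representation; its ultrafilters are the points.

  Given an ultrafilter \<open>F\<close> of components, an element \<open>f\<close> that is bounded on some member of \<open>F\<close> has a
  real value at \<open>F\<close>, and taking values is a homomorphism of ordered algebras. If \<open>f \<le> g\<close> fails,
  then it fails for the values at some \<open>F\<close> where finitely many prescribed elements are finite
  (\<open>not_le_value_at\<close>). Equations and inequalities between finitely many elements are thereby inherited from \<open>\<real>\<close> or
  \<open>\<complex>\<close>: commutativity, uniqueness of roots, \<open>\<bar>zw\<bar> = \<bar>z\<bar> \<bar>w\<bar>\<close> and the triangle inequality.

  Infinite suprema do not commute with values, but if \<open>Sup A \<ge> t > s\<close> on a component, then a single
  \<open>a \<in> A\<close> is at least \<open>s\<close> on a smaller component (\<open>Sup_approximated\<close>), and dually for infima. Universal completeness enters through \<open>bdd_above_if_locally_bounded\<close>: a set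
  that is bounded by a constant on a small piece of every component is order bounded. Roots, inverses
  and band projections are built from these facts; the band generated by \<open>f \<ge> 0\<close> consists of the
  elements fixed by its support component.

  For power series, the radii of uniform convergence can be replaced by those \<open>r\<close> for which
  \<open>\<bar>a\<^sub>n\<bar> r\<^sup>n\<close> is order bounded, up to a factor \<open>t < 1\<close>. With \<open>x\<^sub>n = \<bar>a\<^sub>n\<bar>\<^sup>1\<^sup>/\<^sup>n\<close>, two estimates on a
  component carry the theorem. If the terms at \<open>r\<close> are bounded and \<open>r \<ge> u > 0\<close> there, then on a smaller
  component \<open>x\<^sub>n \<le> v\<close> eventually, for every \<open>v > 1/u\<close> (\<open>coeff_root_bound_if_bounded_radius\<close>).
  Conversely, if \<open>x\<^sub>n \<le> v\<close> eventually on \<open>q\<close> and the \<open>x\<^sub>n\<close> are uniformly bounded there, then the terms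
  at \<open>(1/v) q\<close> are bounded (\<open>component_multiple_bounded_radius\<close>). The inequalities between \<open>L\<close>,
  \<open>\<rho>\<close> and their inverses follow by assuming a failure at an ultrafilter, choosing reals strictly between
  the two values, and descending to a component on which one of the estimates contradicts the choice.
\<close>

section \<open>Disjoint elements\<close>

instance phi_algebra \<subseteq> ordered_ring
proof
  fix a b c :: 'a
  assume *: "a \<le> b" "0 \<le> c"
  then have "0 \<le> c * (b - a)" "0 \<le> (b - a) * c"
    by (auto intro!: mult_pos_pos_le)
  then show "c * a \<le> c * b" "a * c \<le> b * c"
    by (auto simp: algebra_simps)
qed

instance phi_algebra \<subseteq> lattice_ab_group_add ..

lemma inf_add_eq_0:
  fixes x y g :: "'a :: lattice_ab_group_add"
  assumes "inf x g = 0" "inf y g = 0"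
  shows "inf (x + y) g = 0"
proof (rule order.antisym)
  have nn: "0 \<le> x" "0 \<le> y" "0 \<le> g"
    using assms by (metis inf.cobounded1 inf.cobounded2)+
  define w where "w = inf (x + y) g"
  have w: "w \<le> x + y" "w \<le> g"
    by (simp_all add: w_def)
  have "w - y \<le> g"
    using w(2) nn(2) by (metis add_increasing2 diff_le_eq)
  moreover have "w - y \<le> x"
    using w(1) by (simp add: diff_le_eq)
  ultimately have "w - y \<le> inf x g"
    by simp
  then have "w \<le> y"
    by (simp only: assms diff_le_0_iff_le)
  then have "w \<le> inf y g"
    using w(2) by (rule inf_greatest)
  then show "inf (x + y) g \<le> 0"
    using assms(2) by (simp add: w_def)
  show "0 \<le> inf (x + y) g"
    using nn by simp
qed

lemma inf_eq_0_antimono: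
  fixes x y g :: "'a :: lattice_ab_group_add"
  assumes "inf x g = 0" "0 \<le> y" "y \<le> x"
  shows "inf y g = 0"
proof (rule order.antisym)
  show "inf y g \<le> 0"
    using inf_mono[OF assms(3) order_refl[of g]] assms(1) by simp
  have "0 \<le> g"
    using assms(1) inf.cobounded2[of x g] by simp
  then show "0 \<le> inf y g"
    using assms(2) by (rule inf_greatest[rotated])
qed

text \<open>
  An instance of infinite distributivity: \<open>a + g = sup a g \<le> sup (Sup A) g\<close> gives
  \<open>a \<le> Sup A - inf (Sup A) g\<close> for all \<open>a \<in> A\<close>.
\<close>

lemma inf_cSup_eq_0:
  fixes A :: "'a :: {universally_complete_vector_lattice, phi_algebra} set"
  assumes "A \<noteq> {}" "bdd_above A" and disj: "\<And>a. a \<in> A \<Longrightarrow> inf a g = 0"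
  shows "inf (Sup A) g = 0"
proof (rule order.antisym)
  obtain a0 where a0: "a0 \<in> A"
    using assms(1) by blast
  have "0 \<le> a0" "0 \<le> g"
    using disj[OF a0] by (metis inf.cobounded1 inf.cobounded2)+
  then show "0 \<le> inf (Sup A) g"
    using cSup_upper[OF a0 assms(2)] by simp
  have "a \<le> Sup A - inf (Sup A) g" if "a \<in> A" for a
  proof -
    have "a + g = sup a g"
      using add_eq_inf_sup[of a g] disj[OF that] by simp
    also have "\<dots> \<le> sup (Sup A) g"
      using cSup_upper[OF that assms(2)] by (simp add: le_supI1)
    also have "\<dots> = (Sup A - inf (Sup A) g) + g"
      using add_eq_inf_sup[of "Sup A" g] by (metis add.commute add_diff_eq diff_add_eq eq_diff_eq)
    finally show ?thesis
      by (rule add_le_imp_le_right)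
  qed
  then have "Sup A \<le> Sup A - inf (Sup A) g"
    using assms(1) by (intro cSup_least)
  then show "inf (Sup A) g \<le> 0"
    by (simp only: le_diff_eq add_le_same_cancel1)
qed

text \<open>
  Disjointness survives multiplication on either side, so \<open>a * b\<close> is disjoint from itself.
\<close>

lemma disjoint_mult_eq_0:
  fixes a b :: "'a :: phi_algebra"
  assumes "inf a b = 0"
  shows "a * b = 0"
proof -
  have nn: "0 \<le> a" "0 \<le> b"
    using assms by (metis inf.cobounded1 inf.cobounded2)+
  have "inf (a * b) b = 0"
    by (rule f_algebra_right[OF assms nn(2)])
  then have "inf b (a * b) = 0"
    by (simp add: inf_commute)
  then have "inf (a * b) (a * b) = 0"
    by (rule f_algebra_left[OF _ nn(1)])
  then show ?thesis
    by simp
qed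

lemma positive_part_decomp:
  fixes f :: "'a :: lattice_ab_group_add"
  shows "f = sup f 0 - sup (- f) 0"
proof -
  have "f + sup (- f) 0 = sup 0 f"
    by (simp only: add_sup_distrib_left add_0_right right_minus)
  then show ?thesis
    by (simp only: sup_commute eq_diff_eq)
qed

lemma positive_part_disjoint:
  fixes f :: "'a :: lattice_ab_group_add"
  shows "inf (sup f 0) (sup (- f) 0) = 0"
proof -
  have "sup f 0 = f + sup (- f) 0"
    using positive_part_decomp[of f] by (simp only: eq_diff_eq)
  then have "inf (sup f 0) (sup (- f) 0) = inf (f + sup (- f) 0) (0 + sup (- f) 0)"
    by (simp only: add_0_left)
  also have "\<dots> = inf f 0 + sup (- f) 0"
    by (simp only: add_inf_distrib_right)
  also have "\<dots> = 0"
    by (simp only: inf_eq_neg_sup minus_zero left_minus)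
  finally show ?thesis .
qed

lemma square_nonneg:
  fixes f :: "'a :: phi_algebra"
  shows "0 \<le> f * f"
proof -
  define u v where "u = sup f 0" and "v = sup (- f) 0"
  have f: "f = u - v"
    unfolding u_def v_def by (rule positive_part_decomp)
  have "inf u v = 0" "inf v u = 0"
    using positive_part_disjoint[of f] by (simp_all add: u_def v_def inf_commute)
  then have "u * v = 0" "v * u = 0"
    by (simp_all add: disjoint_mult_eq_0)
  then have "f * f = u * u + v * v"
    by (simp add: f algebra_simps)
  moreover have "0 \<le> u" "0 \<le> v"
    by (simp_all add: u_def v_def)
  ultimately show ?thesis
    by simp
qed

lemma zero_le_one_phi: "(0 :: 'a :: phi_algebra) \<le> 1"
  using square_nonneg[of "1 :: 'a"] by simp

section \<open>Components of the unit\<close>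

text \<open>
  Components represent bands: multiplication by \<open>p\<close> is the projection onto the band generated by \<open>p\<close>.
\<close>

definition component :: "'a :: {universally_complete_vector_lattice, phi_algebra} \<Rightarrow> bool" where
  "component p \<longleftrightarrow> 0 \<le> p \<and> p \<le> 1 \<and> p * p = p"

lemma componentD:
  assumes "component p"
  shows "0 \<le> p" "p \<le> 1" "p * p = p"
  using assms by (auto simp: component_def)

lemma component_0 [simp]: "component 0"
  by (simp add: component_def zero_le_one_phi)

lemma component_1 [simp]: "component 1"
  by (simp add: component_def zero_le_one_phi)

lemma component_compl: "component p \<Longrightarrow> component (1 - p)"
  by (auto simp: component_def algebra_simps)

lemma component_mult_compl [simp]:
  assumes "component p"
  shows "p * (1 - p) = 0" "(1 - p) * p = 0"
  using componentD(3)[OF assms] by (simp_all add: algebra_simps)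

lemma component_disjoint_compl:
  assumes "component p"
  shows "inf p (1 - p) = 0"
proof (rule order.antisym)
  define x where "x = inf p (1 - p)"
  have "p * x \<le> p * (1 - p)"
    using componentD(1)[OF assms] by (intro mult_left_mono) (auto simp: x_def)
  moreover have "(1 - p) * x \<le> (1 - p) * p"
    using componentD(1)[OF component_compl[OF assms]] by (intro mult_left_mono) (auto simp: x_def)
  ultimately have "p * x + (1 - p) * x \<le> 0"
    using assms by (simp add: add_nonpos_nonpos)
  then show "inf p (1 - p) \<le> 0"
    by (simp add: x_def flip: distrib_right)
  show "0 \<le> inf p (1 - p)"
    using componentD(1,2)[OF assms] by simp
qed

text \<open>
  For \<open>g \<ge> 0\<close> both \<open>p g (1 - p)\<close> and \<open>(1 - p) g p\<close> are products of disjoint elements. Commutativity of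
  the whole algebra is derived later from this special case.
\<close>

lemma component_commute:
  assumes "component p"
  shows "p * f = f * p"
proof -
  have pos: "q * g * (1 - q) = 0" "(1 - q) * g * q = 0"
    if q: "component q" and g: "0 \<le> g" for q g :: 'a
  proof -
    have d: "inf q (1 - q) = 0" "inf (1 - q) q = 0"
      using component_disjoint_compl[OF q] by (simp_all add: inf_commute)
    show "q * g * (1 - q) = 0" "(1 - q) * g * q = 0"
      by (rule disjoint_mult_eq_0, rule f_algebra_right, rule d, rule g)+
  qed
  have c: "p * g = g * p" if "0 \<le> g" for g
  proof -
    have "p * g = p * g * p"
      using pos(1)[OF assms that] by (simp only: right_diff_distrib mult_1_right right_minus_eq)
    also have "\<dots> = g * p"
      using pos(2)[OF assms that] by (simp only: left_diff_distrib mult_1_left right_minus_eq)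
    finally show ?thesis .
  qed
  have "p * (sup f 0 - sup (- f) 0) = (sup f 0 - sup (- f) 0) * p"
    using c[of "sup f 0"] c[of "sup (- f) 0"] by (simp only: left_diff_distrib right_diff_distrib sup_ge2)
  then show ?thesis
    by (simp only: positive_part_decomp[symmetric])
qed

lemma component_mult:
  assumes "component p" "component q"
  shows "component (p * q)"
  unfolding component_def
proof (intro conjI)
  show "0 \<le> p * q"
    using assms by (simp add: componentD)
  have "p * q \<le> 1 * 1"
    using assms by (intro mult_mono) (auto simp: componentD zero_le_one_phi)
  then show "p * q \<le> 1"
    by simp
  have "p * q * (p * q) = p * (q * p) * q"
    by (simp add: mult.assoc)
  also have "\<dots> = (p * p) * (q * q)"
    using component_commute[OF assms(2), of p] by (simp add: mult.assoc)
  finally show "p * q * (p * q) = p * q"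
    using assms by (simp add: componentD)
qed

text \<open>
  The component of \<open>1\<close> in the disjoint complement of \<open>g\<close>, obtained as the largest element of
  \<open>[0, 1]\<close> that is disjoint from \<open>g\<close>. It is a component since \<open>inf e (1 - e)\<close> could otherwise be added to it.
\<close>

lemma largest_disjoint_component:
  assumes "0 \<le> g"
  obtains e where "component e" "e * g = 0"
    "\<And>y. 0 \<le> y \<Longrightarrow> y \<le> 1 - e \<Longrightarrow> inf y g = 0 \<Longrightarrow> y = 0"
proof -
  define A where "A = {x. 0 \<le> x \<and> x \<le> 1 \<and> inf x g = 0}"
  define e where "e = Sup A"
  have A: "0 \<in> A" "bdd_above A"
    using assms zero_le_one_phi by (auto simp: A_def bdd_above_def inf_absorb1)
  have eg: "inf e g = 0"
    unfolding e_def using A by (intro inf_cSup_eq_0) (auto simp: A_def)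
  have e0: "0 \<le> e"
    unfolding e_def using A by (intro cSup_upper)
  have e1: "e \<le> 1"
    unfolding e_def using A by (intro cSup_least) (auto simp: A_def)
  have maximal: "y = 0" if "0 \<le> y" "y \<le> 1 - e" "inf y g = 0" for y
  proof -
    have "e + y \<in> A"
      using that e0 inf_add_eq_0[OF eg that(3)] by (simp add: A_def algebra_simps)
    then have "e + y \<le> e"
      unfolding e_def using A by (intro cSup_upper)
    then show ?thesis
      using that(1) by (simp add: order.antisym)
  qed
  have e1': "0 \<le> 1 - e"
    using e1 by simp
  have "inf e (1 - e) = 0"
    by (rule maximal, rule inf_greatest[OF e0 e1'], rule inf_le2,
        rule inf_eq_0_antimono[OF eg inf_greatest[OF e0 e1'] inf_le1])
  then have "e * (1 - e) = 0"
    by (rule disjoint_mult_eq_0)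
  then have "component e"
    using e0 e1 by (simp add: component_def algebra_simps)
  then show thesis
    using that disjoint_mult_eq_0[OF eg] maximal by blast
qed

text \<open>
  The component \<open>p\<close> is what is disjoint from the negative part of \<open>f\<close>.
\<close>

lemma component_split_sign:
  obtains p where "component p" "0 \<le> p * f" "(1 - p) * f \<le> 0"
proof -
  define u v where "u = sup f 0" and "v = sup (- f) 0"
  have f: "f = u - v"
    unfolding u_def v_def by (rule positive_part_decomp)
  have uv: "inf u v = 0"
    using positive_part_disjoint[of f] by (simp add: u_def v_def)
  have nn: "0 \<le> u" "0 \<le> v"
    by (simp_all add: u_def v_def)
  obtain e where e: "component e" "e * v = 0"
    and maximal: "\<And>y. 0 \<le> y \<Longrightarrow> y \<le> 1 - e \<Longrightarrow> inf y v = 0 \<Longrightarrow> y = 0"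
    using largest_disjoint_component[OF nn(2)] by blast
  have e': "0 \<le> e" "0 \<le> 1 - e"
    using e(1) by (auto simp: componentD)
  have 1: "0 \<le> e * f"
    using e(2) e' nn by (simp add: f right_diff_distrib)
  have "inf (1 - e) u = 0"
    by (rule maximal, rule inf_greatest[OF e'(2) nn(1)], rule inf_le1,
        rule inf_eq_0_antimono[OF uv inf_greatest[OF e'(2) nn(1)] inf_le2])
  then have "(1 - e) * u = 0"
    by (rule disjoint_mult_eq_0)
  moreover have "0 \<le> (1 - e) * v"
    using e' nn by simp
  ultimately have 2: "(1 - e) * f \<le> 0"
    by (simp add: f right_diff_distrib)
  show thesis
    using that[OF e(1) 1 2] .
qed

lemma component_split_level:
  obtains p where "component p" "t *\<^sub>R p \<le> p * f" "(1 - p) * f \<le> t *\<^sub>R (1 - p)"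
proof -
  obtain p where p: "component p" "0 \<le> p * (f - t *\<^sub>R 1)" "(1 - p) * (f - t *\<^sub>R 1) \<le> 0"
    by (rule component_split_sign)
  show thesis
    by (rule that[OF p(1)]) (use p(2,3) in \<open>auto simp: right_diff_distrib\<close>)
qed

text \<open>For components, \<open>q * p = q\<close> means \<open>q \<le> p\<close>.\<close>

lemma component_le_trans:
  fixes p q r :: "'a :: {universally_complete_vector_lattice, phi_algebra}"
  shows "r * q = r \<Longrightarrow> q * p = q \<Longrightarrow> r * p = r"
  using mult.assoc[of r q p] by simp

lemma component_restrict:
  fixes f g :: "'a :: {universally_complete_vector_lattice, phi_algebra}"
  assumes "component q" "q * p = q" "p * f \<le> p * g"
  shows "q * f \<le> q * g"
proof -
  have "q * (p * f) \<le> q * (p * g)"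
    using componentD(1)[OF assms(1)] assms(3) by (rule mult_left_mono[rotated])
  then show ?thesis
    by (simp add: assms(2) flip: mult.assoc)
qed

lemma component_restrict_upper:
  assumes "component q" "q * p = q" "p * f \<le> t *\<^sub>R p"
  shows "q * f \<le> t *\<^sub>R q"
  using component_restrict[of q p f "t *\<^sub>R 1"] assms by simp

lemma component_restrict_lower:
  assumes "component q" "q * p = q" "t *\<^sub>R p \<le> p * f"
  shows "t *\<^sub>R q \<le> q * f"
  using component_restrict[of q p "t *\<^sub>R 1" f] assms by simp

lemma component_mult_le:
  assumes "component p" "component q"
  shows "p * q * p = p * q" "p * q * q = p * q"
proof -
  have "p * q * p = (p * p) * q"
    using component_commute[OF assms(2), of p] by (simp add: mult.assoc)
  then show "p * q * p = p * q"
    using assms(1) by (simp add: componentD)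
  show "p * q * q = p * q"
    using assms(2) by (simp add: componentD mult.assoc)
qed

lemma component_scaleR_le_iff:
  assumes "component p" "p \<noteq> 0"
  shows "s *\<^sub>R p \<le> t *\<^sub>R p \<longleftrightarrow> s \<le> t"
proof
  show "s *\<^sub>R p \<le> t *\<^sub>R p" if "s \<le> t"
    using that assms by (intro scaleR_right_mono) (auto simp: componentD)
  show "s \<le> t" if le: "s *\<^sub>R p \<le> t *\<^sub>R p"
  proof (rule ccontr)
    assume "\<not> s \<le> t"
    moreover have "(s - t) *\<^sub>R p \<le> 0"
      using le by (simp add: scaleR_left_diff_distrib)
    ultimately have "inverse (s - t) *\<^sub>R ((s - t) *\<^sub>R p) \<le> inverse (s - t) *\<^sub>R 0"
      by (intro scaleR_left_mono) auto
    then have "p \<le> 0"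
      using \<open>\<not> s \<le> t\<close> by simp
    then show False
      using assms componentD(1) by (metis order.antisym)
  qed
qed

text \<open>
  If no component met \<open>f\<close> at a positive level \<open>t\<close>, then \<open>f \<le> t\<close> for all \<open>t > 0\<close>, and \<open>f \<le> 0\<close> by the
  Archimedean property.
\<close>

lemma positive_on_component:
  assumes "\<not> f \<le> 0"
  obtains q t where "component q" "q \<noteq> 0" "t > 0" "t *\<^sub>R q \<le> q * f"
proof -
  have "\<exists>q t. component q \<and> q \<noteq> 0 \<and> t > 0 \<and> t *\<^sub>R q \<le> q * f"
  proof (rule ccontr)
    assume *: "\<not> ?thesis"
    have "f \<le> t *\<^sub>R 1" if "t > 0" for t
    proof -
      obtain p where p: "component p" "t *\<^sub>R p \<le> p * f" "(1 - p) * f \<le> t *\<^sub>R (1 - p)"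
        by (rule component_split_level)
      have "p = 0"
        using * p(1,2) that by blast
      then show ?thesis
        using p(3) by simp
    qed
    then have le: "f \<le> (1 / real n) *\<^sub>R 1" if "n \<noteq> 0" for n
      using that by simp
    have "real n *\<^sub>R f \<le> 1" for n
    proof (cases "n = 0")
      case False
      then have "real n *\<^sub>R f \<le> real n *\<^sub>R ((1 / real n) *\<^sub>R 1)"
        using le by (intro scaleR_left_mono) auto
      then show ?thesis
        using False by simp
    qed (simp add: zero_le_one_phi)
    then have "f \<le> 0"
      by (rule archimedean_vector_lattice)
    then show False
      using assms by simp
  qed
  then show thesis
    using that by blast
qed

text \<open>
  Split \<open>p\<close> along the component where \<open>f \<ge> t\<close>: either one of the parts vanishes, or it is the required
  nonzero \<open>q\<close>.
\<close>

lemma component_level_dichotomy: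
  assumes p: "component p"
  shows "p * f \<le> t *\<^sub>R p \<or> (\<exists>q. component q \<and> q \<noteq> 0 \<and> q * p = q \<and> t *\<^sub>R q \<le> q * f)" (is ?thesis1)
    and "t *\<^sub>R p \<le> p * f \<or> (\<exists>q. component q \<and> q \<noteq> 0 \<and> q * p = q \<and> q * f \<le> t *\<^sub>R q)" (is ?thesis2)
proof -
  obtain e where e: "component e" "t *\<^sub>R e \<le> e * f" "(1 - e) * f \<le> t *\<^sub>R (1 - e)"
    by (rule component_split_level)
  have e': "component (1 - e)"
    using e(1) by (rule component_compl)
  note c = component_mult[OF e(1) p] component_mult[OF e' p]
  note le = component_mult_le[OF e(1) p] component_mult_le[OF e' p]
  have sum: "e * p + (1 - e) * p = p"
    by (simp flip: distrib_right)
  have low: "t *\<^sub>R (e * p) \<le> (e * p) * f"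
    by (rule component_restrict_lower[OF c(1) le(1) e(2)])
  have up: "((1 - e) * p) * f \<le> t *\<^sub>R ((1 - e) * p)"
    by (rule component_restrict_upper[OF c(2) le(3) e(3)])
  show ?thesis1
  proof (cases "e * p = 0")
    case True
    then show ?thesis
      using up sum by simp
  next
    case False
    then show ?thesis
      using low c(1) le(2) by blast
  qed
  show ?thesis2
  proof (cases "(1 - e) * p = 0")
    case True
    then show ?thesis
      using low sum by simp
  next
    case False
    then show ?thesis
      using up c(2) le(4) by blast
  qed
qed

lemma bounded_above_on_component:
  assumes "component p" "p \<noteq> 0"
  obtains q K where "component q" "q \<noteq> 0" "q * p = q" "q * f \<le> K *\<^sub>R q"
proof -
  have "\<exists>q K. component q \<and> q \<noteq> 0 \<and> q * p = q \<and> q * f \<le> K *\<^sub>R q"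
  proof (rule ccontr)
    assume *: "\<not> ?thesis"
    have "t *\<^sub>R p \<le> p * f" for t
      using component_level_dichotomy(2)[OF assms(1), of t f] * by blast
    then have "p \<le> 0"
      by (intro archimedean_vector_lattice[where y = "p * f"])
    then show False
      using assms componentD(1) by (metis order.antisym)
  qed
  then show thesis
    using that by blast
qed

lemma bounded_on_component:
  assumes "component p" "p \<noteq> 0"
  obtains q K where "component q" "q \<noteq> 0" "q * p = q" "- K *\<^sub>R q \<le> q * f" "q * f \<le> K *\<^sub>R q"
proof -
  obtain q1 K1 where 1: "component q1" "q1 \<noteq> 0" "q1 * p = q1" "q1 * f \<le> K1 *\<^sub>R q1"
    using bounded_above_on_component[OF assms] by blast
  obtain q K2 where 2: "component q" "q \<noteq> 0" "q * q1 = q" "q * (- f) \<le> K2 *\<^sub>R q"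
    using bounded_above_on_component[OF 1(1,2)] by blast
  have "q * f \<le> K1 *\<^sub>R q"
    by (rule component_restrict_upper[OF 2(1,3) 1(4)])
  also have "\<dots> \<le> max K1 K2 *\<^sub>R q"
    using 2(1) by (intro scaleR_right_mono) (auto simp: componentD)
  finally have u: "q * f \<le> max K1 K2 *\<^sub>R q" .
  have "q * (- f) \<le> max K1 K2 *\<^sub>R q"
    using 2(4) by (rule order.trans) (use 2(1) in \<open>intro scaleR_right_mono; auto simp: componentD\<close>)
  then have "- (max K1 K2) *\<^sub>R q \<le> q * f"
    by (simp add: minus_le_iff)
  with u show thesis
    using that[OF 2(1,2)] component_le_trans[OF 2(3) 1(3)] by blast
qed

lemma finitely_many_bounded_on_component:
  assumes "finite H" "component p" "p \<noteq> 0"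
  obtains q where "component q" "q \<noteq> 0" "q * p = q"
    "\<And>h. h \<in> H \<Longrightarrow> \<exists>K. - K *\<^sub>R q \<le> q * h \<and> q * h \<le> K *\<^sub>R q"
proof -
  have "\<exists>q. component q \<and> q \<noteq> 0 \<and> q * p = q \<and> (\<forall>h\<in>H. \<exists>K. - K *\<^sub>R q \<le> q * h \<and> q * h \<le> K *\<^sub>R q)"
    using assms(1)
  proof induction
    case empty
    then show ?case
      using assms componentD by auto
  next
    case (insert h H)
    then obtain q where q: "component q" "q \<noteq> 0" "q * p = q"
      "\<And>h. h \<in> H \<Longrightarrow> \<exists>K. - K *\<^sub>R q \<le> q * h \<and> q * h \<le> K *\<^sub>R q"
      by auto
    obtain r K where r: "component r" "r \<noteq> 0" "r * q = r" "- K *\<^sub>R r \<le> r * h" "r * h \<le> K *\<^sub>R r"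
      using bounded_on_component[OF q(1,2)] by blast
    have "\<exists>K. - K *\<^sub>R r \<le> r * h' \<and> r * h' \<le> K *\<^sub>R r" if h': "h' \<in> H" for h'
      using q(4)[OF h'] component_restrict_upper[OF r(1,3)] component_restrict_lower[OF r(1,3)]
      by blast
    then show ?case
      using r component_le_trans[OF r(3) q(3)] by (intro exI[of _ r]) auto
  qed
  then show thesis
    using that by blast
qed


section \<open>Real values along ultrafilters of components\<close>

definition ultrafilter ::
    "'a :: {universally_complete_vector_lattice, phi_algebra} set \<Rightarrow> bool" where
  "ultrafilter F \<longleftrightarrow> (\<forall>p\<in>F. component p) \<and> 0 \<notin> F \<and> 1 \<in> F \<and>
     (\<forall>p\<in>F. \<forall>q\<in>F. p * q \<in> F) \<and> (\<forall>p. component p \<longrightarrow> p \<in> F \<or> 1 - p \<in> F)"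

lemma ultrafilterD:
  assumes "ultrafilter F"
  shows "p \<in> F \<Longrightarrow> component p" "p \<in> F \<Longrightarrow> p \<noteq> 0" "1 \<in> F" "p \<in> F \<Longrightarrow> q \<in> F \<Longrightarrow> p * q \<in> F"
    "component p \<Longrightarrow> p \<in> F \<or> 1 - p \<in> F"
  using assms by (auto simp: ultrafilter_def)

text \<open>
  In a maximal multiplicatively closed set \<open>M\<close> without \<open>0\<close>, a component outside \<open>M\<close> is annihilated by
  some member. If neither \<open>c\<close> nor \<open>1 - c\<close> belonged to \<open>M\<close>, the product of the two annihilating
  members would be \<open>0\<close>.
\<close>

lemma ultrafilter_exists:
  fixes p :: "'a :: {universally_complete_vector_lattice, phi_algebra}"
  assumes p: "component p" "p \<noteq> 0"
  obtains F where "ultrafilter F" "p \<in> F"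
proof -
  define good where "good F \<longleftrightarrow> (\<forall>p\<in>F. component p) \<and> 0 \<notin> F \<and> 1 \<in> F \<and>
     (\<forall>p\<in>F. \<forall>q\<in>F. p * q \<in> F)" for F :: "'a set"
  have "(1 :: 'a) \<noteq> 0"
    using p by (metis mult_1_right mult_zero_right)
  then have init: "good {1, p}"
    using p by (auto simp: good_def componentD)
  have "\<exists>M\<in>{F. good F \<and> p \<in> F}. \<forall>X\<in>{F. good F \<and> p \<in> F}. M \<subseteq> X \<longrightarrow> X = M"
  proof (rule subset_Zorn_nonempty)
    show "{F. good F \<and> p \<in> F} \<noteq> {}"
      using init by blast
    fix C assume C: "C \<noteq> {}" "subset.chain {F. good F \<and> p \<in> F} C"
    have sub: "C \<subseteq> {F. good F \<and> p \<in> F}" and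
      chain: "\<And>X Y. X \<in> C \<Longrightarrow> Y \<in> C \<Longrightarrow> X \<subseteq> Y \<or> Y \<subseteq> X"
      using C(2) by (auto simp: subset.chain_def)
    have "x * y \<in> \<Union>C" if xy: "x \<in> \<Union>C" "y \<in> \<Union>C" for x y
    proof -
      obtain X Y where "X \<in> C" "x \<in> X" "Y \<in> C" "y \<in> Y"
        using xy by blast
      then obtain Z where "Z \<in> C" "x \<in> Z" "y \<in> Z"
        using chain[of X Y] by blast
      then show ?thesis
        using sub unfolding good_def by blast
    qed
    then show "\<Union>C \<in> {F. good F \<and> p \<in> F}"
      using C(1) sub unfolding good_def by blast
  qed
  then obtain M where M: "good M" "p \<in> M" and max: "\<And>X. good X \<Longrightarrow> M \<subseteq> X \<Longrightarrow> X = M"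
    by (smt (verit) mem_Collect_eq subset_eq)
  have M': "\<And>q. q \<in> M \<Longrightarrow> component q" "0 \<notin> M" "1 \<in> M"
    "\<And>q r. q \<in> M \<Longrightarrow> r \<in> M \<Longrightarrow> q * r \<in> M"
    using M(1) by (auto simp: good_def)
  have kill: "\<exists>q\<in>M. q * c = 0" if c: "component c" "c \<notin> M" for c
  proof (rule ccontr)
    assume *: "\<not> ?thesis"
    define X where "X = M \<union> (\<lambda>q. q * c) ` M"
    have cc: "c * q = q * c" for q
      using component_commute[OF c(1)] .
    have "q * c * r = (q * r) * c" "q * c * (r * c) = (q * r) * c" if "r \<in> M" for q r
      using componentD(3)[OF c(1)] cc[of r] by (metis mult.assoc)+
    then have "good X"
      using M' * component_mult[OF _ c(1)]
      by (auto simp: good_def X_def image_iff mult.assoc[symmetric])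
    then have "X = M"
      by (rule max) (simp add: X_def)
    moreover have "1 * c \<in> X"
      using M'(3) unfolding X_def by blast
    ultimately show False
      using c(2) by simp
  qed
  have "c \<in> M \<or> 1 - c \<in> M" if c: "component c" for c
  proof (rule ccontr)
    assume *: "\<not> ?thesis"
    obtain q where q: "q \<in> M" "q * c = 0"
      using kill[OF c] * by blast
    obtain r where r: "r \<in> M" "r * (1 - c) = 0"
      using kill[OF component_compl[OF c]] * by blast
    have "r = r * c"
      using r(2) by (simp add: right_diff_distrib)
    then have "r * q = r * (c * q)"
      by (metis mult.assoc)
    also have "\<dots> = 0"
      using q(2) component_commute[OF c, of q] by simp
    finally show False
      using M'(4)[OF r(1) q(1)] M'(2) by simp
  qed
  then have "ultrafilter M"
    using M' by (auto simp: ultrafilter_def)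
  then show thesis
    using that M(2) by blast
qed

text \<open>
  The value is a real number: an element that exceeds every constant on the members of \<open>F\<close> has none.
\<close>

definition has_value ::
    "'a :: {universally_complete_vector_lattice, phi_algebra} set \<Rightarrow> 'a \<Rightarrow> real \<Rightarrow> bool" where
  "has_value F f \<alpha> \<longleftrightarrow> (\<forall>\<epsilon>>0. \<exists>p\<in>F. (\<alpha> - \<epsilon>) *\<^sub>R p \<le> p * f \<and> p * f \<le> (\<alpha> + \<epsilon>) *\<^sub>R p)"

text \<open>
  On a common refinement of \<open>p\<close> and of the members where \<open>f\<close> and \<open>g\<close> are almost constant, the
  inequality compares two multiples of one nonzero component.
\<close>

lemma has_value_le:
  assumes F: "ultrafilter F" and "has_value F f \<alpha>" "has_value F g \<beta>"
    and p: "p \<in> F" "p * f \<le> p * g"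
  shows "\<alpha> \<le> \<beta>"
proof (rule ccontr)
  assume "\<not> \<alpha> \<le> \<beta>"
  define \<epsilon> where "\<epsilon> = (\<alpha> - \<beta>) / 3"
  have \<epsilon>: "\<epsilon> > 0" "\<beta> + \<epsilon> < \<alpha> - \<epsilon>"
    using \<open>\<not> \<alpha> \<le> \<beta>\<close> by (auto simp: \<epsilon>_def field_simps)
  obtain q where q: "q \<in> F" "(\<alpha> - \<epsilon>) *\<^sub>R q \<le> q * f"
    using assms(2) \<epsilon>(1) by (auto simp: has_value_def)
  obtain r where r: "r \<in> F" "r * g \<le> (\<beta> + \<epsilon>) *\<^sub>R r"
    using assms(3) \<epsilon>(1) by (auto simp: has_value_def)
  note c = ultrafilterD(1)[OF F]
  define s where "s = p * (q * r)"
  have s: "s \<in> F"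
    unfolding s_def by (intro ultrafilterD(4)[OF F] p q r)
  have qr: "q * r * q = q * r" "q * r * r = q * r"
    using component_mult_le[OF c[OF q(1)] c[OF r(1)]] by auto
  have sqr: "s * p = s" "s * (q * r) = s"
    unfolding s_def using component_mult_le[OF c[OF p(1)] component_mult[OF c[OF q(1)] c[OF r(1)]]] by auto
  have "(\<alpha> - \<epsilon>) *\<^sub>R s \<le> s * f"
    using component_restrict_lower[OF c[OF s] component_le_trans[OF sqr(2) qr(1)] q(2)] .
  also have "\<dots> \<le> s * g"
    using component_restrict[OF c[OF s] sqr(1) p(2)] .
  also have "\<dots> \<le> (\<beta> + \<epsilon>) *\<^sub>R s"
    using component_restrict_upper[OF c[OF s] component_le_trans[OF sqr(2) qr(2)] r(2)] .
  finally show False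
    using component_scaleR_le_iff[OF c[OF s] ultrafilterD(2)[OF F s]] \<epsilon>(2) by simp
qed

lemma has_value_unique:
  assumes "ultrafilter F" "has_value F f \<alpha>" "has_value F f \<beta>"
  shows "\<alpha> = \<beta>"
  using has_value_le[OF assms ultrafilterD(3)[OF assms(1)]]
    has_value_le[OF assms(1,3,2) ultrafilterD(3)[OF assms(1)]] by simp

text \<open>
  The value is the supremum of the levels \<open>t\<close> that \<open>f\<close> reaches on some member. At any level above it,
  the ultrafilter contains the component where \<open>f\<close> stays below that level.
\<close>

lemma has_value_exists:
  assumes F: "ultrafilter F" and p: "p \<in> F" "A *\<^sub>R p \<le> p * f" "p * f \<le> B *\<^sub>R p"
  shows "\<exists>\<alpha>. has_value F f \<alpha>"
proof -
  note c = ultrafilterD(1)[OF F]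
  define T where "T = {t. \<exists>q\<in>F. t *\<^sub>R q \<le> q * f}"
  have T1: "A \<in> T"
    using p by (auto simp: T_def)
  have T2: "t \<le> B" if t: "t \<in> T" for t
  proof -
    obtain q where q: "q \<in> F" "t *\<^sub>R q \<le> q * f"
      using t by (auto simp: T_def)
    have s: "p * q \<in> F"
      by (intro ultrafilterD(4)[OF F] p q)
    have "t *\<^sub>R (p * q) \<le> (p * q) * f"
      using component_restrict_lower[OF c[OF s] _ q(2)] component_mult_le[OF c[OF p(1)] c[OF q(1)]]
      by simp
    also have "\<dots> \<le> B *\<^sub>R (p * q)"
      using component_restrict_upper[OF c[OF s] _ p(3)] component_mult_le[OF c[OF p(1)] c[OF q(1)]]
      by simp
    finally show ?thesis
      using component_scaleR_le_iff[OF c[OF s] ultrafilterD(2)[OF F s]] by simp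
  qed
  have bdd: "bdd_above T"
    using T2 by (auto simp: bdd_above_def)
  have "\<exists>q\<in>F. (Sup T - \<epsilon>) *\<^sub>R q \<le> q * f \<and> q * f \<le> (Sup T + \<epsilon>) *\<^sub>R q" if "\<epsilon> > 0" for \<epsilon>
  proof -
    obtain t where t: "t \<in> T" "Sup T - \<epsilon> < t"
      using less_cSup_iff[of T "Sup T - \<epsilon>"] T1 bdd \<open>\<epsilon> > 0\<close> by auto
    obtain q where q: "q \<in> F" "t *\<^sub>R q \<le> q * f"
      using t(1) by (auto simp: T_def)
    have "(Sup T - \<epsilon>) *\<^sub>R q \<le> t *\<^sub>R q"
      using component_scaleR_le_iff[OF c[OF q(1)] ultrafilterD(2)[OF F q(1)]] t(2) by simp
    with q have q2: "(Sup T - \<epsilon>) *\<^sub>R q \<le> q * f"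
      by (meson order_trans)
    obtain e where e: "component e" "(Sup T + \<epsilon>) *\<^sub>R e \<le> e * f" "(1 - e) * f \<le> (Sup T + \<epsilon>) *\<^sub>R (1 - e)"
      by (rule component_split_level)
    have "e \<notin> F"
    proof
      assume "e \<in> F"
      then have "Sup T + \<epsilon> \<in> T"
        using e(2) by (auto simp: T_def)
      then show False
        using cSup_upper[OF _ bdd] \<open>\<epsilon> > 0\<close> by fastforce
    qed
    then have e': "1 - e \<in> F"
      using ultrafilterD(5)[OF F e(1)] by simp
    define s where "s = (1 - e) * q"
    have s: "s \<in> F"
      unfolding s_def by (intro ultrafilterD(4)[OF F] e' q)
    have sq: "s * (1 - e) = s" "s * q = s"
      unfolding s_def using component_mult_le[OF c[OF e'] c[OF q(1)]] by auto
    show ?thesis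
      using s component_restrict_lower[OF c[OF s] sq(2) q2] component_restrict_upper[OF c[OF s] sq(1) e(3)]
      by blast
  qed
  then show ?thesis
    unfolding has_value_def by blast
qed

lemma has_value_common:
  assumes F: "ultrafilter F" and "has_value F f \<alpha>" "has_value F g \<beta>" "\<epsilon> > 0"
  obtains p where "p \<in> F" "(\<alpha> - \<epsilon>) *\<^sub>R p \<le> p * f" "p * f \<le> (\<alpha> + \<epsilon>) *\<^sub>R p"
    "(\<beta> - \<epsilon>) *\<^sub>R p \<le> p * g" "p * g \<le> (\<beta> + \<epsilon>) *\<^sub>R p"
proof -
  note c = ultrafilterD(1)[OF F]
  obtain q where q: "q \<in> F" "(\<alpha> - \<epsilon>) *\<^sub>R q \<le> q * f" "q * f \<le> (\<alpha> + \<epsilon>) *\<^sub>R q"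
    using assms(2,4) by (auto simp: has_value_def)
  obtain r where r: "r \<in> F" "(\<beta> - \<epsilon>) *\<^sub>R r \<le> r * g" "r * g \<le> (\<beta> + \<epsilon>) *\<^sub>R r"
    using assms(3,4) by (auto simp: has_value_def)
  have s: "q * r \<in> F"
    by (intro ultrafilterD(4)[OF F] q r)
  note le = component_mult_le[OF c[OF q(1)] c[OF r(1)]]
  show thesis
    using that[OF s] component_restrict_upper[OF c[OF s] le(1) q(3)] component_restrict_lower[OF c[OF s] le(1) q(2)]
      component_restrict_upper[OF c[OF s] le(2) r(3)] component_restrict_lower[OF c[OF s] le(2) r(2)]
    by blast
qed

lemma has_value_add:
  assumes F: "ultrafilter F" and "has_value F f \<alpha>" "has_value F g \<beta>"
  shows "has_value F (f + g) (\<alpha> + \<beta>)"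
  unfolding has_value_def
proof (intro allI impI)
  fix \<epsilon> :: real assume "\<epsilon> > 0"
  then obtain p where p: "p \<in> F" "(\<alpha> - \<epsilon> / 2) *\<^sub>R p \<le> p * f" "p * f \<le> (\<alpha> + \<epsilon> / 2) *\<^sub>R p"
    "(\<beta> - \<epsilon> / 2) *\<^sub>R p \<le> p * g" "p * g \<le> (\<beta> + \<epsilon> / 2) *\<^sub>R p"
    using has_value_common[OF assms, of "\<epsilon> / 2"] by auto
  have "(\<alpha> - \<epsilon> / 2) *\<^sub>R p + (\<beta> - \<epsilon> / 2) *\<^sub>R p \<le> p * f + p * g"
    using p by (intro add_mono)
  moreover have "p * f + p * g \<le> (\<alpha> + \<epsilon> / 2) *\<^sub>R p + (\<beta> + \<epsilon> / 2) *\<^sub>R p"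
    using p by (intro add_mono)
  moreover have "(\<alpha> - \<epsilon> / 2) *\<^sub>R p + (\<beta> - \<epsilon> / 2) *\<^sub>R p = (\<alpha> + \<beta> - \<epsilon>) *\<^sub>R p"
    "(\<alpha> + \<epsilon> / 2) *\<^sub>R p + (\<beta> + \<epsilon> / 2) *\<^sub>R p = (\<alpha> + \<beta> + \<epsilon>) *\<^sub>R p"
    by (simp_all only: scaleR_left_distrib[symmetric], simp_all)
  ultimately show "\<exists>p\<in>F. (\<alpha> + \<beta> - \<epsilon>) *\<^sub>R p \<le> p * (f + g) \<and> p * (f + g) \<le> (\<alpha> + \<beta> + \<epsilon>) *\<^sub>R p"
    using p(1) by (auto simp: distrib_left)
qed

lemma has_value_1:
  assumes F: "ultrafilter F"
  shows "has_value F 1 1"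
  unfolding has_value_def
proof (intro allI impI bexI conjI)
  fix \<epsilon> :: real assume "\<epsilon> > 0"
  then show "(1 - \<epsilon>) *\<^sub>R 1 \<le> (1 :: 'a) * 1" "(1 :: 'a) * 1 \<le> (1 + \<epsilon>) *\<^sub>R 1"
    using scaleR_right_mono[of "1 - \<epsilon>" 1 "1 :: 'a"] scaleR_right_mono[of 1 "1 + \<epsilon>" "1 :: 'a"]
      zero_le_one_phi by simp_all
qed (rule ultrafilterD(3)[OF F])

lemma has_value_minus:
  assumes "has_value F f \<alpha>"
  shows "has_value F (- f) (- \<alpha>)"
  unfolding has_value_def
proof (intro allI impI)
  fix \<epsilon> :: real assume "\<epsilon> > 0"
  then obtain p where p: "p \<in> F" "(\<alpha> - \<epsilon>) *\<^sub>R p \<le> p * f" "p * f \<le> (\<alpha> + \<epsilon>) *\<^sub>R p"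
    using assms by (auto simp: has_value_def)
  then have "- (p * f) \<le> - ((\<alpha> - \<epsilon>) *\<^sub>R p)" "- ((\<alpha> + \<epsilon>) *\<^sub>R p) \<le> - (p * f)"
    by (simp_all only: neg_le_iff_le)
  moreover have "- ((\<alpha> - \<epsilon>) *\<^sub>R p) = (- \<alpha> + \<epsilon>) *\<^sub>R p" "- ((\<alpha> + \<epsilon>) *\<^sub>R p) = (- \<alpha> - \<epsilon>) *\<^sub>R p"
    by (simp_all flip: scaleR_minus_left)
  ultimately show "\<exists>p\<in>F. (- \<alpha> - \<epsilon>) *\<^sub>R p \<le> p * (- f) \<and> p * (- f) \<le> (- \<alpha> + \<epsilon>) *\<^sub>R p"
    using p(1) by auto
qed

lemma has_value_scaleR:
  assumes F: "ultrafilter F" and "has_value F f \<alpha>"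
  shows "has_value F (t *\<^sub>R f) (t * \<alpha>)"
proof -
  have pos: "has_value F (t *\<^sub>R f) (t * \<alpha>)" if "t > 0" for t
    unfolding has_value_def
  proof (intro allI impI)
    fix \<epsilon> :: real assume "\<epsilon> > 0"
    then have "\<epsilon> / t > 0"
      using that by simp
    then obtain p where p: "p \<in> F" "(\<alpha> - \<epsilon> / t) *\<^sub>R p \<le> p * f" "p * f \<le> (\<alpha> + \<epsilon> / t) *\<^sub>R p"
      using assms(2) unfolding has_value_def by meson
    have "(t * \<alpha> - \<epsilon>) *\<^sub>R p \<le> t *\<^sub>R (p * f)"
      using scaleR_left_mono[OF p(2), of t] that by (simp add: right_diff_distrib)
    moreover have "t *\<^sub>R (p * f) \<le> (t * \<alpha> + \<epsilon>) *\<^sub>R p"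
      using scaleR_left_mono[OF p(3), of t] that by (simp add: distrib_left)
    ultimately show "\<exists>p\<in>F. (t * \<alpha> - \<epsilon>) *\<^sub>R p \<le> p * (t *\<^sub>R f) \<and> p * (t *\<^sub>R f) \<le> (t * \<alpha> + \<epsilon>) *\<^sub>R p"
      using p(1) by auto
  qed
  consider "t > 0" | "t = 0" | "- t > 0"
    by linarith
  then show ?thesis
  proof cases
    case 1
    then show ?thesis
      by (rule pos)
  next
    case 2
    have "has_value F 0 0"
      using has_value_add[OF F has_value_1[OF F] has_value_minus[OF has_value_1[OF F]]] by simp
    then show ?thesis
      using 2 by simp
  next
    case 3
    then show ?thesis
      using has_value_minus[OF pos[OF 3]] by simp
  qed
qed

lemma has_value_const:
  assumes F: "ultrafilter F"
  shows "has_value F (t *\<^sub>R 1) t"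
  using has_value_scaleR[OF F has_value_1[OF F], of t] by simp

text \<open>If \<open>-\<epsilon> p \<le> u, v \<le> \<epsilon> p\<close> then \<open>\<bar>uv\<bar> \<le> \<epsilon>\<^sup>2 p\<close>, as \<open>(\<epsilon> p + u)(\<epsilon> p - v) + (\<epsilon> p - u)(\<epsilon> p + v) \<ge> 0\<close>.\<close>

lemma has_value_mult_0:
  assumes F: "ultrafilter F" and "has_value F f 0" "has_value F g 0"
  shows "has_value F (f * g) 0"
  unfolding has_value_def
proof (intro allI impI)
  fix \<epsilon> :: real assume "\<epsilon> > 0"
  note c = ultrafilterD(1)[OF F]
  define \<delta> where "\<delta> = sqrt \<epsilon>"
  have \<delta>: "\<delta> > 0" "\<delta> * \<delta> = \<epsilon>"
    using \<open>\<epsilon> > 0\<close> by (auto simp: \<delta>_def)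
  obtain p where p: "p \<in> F" "- \<delta> *\<^sub>R p \<le> p * f" "p * f \<le> \<delta> *\<^sub>R p"
    "- \<delta> *\<^sub>R p \<le> p * g" "p * g \<le> \<delta> *\<^sub>R p"
    using has_value_common[OF F assms(2,3) \<delta>(1)] by auto
  define u v w where "u = p * f" and "v = p * g" and "w = \<delta> *\<^sub>R p"
  have pp: "p * p = p"
    using c[OF p(1)] by (simp add: componentD)
  have pf: "f * p = p * f" "g * p = p * g"
    using component_commute[OF c[OF p(1)]] by simp_all
  have "p * (p * x) = p * x" for x
    using pp by (metis mult.assoc)
  then have uw: "u * w = \<delta> *\<^sub>R u" "w * u = \<delta> *\<^sub>R u" "v * w = \<delta> *\<^sub>R v" "w * v = \<delta> *\<^sub>R v" "w * w = \<epsilon> *\<^sub>R p"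
    using pp \<delta>(2) by (simp_all add: u_def v_def w_def mult.assoc pf)
  have "p * f * (p * g) = p * (f * p) * g"
    by (simp add: mult.assoc)
  then have uv: "u * v = p * (f * g)"
    using \<open>\<And>x. p * (p * x) = p * x\<close> by (simp add: u_def v_def pf mult.assoc)
  have nn: "0 \<le> w - u" "0 \<le> w + u" "0 \<le> w - v" "0 \<le> w + v"
  proof -
    have "- w \<le> u" "u \<le> w" "- w \<le> v" "v \<le> w"
      using p by (simp_all add: u_def v_def w_def)
    then show "0 \<le> w - u" "0 \<le> w + u" "0 \<le> w - v" "0 \<le> w + v"
      by (simp_all add: minus_le_iff neg_le_iff_le le_diff_eq flip: diff_le_eq)
  qed
  have "0 \<le> (w + u) * (w - v) + (w - u) * (w + v)" "0 \<le> (w + u) * (w + v) + (w - u) * (w - v)"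
    using nn by (auto intro!: add_nonneg_nonneg mult_nonneg_nonneg)
  moreover have "(w + u) * (w - v) + (w - u) * (w + v) = 2 *\<^sub>R (w * w - u * v)"
    "(w + u) * (w + v) + (w - u) * (w - v) = 2 *\<^sub>R (w * w + u * v)"
    using uw by (simp_all add: distrib_left distrib_right left_diff_distrib right_diff_distrib scaleR_2)
  ultimately have "0 \<le> w * w - u * v" "0 \<le> w * w + u * v"
    by (simp_all only: zero_le_scaleR_iff) simp_all
  then have "0 \<le> \<epsilon> *\<^sub>R p - p * (f * g)" "0 \<le> \<epsilon> *\<^sub>R p + p * (f * g)"
    using uw(5) uv by simp_all
  then have "p * (f * g) \<le> \<epsilon> *\<^sub>R p" "- (\<epsilon> *\<^sub>R p) \<le> p * (f * g)"
    using diff_le_eq[of 0 "\<epsilon> *\<^sub>R p" "p * (f * g)"] by (simp_all add: add.commute)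
  then show "\<exists>p\<in>F. (0 - \<epsilon>) *\<^sub>R p \<le> p * (f * g) \<and> p * (f * g) \<le> (0 + \<epsilon>) *\<^sub>R p"
    using p(1) by auto
qed

text \<open>Subtracting the values reduces this to factors with value \<open>0\<close>.\<close>

lemma has_value_mult:
  assumes F: "ultrafilter F" and "has_value F f \<alpha>" "has_value F g \<beta>"
  shows "has_value F (f * g) (\<alpha> * \<beta>)"
proof -
  define u v where "u = f - \<alpha> *\<^sub>R 1" and "v = g - \<beta> *\<^sub>R 1"
  have "has_value F u 0" "has_value F v 0"
    using has_value_add[OF F assms(2) has_value_minus[OF has_value_const[OF F, of \<alpha>]]]
      has_value_add[OF F assms(3) has_value_minus[OF has_value_const[OF F, of \<beta>]]]
    by (simp_all add: u_def v_def)
  then have "has_value F (u * v + (\<alpha> *\<^sub>R v + (\<beta> *\<^sub>R u + (\<alpha> * \<beta>) *\<^sub>R 1))) (0 + (\<alpha> * 0 + (\<beta> * 0 + \<alpha> * \<beta>)))"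
    by (intro has_value_add[OF F] has_value_mult_0[OF F] has_value_scaleR[OF F] has_value_const[OF F])
  moreover have "f * g = (u + \<alpha> *\<^sub>R 1) * (v + \<beta> *\<^sub>R 1)"
    by (simp add: u_def v_def)
  then have "f * g = u * v + (\<alpha> *\<^sub>R v + (\<beta> *\<^sub>R u + (\<alpha> * \<beta>) *\<^sub>R 1))"
    by (simp add: distrib_left distrib_right mult.commute add.assoc add.left_commute add.commute scaleR_right_distrib)
  ultimately show ?thesis
    by simp
qed

definition finite_at ::
    "'a :: {universally_complete_vector_lattice, phi_algebra} set \<Rightarrow> 'a \<Rightarrow> bool" where
  "finite_at F f \<longleftrightarrow> (\<exists>\<alpha>. has_value F f \<alpha>)"

definition value_at ::
    "'a :: {universally_complete_vector_lattice, phi_algebra} set \<Rightarrow> 'a \<Rightarrow> real" where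
  "value_at F f = (THE \<alpha>. has_value F f \<alpha>)"

lemma value_atI:
  assumes "ultrafilter F" "has_value F f \<alpha>"
  shows "finite_at F f" "value_at F f = \<alpha>"
  using assms has_value_unique[OF assms(1)] by (auto simp: finite_at_def value_at_def)

lemma has_value_at:
  assumes "ultrafilter F" "finite_at F f"
  shows "has_value F f (value_at F f)"
  using assms value_atI(2)[OF assms(1)] by (auto simp: finite_at_def)

lemma value_at_hom:
  assumes F: "ultrafilter F" and f: "finite_at F f" and g: "finite_at F g"
  shows finite_at_add: "finite_at F (f + g)" and value_at_add: "value_at F (f + g) = value_at F f + value_at F g"
    and finite_at_mult: "finite_at F (f * g)" and value_at_mult: "value_at F (f * g) = value_at F f * value_at F g"
    and finite_at_diff: "finite_at F (f - g)" and value_at_diff: "value_at F (f - g) = value_at F f - value_at F g"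
  using value_atI[OF F has_value_add[OF F has_value_at[OF F f] has_value_at[OF F g]]]
    value_atI[OF F has_value_mult[OF F has_value_at[OF F f] has_value_at[OF F g]]]
    value_atI[OF F has_value_add[OF F has_value_at[OF F f] has_value_minus[OF has_value_at[OF F g]]]]
  by simp_all

lemma finite_value_at_scaleR:
  assumes F: "ultrafilter F" and f: "finite_at F f"
  shows finite_at_scaleR: "finite_at F (t *\<^sub>R f)" and value_at_scaleR: "value_at F (t *\<^sub>R f) = t * value_at F f"
  using value_atI[OF F has_value_scaleR[OF F has_value_at[OF F f]]] by simp_all

lemma value_at_const:
  assumes F: "ultrafilter F"
  shows finite_at_1: "finite_at F 1" and value_at_1: "value_at F 1 = 1"
    and finite_at_0: "finite_at F 0" and value_at_0: "value_at F 0 = 0"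
  using value_atI[OF F has_value_1[OF F]] value_atI[OF F has_value_const[OF F, of 0]] by simp_all

lemma finite_value_at_power:
  assumes F: "ultrafilter F" and f: "finite_at F f"
  shows finite_at_power: "finite_at F (f ^ n)" and value_at_power: "value_at F (f ^ n) = value_at F f ^ n"
  by (induction n)
    (simp_all add: finite_at_1[OF F] value_at_1[OF F] finite_at_mult[OF F f] value_at_mult[OF F f])

lemmas finite_at_intros =
  finite_at_add finite_at_mult finite_at_diff finite_at_scaleR finite_at_1 finite_at_0 finite_at_power

lemmas value_at_simps =
  value_at_add value_at_mult value_at_diff value_at_scaleR value_at_1 value_at_0 value_at_power

lemma value_at_mono_on:
  assumes "ultrafilter F" "finite_at F f" "finite_at F g" "p \<in> F" "p * f \<le> p * g"
  shows "value_at F f \<le> value_at F g"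
  using has_value_le[OF assms(1) has_value_at[OF assms(1,2)] has_value_at[OF assms(1,3)] assms(4,5)] .

lemma value_at_mono:
  assumes "ultrafilter F" "finite_at F f" "finite_at F g" "f \<le> g"
  shows "value_at F f \<le> value_at F g"
  using value_at_mono_on[OF assms(1-3) ultrafilterD(3)[OF assms(1)]] assms(4) by simp

lemma value_at_nonneg:
  assumes "ultrafilter F" "finite_at F f" "0 \<le> f"
  shows "0 \<le> value_at F f"
  using value_at_mono[OF assms(1) finite_at_0[OF assms(1)] assms(2,3)] value_at_0[OF assms(1)] by simp

lemma value_at_le_on:
  assumes "ultrafilter F" "finite_at F f" "p \<in> F" "p * f \<le> t *\<^sub>R p"
  shows "value_at F f \<le> t"
  using value_at_mono_on[OF assms(1,2), of "t *\<^sub>R 1" p] assms value_at_scaleR[OF assms(1), of 1 t]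
  by (simp add: finite_at_intros value_at_simps)

lemma value_at_ge_on:
  assumes "ultrafilter F" "finite_at F f" "p \<in> F" "t *\<^sub>R p \<le> p * f"
  shows "t \<le> value_at F f"
  using value_at_mono_on[OF assms(1) _ assms(2,3), of "t *\<^sub>R 1"] assms value_at_scaleR[OF assms(1), of 1 t]
  by (simp add: finite_at_intros value_at_simps)

lemma value_at_less_on:
  assumes F: "ultrafilter F" "finite_at F f" "value_at F f < t"
  obtains p where "p \<in> F" "p * f \<le> t *\<^sub>R p"
  using has_value_at[OF F(1,2)] F(3) unfolding has_value_def
  by (auto dest!: spec[of _ "t - value_at F f"])

lemma value_at_greater_on:
  assumes F: "ultrafilter F" "finite_at F f" "t < value_at F f"
  obtains p where "p \<in> F" "t *\<^sub>R p \<le> p * f"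
  using has_value_at[OF F(1,2)] F(3) unfolding has_value_def
  by (auto dest!: spec[of _ "value_at F f - t"])

lemma finite_value_at_component:
  assumes F: "ultrafilter F" and p: "component p"
  shows finite_at_component: "finite_at F p"
    and value_at_component: "value_at F p = (if p \<in> F then 1 else 0)"
proof -
  have "has_value F p (if p \<in> F then 1 else 0)"
  proof (cases "p \<in> F")
    case True
    have "p * p = p" "0 \<le> p"
      using p by (auto simp: componentD)
    then show ?thesis
      using True
      by (auto simp: has_value_def intro!: bexI[of _ p] scaleR_nonneg_nonneg
          simp: scaleR_left_diff_distrib scaleR_left_distrib)
  next
    case False
    then have "1 - p \<in> F"
      using ultrafilterD(5)[OF F p] by simp
    moreover have "0 \<le> 1 - p"
      using p by (simp add: componentD)
    ultimately show ?thesis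
      using False p by (auto simp: has_value_def intro!: bexI[of _ "1 - p"] scaleR_nonneg_nonneg)
  qed
  then show "finite_at F p" "value_at F p = (if p \<in> F then 1 else 0)"
    using value_atI[OF F] by auto
qed

lemma finite_values_on_component:
  assumes "component p" "p \<noteq> 0" "finite H"
  obtains F where "ultrafilter F" "p \<in> F" "\<And>h. h \<in> H \<Longrightarrow> finite_at F h"
proof -
  obtain q where q: "component q" "q \<noteq> 0" "q * p = q"
    "\<And>h. h \<in> H \<Longrightarrow> \<exists>K. - K *\<^sub>R q \<le> q * h \<and> q * h \<le> K *\<^sub>R q"
    using finitely_many_bounded_on_component[OF assms(3,1,2)] by metis
  obtain F where F: "ultrafilter F" "q \<in> F"
    using ultrafilter_exists[OF q(1,2)] .
  have "p \<in> F"
  proof (rule ccontr)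
    assume "p \<notin> F"
    then have "1 - p \<in> F"
      using ultrafilterD(5)[OF F(1) assms(1)] by simp
    then have "q * (1 - p) \<in> F"
      using ultrafilterD(4)[OF F(1,2)] by simp
    then show False
      using q(3) ultrafilterD(2)[OF F(1)] by (auto simp: right_diff_distrib)
  qed
  moreover have "finite_at F h" if "h \<in> H" for h
    using q(4)[OF that] has_value_exists[OF F] unfolding finite_at_def by blast
  ultimately show thesis
    using that F(1) by blast
qed

text \<open>
  The transfer principle. On some component \<open>f - g \<ge> t > 0\<close>; shrinking it makes the finitely many
  elements bounded, and any ultrafilter through it serves.
\<close>

lemma not_le_value_at:
  fixes f g :: "'a :: {universally_complete_vector_lattice, phi_algebra}"
  assumes "\<not> f \<le> g" "finite H"
  obtains F where "ultrafilter F" "finite_at F f" "finite_at F g"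
    "\<And>h. h \<in> H \<Longrightarrow> finite_at F h" "value_at F g < value_at F f"
proof -
  have "\<not> f - g \<le> 0"
    using assms(1) by simp
  then obtain q t where q: "component q" "q \<noteq> 0" "t > 0" "t *\<^sub>R q \<le> q * (f - g)"
    using positive_on_component by blast
  obtain F where F: "ultrafilter F" "q \<in> F" "\<And>h. h \<in> H \<union> {f, g} \<Longrightarrow> finite_at F h"
    using finite_values_on_component[OF q(1,2), of "H \<union> {f, g}"] assms(2) by auto
  have "t \<le> value_at F (f - g)"
    using value_at_ge_on[OF F(1) _ F(2) q(4)] F(1,3) by (simp add: finite_at_intros)
  then have "value_at F g < value_at F f"
    using q(3) F(1,3) by (simp add: value_at_simps)
  then show thesis
    using that F by auto
qed

lemma not_le_value_at2:
  assumes "\<not> f \<le> g"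
  obtains F where "ultrafilter F" "finite_at F x" "finite_at F y"
    "value_at F g < value_at F f"
  using not_le_value_at[OF assms, of "{x, y}"] by (metis finite.emptyI finite_insert insertCI)

lemma le_by_values:
  fixes f g :: "'a :: {universally_complete_vector_lattice, phi_algebra}"
  assumes "finite H"
    and le: "\<And>F. ultrafilter F \<Longrightarrow> (\<And>h. h \<in> H \<Longrightarrow> finite_at F h) \<Longrightarrow>
      finite_at F f \<Longrightarrow> finite_at F g \<Longrightarrow> value_at F f \<le> value_at F g"
  shows "f \<le> g"
proof (rule ccontr)
  assume "\<not> f \<le> g"
  then obtain F where "ultrafilter F" "finite_at F f" "finite_at F g"
    "\<And>h. h \<in> H \<Longrightarrow> finite_at F h" "value_at F g < value_at F f"
    using not_le_value_at assms(1) by blast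
  then show False
    using le[of F] by fastforce
qed

lemma eq_by_values:
  fixes f g :: "'a :: {universally_complete_vector_lattice, phi_algebra}"
  assumes "finite H"
    and eq: "\<And>F. ultrafilter F \<Longrightarrow> (\<And>h. h \<in> H \<Longrightarrow> finite_at F h) \<Longrightarrow>
      finite_at F f \<Longrightarrow> finite_at F g \<Longrightarrow> value_at F f = value_at F g"
  shows "f = g"
  using le_by_values[OF assms(1), of f g] le_by_values[OF assms(1), of g f] eq
  by (metis order.antisym order_refl)

text \<open>The \<open>f\<close>-algebra is commutative since the real numbers are.\<close>

lemma phi_mult_commute:
  fixes f g :: "'a :: {universally_complete_vector_lattice, phi_algebra}"
  shows "f * g = g * f"
  by (rule eq_by_values[of "{f, g}"]) (simp_all add: value_at_simps)


section \<open>Suprema, infima and order boundedness on components\<close>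

text \<open>
  A supremum need not be approximated at a given ultrafilter; it is approximated on some component
  below any member of the ultrafilter, since otherwise it could be lowered on that member.
\<close>

lemma Sup_approximated:
  assumes A: "A \<noteq> {}" "bdd_above A" and p: "component p" "p \<noteq> 0" and t: "t *\<^sub>R p \<le> p * Sup A" "s < t"
  obtains a q where "a \<in> A" "component q" "q \<noteq> 0" "q * p = q" "s *\<^sub>R q \<le> q * a"
proof -
  have "\<exists>a\<in>A. \<exists>q. component q \<and> q \<noteq> 0 \<and> q * p = q \<and> s *\<^sub>R q \<le> q * a"
  proof (rule ccontr)
    assume *: "\<not> ?thesis"
    have "a \<le> s *\<^sub>R p + (1 - p) * Sup A" if "a \<in> A" for a
    proof -
      have "p * a \<le> s *\<^sub>R p"
        using component_level_dichotomy(1)[OF p(1), of a s] * that by blast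
      moreover have "(1 - p) * a \<le> (1 - p) * Sup A"
        using cSup_upper[OF that A(2)] componentD(1)[OF component_compl[OF p(1)]]
        by (rule mult_left_mono)
      ultimately have "p * a + (1 - p) * a \<le> s *\<^sub>R p + (1 - p) * Sup A"
        by (rule add_mono)
      then show ?thesis
        by (simp flip: distrib_right)
    qed
    then have "Sup A \<le> s *\<^sub>R p + (1 - p) * Sup A"
      using A(1) by (intro cSup_least)
    then have "p * Sup A \<le> s *\<^sub>R p"
      by (simp add: left_diff_distrib)
    then show False
      using t component_scaleR_le_iff[OF p] by (meson leD order_trans)
  qed
  then show thesis
    using that by blast
qed

lemma Inf_approximated:
  assumes A: "A \<noteq> {}" "bdd_below A" and p: "component p" "p \<noteq> 0" and t: "p * Inf A \<le> t *\<^sub>R p" "t < s"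
  obtains a q where "a \<in> A" "component q" "q \<noteq> 0" "q * p = q" "q * a \<le> s *\<^sub>R q"
proof -
  have "\<exists>a\<in>A. \<exists>q. component q \<and> q \<noteq> 0 \<and> q * p = q \<and> q * a \<le> s *\<^sub>R q"
  proof (rule ccontr)
    assume *: "\<not> ?thesis"
    have "s *\<^sub>R p + (1 - p) * Inf A \<le> a" if "a \<in> A" for a
    proof -
      have "s *\<^sub>R p \<le> p * a"
        using component_level_dichotomy(2)[OF p(1), of s a] * that by blast
      moreover have "(1 - p) * Inf A \<le> (1 - p) * a"
        using cInf_lower[OF that A(2)] componentD(1)[OF component_compl[OF p(1)]]
        by (rule mult_left_mono)
      ultimately have "s *\<^sub>R p + (1 - p) * Inf A \<le> p * a + (1 - p) * a"
        by (rule add_mono)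
      then show ?thesis
        by (simp flip: distrib_right)
    qed
    then have "s *\<^sub>R p + (1 - p) * Inf A \<le> Inf A"
      using A(1) by (intro cInf_greatest)
    then have "s *\<^sub>R p \<le> p * Inf A"
      by (simp add: left_diff_distrib)
    then show False
      using t component_scaleR_le_iff[OF p] by (meson leD order_trans)
  qed
  then show thesis
    using that by blast
qed

lemma disjoint_component_multiples:
  assumes "component p" "component q" "p * q = 0"
    and "0 \<le> s" "0 \<le> t"
  shows "inf (s *\<^sub>R p) (t *\<^sub>R q) = 0"
proof (rule order.antisym)
  define x where "x = inf (s *\<^sub>R p) (t *\<^sub>R q)"
  have "(1 - p) * x \<le> (1 - p) * (s *\<^sub>R p)"
    using componentD(1)[OF component_compl[OF assms(1)]] by (intro mult_left_mono) (auto simp: x_def)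
  moreover have "p * x \<le> p * (t *\<^sub>R q)"
    using componentD(1)[OF assms(1)] by (intro mult_left_mono) (auto simp: x_def)
  ultimately have "(1 - p) * x + p * x \<le> 0"
    using assms by (simp add: add_nonpos_nonpos)
  then show "inf (s *\<^sub>R p) (t *\<^sub>R q) \<le> 0"
    by (simp add: x_def flip: distrib_right)
  show "0 \<le> inf (s *\<^sub>R p) (t *\<^sub>R q)"
    using assms by (simp add: componentD scaleR_nonneg_nonneg)
qed

text \<open>
  This is the use of the existence of suprema of disjoint sets: on a maximal disjoint family of
  components \<open>q\<close> with bounds \<open>K\<^sub>q q\<close>, the supremum of these bounds is a global bound.
\<close>

lemma bdd_above_if_locally_bounded:
  fixes A :: "'a :: {universally_complete_vector_lattice, phi_algebra} set"
  assumes loc: "\<And>p. component p \<Longrightarrow> p \<noteq> 0 \<Longrightarrow>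
    \<exists>q K. component q \<and> q \<noteq> 0 \<and> q * p = q \<and> (\<forall>a\<in>A. q * a \<le> K *\<^sub>R q)"
  shows "bdd_above A"
proof -
  define good where "good Q \<longleftrightarrow> (\<forall>q\<in>Q. component q \<and> q \<noteq> 0 \<and> (\<exists>K. \<forall>a\<in>A. q * a \<le> K *\<^sub>R q)) \<and>
    (\<forall>q\<in>Q. \<forall>r\<in>Q. q \<noteq> r \<longrightarrow> q * r = 0)" for Q :: "'a set"
  have "\<exists>M\<in>{Q. good Q}. \<forall>X\<in>{Q. good Q}. M \<subseteq> X \<longrightarrow> X = M"
  proof (rule subset_Zorn')
    fix C assume C: "subset.chain {Q. good Q} C"
    have sub: "C \<subseteq> {Q. good Q}" and
      chain: "\<And>X Y. X \<in> C \<Longrightarrow> Y \<in> C \<Longrightarrow> X \<subseteq> Y \<or> Y \<subseteq> X"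
      using C by (auto simp: subset.chain_def)
    have "q * r = 0" if qr: "q \<in> \<Union>C" "r \<in> \<Union>C" "q \<noteq> r" for q r
    proof -
      obtain X Y where "X \<in> C" "q \<in> X" "Y \<in> C" "r \<in> Y"
        using qr by blast
      then obtain Z where "Z \<in> C" "q \<in> Z" "r \<in> Z"
        using chain[of X Y] by blast
      then show ?thesis
        using sub qr(3) unfolding good_def by blast
    qed
    then show "\<Union>C \<in> {Q. good Q}"
      using sub unfolding good_def by blast
  qed
  then obtain M where M: "good M" and max: "\<And>X. good X \<Longrightarrow> M \<subseteq> X \<Longrightarrow> X = M"
    by blast
  have "\<exists>k. \<forall>q\<in>M. \<forall>a\<in>A. q * a \<le> k q *\<^sub>R q"
    using M unfolding good_def by (intro bchoice) blast
  then obtain k where k: "\<And>q a. q \<in> M \<Longrightarrow> a \<in> A \<Longrightarrow> q * a \<le> k q *\<^sub>R q"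
    by blast
  (* The element 0 keeps D nonempty, and the maxima keep it nonnegative. *)
  define D where "D = insert 0 ((\<lambda>q. max 0 (k q) *\<^sub>R q) ` M)"
  have Mc: "component q" "q \<noteq> 0" if "q \<in> M" for q
    using M that by (auto simp: good_def)
  have Dpos: "0 \<le> x" if "x \<in> D" for x
    using that Mc by (auto simp: D_def componentD intro!: scaleR_nonneg_nonneg)
  have Ddisj: "inf x y = 0" if "x \<in> D" "y \<in> D" "x \<noteq> y" for x y
  proof (cases "x = 0 \<or> y = 0")
    case True
    then show ?thesis
      using Dpos that by (auto simp: inf_absorb1 inf_absorb2)
  next
    case False
    then obtain q r where qr: "q \<in> M" "r \<in> M" "x = max 0 (k q) *\<^sub>R q" "y = max 0 (k r) *\<^sub>R r"
      using \<open>x \<in> D\<close> \<open>y \<in> D\<close> unfolding D_def by blast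
    then have "q * r = 0"
      using M \<open>x \<noteq> y\<close> unfolding good_def by metis
    then show ?thesis
      using qr Mc by (simp add: disjoint_component_multiples)
  qed
  have "D \<noteq> {}"
    by (simp add: D_def)
  then obtain s where s: "\<And>x. x \<in> D \<Longrightarrow> x \<le> s"
    using disjoint_sup_ex[of D] Dpos Ddisj by blast
  have "a \<le> s" if a: "a \<in> A" for a
  proof (rule ccontr)
    assume "\<not> a \<le> s"
    then have "\<not> a - s \<le> 0"
      by simp
    then obtain p t where p: "component p" "p \<noteq> 0" "t > 0" "t *\<^sub>R p \<le> p * (a - s)"
      using positive_on_component by blast
    obtain q K where q: "component q" "q \<noteq> 0" "q * p = q" "\<forall>a\<in>A. q * a \<le> K *\<^sub>R q"
      using loc[OF p(1,2)] by blast
    have "\<exists>r\<in>M. q * r \<noteq> 0"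
    proof (rule ccontr)
      assume *: "\<not> ?thesis"
      then have "q \<notin> M"
        using q by (auto simp: componentD)
      (* q is disjoint from all members of M, contradicting maximality. *)
      moreover have "good (insert q M)"
        using M q * component_commute[OF q(1)] unfolding good_def by (metis insert_iff)
      ultimately show False
        using max[of "insert q M"] by blast
    qed
    then obtain r where r: "r \<in> M" "q * r \<noteq> 0"
      by blast
    note c = component_mult[OF q(1) Mc(1)[OF r(1)]]
    note le = component_mult_le[OF q(1) Mc(1)[OF r(1)]]
    have "t *\<^sub>R (q * r) \<le> q * r * (a - s)"
      using component_restrict_lower[OF c _ p(4)] component_le_trans[OF le(1) q(3)] by simp
    moreover have "q * r * a \<le> max 0 (k r) *\<^sub>R (q * r)"
    proof -
      have "r * a \<le> max 0 (k r) *\<^sub>R r"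
        using k[OF r(1) a] scaleR_right_mono[of "k r" "max 0 (k r)" r] Mc(1)[OF r(1)]
        by (auto simp: componentD intro: order_trans)
      then show ?thesis
        by (rule component_restrict_upper[OF c le(2)])
    qed
    moreover have "max 0 (k r) *\<^sub>R (q * r) \<le> q * r * s"
    proof -
      have "max 0 (k r) *\<^sub>R r \<le> s"
        using r by (intro s) (auto simp: D_def)
      then have "(q * r) * (max 0 (k r) *\<^sub>R r) \<le> (q * r) * s"
        using c by (intro mult_left_mono) (auto simp: componentD)
      then show ?thesis
        by (simp add: le(2))
    qed
    ultimately have "t *\<^sub>R (q * r) \<le> 0"
      by (metis diff_le_0_iff_le order_trans right_diff_distrib)
    then show False
      using component_scaleR_le_iff[OF c r(2), of t 0] p(3) by simp
  qed
  then show ?thesis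
    by (auto simp: bdd_above_def)
qed

lemma ultrafilter_below:
  assumes F: "ultrafilter F" and "p \<in> F" "q \<in> F"
  obtains r where "r \<in> F" "component r" "r \<noteq> 0" "r * p = r" "r * q = r"
proof -
  note c = ultrafilterD(1)[OF F]
  have "p * q \<in> F"
    using assms by (intro ultrafilterD(4)[OF F])
  then show thesis
    using that[of "p * q"] component_mult_le[OF c[OF assms(2)] c[OF assms(3)]]
      c ultrafilterD(2)[OF F] by blast
qed

text \<open>
  Strict inequalities between values hold, up to a little, on a common member of the ultrafilter.
\<close>

lemma value_bounds_on_member:
  assumes F: "ultrafilter F" and p: "p \<in> F"
    and f: "finite_at F f" "value_at F f < s" and g: "finite_at F g" "t < value_at F g"
  obtains r where "r \<in> F" "component r" "r \<noteq> 0" "r * p = r" "r * f \<le> s *\<^sub>R r" "t *\<^sub>R r \<le> r * g"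
proof -
  obtain q where q: "q \<in> F" "q * f \<le> s *\<^sub>R q"
    using value_at_less_on[OF F f] .
  obtain q' where q': "q' \<in> F" "t *\<^sub>R q' \<le> q' * g"
    using value_at_greater_on[OF F g] .
  obtain r where r: "r \<in> F" "component r" "r \<noteq> 0" "r * q = r" "r * q' = r"
    using ultrafilter_below[OF F q(1) q'(1)] .
  obtain r' where r': "r' \<in> F" "component r'" "r' \<noteq> 0" "r' * r = r'" "r' * p = r'"
    using ultrafilter_below[OF F r(1) p] .
  show thesis
    by (rule that[OF r'(1-3) r'(5)])
      (rule component_restrict_upper[OF r'(2) component_le_trans[OF r'(4) r(4)] q(2)],
       rule component_restrict_lower[OF r'(2) component_le_trans[OF r'(4) r(5)] q'(2)])
qed


section \<open>Roots, supports and inverses\<close>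

lemma power_nonneg_phi:
  fixes f :: "'a :: phi_algebra"
  shows "0 \<le> f \<Longrightarrow> 0 \<le> f ^ n"
  by (induction n) (auto simp: zero_le_one_phi)

lemma component_scaleR_power:
  assumes "component p" "n \<ge> 1"
  shows "(t *\<^sub>R p) ^ n = t ^ n *\<^sub>R p"
  using assms(2)
  by (induction n rule: nat_induct_at_least) (use assms(1) in \<open>auto simp: componentD\<close>)

lemma le_add_1_if_power_le:
  fixes s a :: "'a :: {universally_complete_vector_lattice, phi_algebra}"
  assumes "s ^ n \<le> a" "0 \<le> a" and n: "n \<ge> 1"
  shows "s \<le> a + 1"
proof (rule le_by_values[of "{s, a}"])
  fix F :: "'a set"
  assume F: "ultrafilter F" and fin: "\<And>h. h \<in> {s, a} \<Longrightarrow> finite_at F h"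
  have "value_at F s ^ n \<le> value_at F a"
    using value_at_mono[OF F _ _ assms(1)] fin F by (simp add: finite_at_intros value_at_simps)
  moreover have "0 \<le> value_at F a"
    using value_at_nonneg[OF F _ assms(2)] fin by simp
  moreover have "value_at F s \<le> value_at F s ^ n" if "value_at F s > 1"
    using self_le_power[of "value_at F s" n] that n by simp
  ultimately have "value_at F s \<le> value_at F a + 1"
    by (cases "value_at F s > 1") auto
  then show "value_at F s \<le> value_at F (a + 1)"
    using F fin by (simp add: finite_at_intros value_at_simps)
qed simp

text \<open>
  The root is the supremum \<open>r\<close> of \<open>{s \<ge> 0. s\<^sup>n \<le> a}\<close>. If \<open>r\<^sup>n\<close> exceeded \<open>a\<close> at an ultrafilter, so would
  \<open>s\<^sup>n\<close> for some \<open>s\<close> in the set, on a smaller component; if it fell short, a constant multiple of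
  a component could be added to the set beyond \<open>r\<close>.
\<close>

lemma pos_root_exists:
  fixes a :: "'a :: {universally_complete_vector_lattice, phi_algebra}"
  assumes a: "0 \<le> a" and n: "n \<ge> 1"
  obtains r where "0 \<le> r" "r ^ n = a"
proof -
  define A where "A = {s. 0 \<le> s \<and> s ^ n \<le> a}"
  define r where "r = Sup A"
  have A0: "0 \<in> A"
    using a component_scaleR_power[where p = "0 :: 'a", OF component_0 n, of 0] by (simp add: A_def)
  have "s \<le> a + 1" if "s \<in> A" for s
    using that a n by (intro le_add_1_if_power_le[of s n]) (auto simp: A_def)
  then have bdd: "bdd_above A"
    by (auto simp: bdd_above_def)
  have r0: "0 \<le> r"
    unfolding r_def using A0 bdd by (rule cSup_upper)
  have "r ^ n \<le> a"
  proof (rule ccontr)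
    assume "\<not> r ^ n \<le> a"
    then obtain F where F: "ultrafilter F" "finite_at F r" "finite_at F a"
      "value_at F a < value_at F (r ^ n)"
      by (rule not_le_value_at2)
    define m where "m = (value_at F a + value_at F r ^ n) / 2"
    have m: "value_at F a < m" "m < value_at F r ^ n" "0 \<le> m"
      using F value_at_nonneg[OF F(1,3) a] by (auto simp: m_def value_at_simps)
    have v0: "0 \<le> value_at F r"
      using value_at_nonneg[OF F(1,2) r0] .
    have "root n m < root n (value_at F r ^ n)"
      using m n by (intro real_root_less_mono) auto
    then have lt: "root n m < value_at F r"
      using n v0 by (simp add: real_root_power_cancel)
    then obtain t where t: "root n m < t" "t < value_at F r"
      using dense by blast
    obtain q where q: "component q" "q \<noteq> 0" "q * a \<le> ((value_at F a + m) / 2) *\<^sub>R q" "t *\<^sub>R q \<le> q * r"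
      using value_bounds_on_member[OF F(1) ultrafilterD(3)[OF F(1)] F(3) _ F(2) t(2),
          of "(value_at F a + m) / 2"] m by auto
    obtain s p where s: "s \<in> A" and p: "component p" "p \<noteq> 0" "p * q = p" "root n m *\<^sub>R p \<le> p * s"
      using Sup_approximated[OF _ bdd q(1,2) _ t(1)] A0 q(4) unfolding r_def by blast
    obtain G where G: "ultrafilter G" "p \<in> G" "\<And>h. h \<in> {s, a} \<Longrightarrow> finite_at G h"
      using finite_values_on_component[OF p(1,2), of "{s, a}"] by auto
    have "root n m \<le> value_at G s"
      using value_at_ge_on[OF G(1) _ G(2) p(4)] G(3) by simp
    then have "root n m ^ n \<le> value_at G s ^ n"
      using m(3) n by (intro power_mono) auto
    then have "m \<le> value_at G s ^ n"
      using m(3) n by simp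
    also have "\<dots> \<le> value_at G a"
      using value_at_mono[OF G(1), of "s ^ n" a] s G(1,3) by (simp add: A_def finite_at_intros value_at_simps)
    also have "\<dots> \<le> (value_at F a + m) / 2"
      using value_at_le_on[OF G(1) _ G(2) component_restrict_upper[OF p(1,3) q(3)]] G(3) by simp
    finally show False
      using m(1) by simp
  qed
  moreover have "a \<le> r ^ n"
  proof (rule ccontr)
    assume "\<not> a \<le> r ^ n"
    then obtain F where F: "ultrafilter F" "finite_at F r" "finite_at F a"
      "value_at F (r ^ n) < value_at F a"
      by (rule not_le_value_at2)
    define m where "m = (value_at F a + value_at F r ^ n) / 2"
    have v0: "0 \<le> value_at F r"
      using value_at_nonneg[OF F(1,2) r0] .
    have m: "m < value_at F a" "value_at F r ^ n < m"
      using F by (auto simp: m_def value_at_simps)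
    have m0: "0 \<le> m"
      using m(2) v0 by (meson less_imp_le order_trans zero_le_power)
    have "root n (value_at F r ^ n) < root n m"
      using m n by (intro real_root_less_mono) auto
    then have lt: "value_at F r < root n m"
      using n v0 by (simp add: real_root_power_cancel)
    obtain q where q: "q \<in> F" "m *\<^sub>R q \<le> q * a"
      using value_at_greater_on[OF F(1,3) m(1)] .
    have cq: "component q"
      using ultrafilterD(1)[OF F(1) q(1)] .
    have "(root n m *\<^sub>R q) ^ n = m *\<^sub>R q"
      using component_scaleR_power[OF cq n] m0 n by simp
    also have "\<dots> \<le> q * a"
      by (rule q(2))
    also have "\<dots> \<le> a"
      using mult_right_mono[OF componentD(2)[OF cq] a] by simp
    finally have "root n m *\<^sub>R q \<in> A"
      using m0 cq n by (simp add: A_def componentD scaleR_nonneg_nonneg)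
    then have "root n m *\<^sub>R q \<le> r"
      unfolding r_def using bdd by (rule cSup_upper)
    then have "value_at F (root n m *\<^sub>R q) \<le> value_at F r"
      using value_at_mono[OF F(1) _ F(2)] F(1) finite_at_component[OF F(1) cq] by (simp add: finite_at_intros)
    then show False
      using lt F(1) q(1) finite_at_component[OF F(1) cq] value_at_component[OF F(1) cq]
      by (simp add: value_at_simps)
  qed
  ultimately show thesis
    using that r0 by (simp add: order.antisym)
qed

lemma pos_root:
  fixes a :: "'a :: {universally_complete_vector_lattice, phi_algebra}"
  assumes "0 \<le> a" "n \<ge> 1"
  shows pos_root_nonneg: "0 \<le> pos_root n a" and pos_root_power: "pos_root n a ^ n = a"
proof -
  obtain r where r: "0 \<le> r" "r ^ n = a"
    using pos_root_exists[OF assms] .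
  have unique: "s = r" if "0 \<le> s" "s ^ n = a" for s
  proof (rule eq_by_values[of "{}"])
    fix F :: "'a set"
    assume F: "ultrafilter F" "finite_at F s" "finite_at F r"
    have "value_at F s ^ n = value_at F r ^ n"
      using value_at_power[OF F(1,2), of n] value_at_power[OF F(1,3), of n] that(2) r(2) by simp
    moreover have "0 < n"
      using assms(2) by simp
    ultimately show "value_at F s = value_at F r"
      using value_at_nonneg[OF F(1,2) that(1)] value_at_nonneg[OF F(1,3) r(1)]
      by (meson power_eq_imp_eq_base)
  qed simp
  have "pos_root n a = r"
    unfolding pos_root_def
    by (rule the_equality, rule conjI, rule r(1), rule r(2), elim conjE, rule unique)
  then show "0 \<le> pos_root n a" "pos_root n a ^ n = a"
    using r by simp_all
qed

text \<open>
  For \<open>f \<ge> 0\<close> these conditions determine \<open>e\<close>: it is the least component with \<open>e f = f\<close>.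
\<close>

definition support_component ::
    "'a :: {universally_complete_vector_lattice, phi_algebra} \<Rightarrow> 'a" where
  "support_component f = (SOME e. component e \<and> e * f = f \<and> (\<forall>q. component q \<longrightarrow> q * f = 0 \<longrightarrow> q * e = 0))"

lemma support_component:
  assumes "0 \<le> f"
  shows component_support: "component (support_component f)"
    and support_mult: "support_component f * f = f"
    and disjoint_support: "component q \<Longrightarrow> q * f = 0 \<Longrightarrow> q * support_component f = 0"
proof -
  obtain e where e: "component e" "e * f = 0"
    "\<And>y. 0 \<le> y \<Longrightarrow> y \<le> 1 - e \<Longrightarrow> inf y f = 0 \<Longrightarrow> y = 0"
    using largest_disjoint_component[OF assms] by blast
  have "q * (1 - e) = 0" if q: "component q" "q * f = 0" for q
  proof (rule e(3))
    define y where "y = q * (1 - e)"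
    have y: "component y"
      unfolding y_def by (intro component_mult component_compl q e)
    show "0 \<le> q * (1 - e)"
      using y by (simp add: y_def componentD)
    show "q * (1 - e) \<le> 1 - e"
      using mult_right_mono[OF componentD(2)[OF q(1)], of "1 - e"] componentD(1)[OF component_compl[OF e(1)]]
      by simp
    have "y * f = (1 - e) * (q * f)"
      using component_commute[OF q(1), of "1 - e"] by (simp add: y_def mult.assoc)
    then have yf: "y * f = 0"
      using q by simp
    have "(1 - y) * inf y f \<le> (1 - y) * y" "y * inf y f \<le> y * f"
      using componentD(1)[OF y] componentD(1)[OF component_compl[OF y]] by (auto intro!: mult_left_mono)
    then have "(1 - y) * inf y f + y * inf y f \<le> 0"
      using y yf by (simp add: add_nonpos_nonpos)
    then have "inf y f \<le> 0"
      by (simp flip: distrib_right)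
    moreover have "0 \<le> inf y f"
      using componentD(1)[OF y] assms by simp
    ultimately show "inf (q * (1 - e)) f = 0"
      by (simp add: y_def order.antisym)
  qed
  then have "\<exists>e. component e \<and> e * f = f \<and> (\<forall>q. component q \<longrightarrow> q * f = 0 \<longrightarrow> q * e = 0)"
    using component_compl[OF e(1)] e(2) by (intro exI[of _ "1 - e"]) (auto simp: left_diff_distrib)
  note * = someI_ex[OF this, folded support_component_def]
  show "component (support_component f)" "support_component f * f = f"
    "component q \<Longrightarrow> q * f = 0 \<Longrightarrow> q * support_component f = 0"
    using * by auto
qed

text \<open>
  At an ultrafilter containing the support, \<open>f\<close> may still have the value \<open>0\<close>; a strictly positive lower
  bound is only available on a smaller component.
\<close>

lemma positive_below_support:
  assumes f: "0 \<le> f" and p: "component p" "p \<noteq> 0" "p * support_component f = p"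
  obtains q t where "component q" "q \<noteq> 0" "q * p = q" "t > 0" "t *\<^sub>R q \<le> q * f"
proof -
  have "\<not> p * f \<le> 0"
  proof
    assume "p * f \<le> 0"
    moreover have "0 \<le> p * f"
      using f p(1) by (simp add: componentD)
    ultimately have "p * f = 0"
      by (rule order.antisym)
    then show False
      using disjoint_support[OF f p(1)] p by simp
  qed
  then obtain q t where q: "component q" "q \<noteq> 0" "t > 0" "t *\<^sub>R q \<le> q * (p * f)"
    using positive_on_component by blast
  have c: "component (q * (1 - p))"
    by (intro component_mult component_compl q p)
  have "t *\<^sub>R (q * (1 - p)) \<le> q * (1 - p) * (p * f)"
    using component_restrict_lower[OF c _ q(4)] component_mult_le[OF q(1) component_compl[OF p(1)]]
    by simp
  also have "\<dots> = q * ((1 - p) * p) * f"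
    by (simp only: mult.assoc)
  also have "\<dots> = 0"
    using p(1) by simp
  finally have "q * (1 - p) = 0"
    using component_scaleR_le_iff[OF c, of t 0] q(3) by fastforce
  then have qp: "q * p = q"
    by (simp add: right_diff_distrib)
  then have "q * (p * f) = q * f"
    by (metis mult.assoc)
  then show thesis
    using that[OF q(1,2) qp q(3)] q(4) by simp
qed

text \<open>
  The inverse of \<open>f\<close> on its support is the supremum of the \<open>w\<close> supported there with \<open>f w \<le> 1\<close>.
  These are bounded by \<open>1/t\<close> on every component where \<open>f \<ge> t > 0\<close>, hence locally bounded.
\<close>

lemma support_inverse_exists:
  fixes f :: "'a :: {universally_complete_vector_lattice, phi_algebra}"
  assumes f: "0 \<le> f"
  obtains g where "0 \<le> g" "support_component f * g = g" "f * g = support_component f"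
proof -
  define e where "e = support_component f"
  have e: "component e" "e * f = f"
    using component_support[OF f] support_mult[OF f] by (simp_all add: e_def)
  define A where "A = {w. 0 \<le> w \<and> e * w = w \<and> f * w \<le> 1}"
  define g where "g = Sup A"
  have A0: "0 \<in> A"
    by (simp add: A_def zero_le_one_phi)
  have bdd: "bdd_above A"
  proof (rule bdd_above_if_locally_bounded)
    fix p :: 'a assume p: "component p" "p \<noteq> 0"
    show "\<exists>q K. component q \<and> q \<noteq> 0 \<and> q * p = q \<and> (\<forall>a\<in>A. q * a \<le> K *\<^sub>R q)"
    proof (cases "p * e = 0")
      case True
      have "p * w = 0" if "w \<in> A" for w
        using that True unfolding A_def by (metis (mono_tags) mem_Collect_eq mult.assoc mult_zero_left)
      then show ?thesis
        using p by (intro exI[of _ p] exI[of _ 0]) (auto simp: componentD)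
    next
      case False
      obtain q t where q: "component q" "q \<noteq> 0" "q * (p * e) = q" "t > 0" "t *\<^sub>R q \<le> q * f"
        using positive_below_support[OF f component_mult[OF p(1) e(1)] False]
          component_mult_le(2)[OF p(1) e(1)] unfolding e_def by blast
      have "q * w \<le> (1 / t) *\<^sub>R q" if w: "w \<in> A" for w
      proof -
        have "t *\<^sub>R q * w \<le> q * f * w"
          using q(5) w by (intro mult_right_mono) (auto simp: A_def)
        also have "\<dots> \<le> q * 1"
          unfolding mult.assoc using w q(1) by (intro mult_left_mono) (auto simp: A_def componentD)
        finally have "(1 / t) *\<^sub>R (t *\<^sub>R (q * w)) \<le> (1 / t) *\<^sub>R q"
          using q(4) by (intro scaleR_left_mono) auto
        then show ?thesis
          using q(4) by simp
      qed
      then show ?thesis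
        using q component_le_trans[OF q(3) component_mult_le(1)[OF p(1) e(1)]] by blast
    qed
  qed
  have g0: "0 \<le> g"
    unfolding g_def using A0 bdd by (rule cSup_upper)
  have "g \<le> e * g"
    unfolding g_def
  proof (rule cSup_least)
    fix w assume w: "w \<in> A"
    then have "e * w \<le> e * Sup A"
      using bdd e(1) by (intro mult_left_mono cSup_upper) (auto simp: componentD)
    then show "w \<le> e * Sup A"
      using w by (simp add: A_def)
  qed (use A0 in auto)
  moreover have "e * g \<le> g"
    using mult_right_mono[OF componentD(2)[OF e(1)] g0] by simp
  ultimately have eg: "e * g = g"
    by simp
  have "f * g \<le> e"
  proof (rule ccontr)
    assume "\<not> f * g \<le> e"
    then obtain F where F: "ultrafilter F" "finite_at F f" "finite_at F g"
      "value_at F e < value_at F (f * g)"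
      by (rule not_le_value_at2)
    have ve: "value_at F e * value_at F g = value_at F g"
      using eg value_at_mult[OF F(1) finite_at_component[OF F(1) e(1)] F(3)] by simp
    have v0: "0 \<le> value_at F f" "0 \<le> value_at F g"
      using value_at_nonneg[OF F(1)] F f g0 by auto
    have "value_at F e = 1"
      using ve F value_at_component[OF F(1) e(1)] by (auto simp: value_at_simps split: if_splits)
    then have gt: "1 < value_at F f * value_at F g"
      using F by (simp add: value_at_simps)
    then have pos: "0 < value_at F f" "0 < value_at F g"
      using v0 by (auto simp: less_le)
    then have "1 / value_at F f < value_at F g"
      using gt by (simp add: field_simps)
    then obtain s t where st: "1 / value_at F f < s" "s < t" "t < value_at F g"
      by (meson dense)
    have s0: "0 < s"
      using st(1) pos by (smt (verit) divide_pos_pos)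
    have "1 / s < value_at F f"
      using st(1) s0 pos by (simp add: field_simps)
    then obtain l where l: "1 / s < l" "l < value_at F f"
      using dense by blast
    obtain p where p: "p \<in> F" "l *\<^sub>R p \<le> p * f"
      using value_at_greater_on[OF F(1,2) l(2)] .
    obtain q where q: "component q" "q \<noteq> 0" "q * p = q" "t *\<^sub>R q \<le> q * g"
      using value_bounds_on_member[OF F(1) p(1) F(2) less_add_one F(3) st(3)] by metis
    obtain w r where w: "w \<in> A" and r: "component r" "r \<noteq> 0" "r * q = r" "s *\<^sub>R r \<le> r * w"
      using Sup_approximated[OF _ bdd q(1,2) _ st(2)] A0 q(4) unfolding g_def by blast
    obtain G where G: "ultrafilter G" "r \<in> G" "\<And>h. h \<in> {w, f} \<Longrightarrow> finite_at G h"
      using finite_values_on_component[OF r(1,2), of "{w, f}"] by auto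
    have "s \<le> value_at G w"
      using value_at_ge_on[OF G(1) _ G(2) r(4)] G(3) by simp
    moreover have "l \<le> value_at G f"
      using value_at_ge_on[OF G(1) _ G(2) component_restrict_lower[OF r(1) component_le_trans[OF r(3) q(3)] p(2)]] G(3)
      by simp
    moreover have "0 < l"
      using l(1) s0 by (smt (verit) divide_pos_pos)
    ultimately have "l * s \<le> value_at G f * value_at G w"
      using s0 by (intro mult_mono) auto
    also have "\<dots> \<le> 1"
      using value_at_mono[OF G(1), of "f * w" 1] w G(1,3) by (simp add: A_def finite_at_intros value_at_simps)
    finally show False
      using l(1) s0 by (simp add: field_simps)
  qed
  moreover have "e \<le> f * g"
  proof (rule ccontr)
    assume "\<not> e \<le> f * g"
    then obtain F where F: "ultrafilter F" "finite_at F f" "finite_at F g"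
      "value_at F (f * g) < value_at F e"
      by (rule not_le_value_at2)
    have v0: "0 \<le> value_at F f" "0 \<le> value_at F g"
      using value_at_nonneg[OF F(1)] F f g0 by auto
    then have "0 \<le> value_at F f * value_at F g"
      by simp
    then have "e \<in> F"
      using F value_at_component[OF F(1) e(1)] by (auto simp: value_at_simps split: if_splits)
    then have lt: "value_at F f * value_at F g < 1"
      using F value_at_component[OF F(1) e(1)] by (simp add: value_at_simps)
    obtain l where l: "value_at F f < l" "l * value_at F g < 1"
    proof (cases "value_at F g = 0")
      case True
      then show ?thesis
        using that[of "value_at F f + 1"] by simp
    next
      case False
      then have "value_at F f < 1 / value_at F g"
        using lt v0 by (simp add: field_simps)
      then show ?thesis
        using that False v0 dense[of "value_at F f" "1 / value_at F g"] by (auto simp: field_simps)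
    qed
    have l0: "0 < l"
      using l(1) v0 by simp
    have "value_at F g < 1 / l"
      using l l0 by (simp add: field_simps)
    then obtain s where s: "value_at F g < s" "s < 1 / l"
      using dense by blast
    obtain q where q: "q \<in> F" "q * g \<le> s *\<^sub>R q"
      using value_at_less_on[OF F(1,3) s(1)] .
    obtain q' where q': "q' \<in> F" "q' * f \<le> l *\<^sub>R q'"
      using value_at_less_on[OF F(1,2) l(1)] .
    obtain r where r: "r \<in> F" "component r" "r \<noteq> 0" "r * q = r" "r * q' = r"
      using ultrafilter_below[OF F(1) q(1) q'(1)] .
    obtain p where p: "p \<in> F" "component p" "p \<noteq> 0" "p * r = p" "p * e = p"
      using ultrafilter_below[OF F(1) r(1) \<open>e \<in> F\<close>] .
    have "p * f \<le> l *\<^sub>R p"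
      by (rule component_restrict_upper[OF p(2) component_le_trans[OF p(4) r(5)] q'(2)])
    then have "(1 / l) *\<^sub>R (p * f) \<le> (1 / l) *\<^sub>R (l *\<^sub>R p)"
      using l0 by (intro scaleR_left_mono) auto
    also have "\<dots> \<le> 1"
      using p(2) l0 by (simp add: componentD)
    finally have "(1 / l) *\<^sub>R p \<in> A"
      using p l0 component_commute[OF p(2), of f] component_commute[OF p(2), of e]
      by (simp add: A_def componentD scaleR_nonneg_nonneg)
    then have "(1 / l) *\<^sub>R p \<le> g"
      unfolding g_def using bdd by (rule cSup_upper)
    then have "p * ((1 / l) *\<^sub>R p) \<le> p * g"
      using p(2) by (intro mult_left_mono) (auto simp: componentD)
    also have "\<dots> \<le> s *\<^sub>R p"
      by (rule component_restrict_upper[OF p(2) component_le_trans[OF p(4) r(4)] q(2)])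
    finally have "1 / l \<le> s"
      using component_scaleR_le_iff[OF p(2,3)] p(2) by (simp add: componentD)
    then show False
      using s(2) by simp
  qed
  ultimately show thesis
    using that[OF g0] eg unfolding e_def by (simp add: order.antisym)
qed


section \<open>The modulus\<close>

lemma modulus_upper:
  fixes x :: "'a :: {ordered_real_vector, conditionally_complete_lattice} complexification"
  assumes "0 \<le> \<theta>" "\<theta> \<le> 2 * pi"
  shows "cos \<theta> *\<^sub>R re x + sin \<theta> *\<^sub>R im x \<le> modulus x"
  unfolding modulus_def using assms by (intro cSUP_upper square_mean_closed) auto

lemma modulus_least:
  fixes x :: "'a :: {ordered_real_vector, conditionally_complete_lattice} complexification"
  assumes "\<And>\<theta>. 0 \<le> \<theta> \<Longrightarrow> \<theta> \<le> 2 * pi \<Longrightarrow> cos \<theta> *\<^sub>R re x + sin \<theta> *\<^sub>R im x \<le> y"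
  shows "modulus x \<le> y"
  unfolding modulus_def using assms by (intro cSUP_least) auto

lemma cos_sin_le_cmod: "cos \<theta> * \<alpha> + sin \<theta> * \<beta> \<le> cmod (Complex \<alpha> \<beta>)"
proof -
  have "cos \<theta> * \<alpha> + sin \<theta> * \<beta> = Re (cis (- \<theta>) * Complex \<alpha> \<beta>)"
    by simp
  also have "\<dots> \<le> cmod (cis (- \<theta>) * Complex \<alpha> \<beta>)"
    by (rule complex_Re_le_cmod)
  finally show ?thesis
    by (simp add: norm_mult)
qed

text \<open>The angle is an argument of \<open>\<alpha> + i \<beta>\<close>.\<close>

lemma cos_sin_eq_cmod:
  obtains \<theta> where "0 \<le> \<theta>" "\<theta> \<le> 2 * pi" "cos \<theta> * \<alpha> + sin \<theta> * \<beta> = cmod (Complex \<alpha> \<beta>)"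
proof (cases "cmod (Complex \<alpha> \<beta>) = 0")
  case True
  then show thesis
    using that[of 0] by (simp add: complex_eq_iff)
next
  case False
  define m where "m = cmod (Complex \<alpha> \<beta>)"
  have m: "m \<noteq> 0" "\<alpha>\<^sup>2 + \<beta>\<^sup>2 = m\<^sup>2"
    using False by (simp_all add: m_def complex_norm)
  have "(\<alpha> / m)\<^sup>2 + (\<beta> / m)\<^sup>2 = 1"
    using m by (simp add: power_divide flip: add_divide_distrib)
  then obtain \<theta> where "0 \<le> \<theta>" "\<theta> \<le> 2 * pi" "\<alpha> / m = cos \<theta>" "\<beta> / m = sin \<theta>"
    using sincos_total_2pi_le by metis
  moreover have "\<alpha> / m * \<alpha> + \<beta> / m * \<beta> = (\<alpha>\<^sup>2 + \<beta>\<^sup>2) / m"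
    by (simp add: power2_eq_square add_divide_distrib)
  moreover have "(\<alpha>\<^sup>2 + \<beta>\<^sup>2) / m = m"
    unfolding m(2) using m(1) by (simp add: power2_eq_square)
  ultimately show thesis
    using that[of \<theta>] by (simp add: m_def)
qed

definition cfinite_at ::
    "'a :: {universally_complete_vector_lattice, phi_algebra} set \<Rightarrow> 'a complexification \<Rightarrow> bool" where
  "cfinite_at F z \<longleftrightarrow> finite_at F (re z) \<and> finite_at F (im z)"

definition cvalue_at ::
    "'a :: {universally_complete_vector_lattice, phi_algebra} set \<Rightarrow> 'a complexification \<Rightarrow> complex" where
  "cvalue_at F z = Complex (value_at F (re z)) (value_at F (im z))"

lemma cvalue_at_hom:
  assumes F: "ultrafilter F" and z: "cfinite_at F z" and w: "cfinite_at F w"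
  shows cfinite_at_add: "cfinite_at F (z + w)" and cvalue_at_add: "cvalue_at F (z + w) = cvalue_at F z + cvalue_at F w"
    and cfinite_at_mult: "cfinite_at F (z * w)" and cvalue_at_mult: "cvalue_at F (z * w) = cvalue_at F z * cvalue_at F w"
    and cfinite_at_diff: "cfinite_at F (z - w)" and cvalue_at_diff: "cvalue_at F (z - w) = cvalue_at F z - cvalue_at F w"
  using assms
  by (simp_all add: cfinite_at_def cvalue_at_def plus_complexification_def minus_complexification_def
      times_complexification_def finite_at_intros value_at_simps complex_eq_iff)

lemma cfinite_value_at_of_rho:
  assumes F: "ultrafilter F" and f: "finite_at F f"
  shows cfinite_at_of_rho: "cfinite_at F (of_rho f)" and cvalue_at_of_rho: "cvalue_at F (of_rho f) = of_real (value_at F f)"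
  using assms by (simp_all add: cfinite_at_def cvalue_at_def of_rho_def finite_at_intros value_at_simps complex_eq_iff)

text \<open>
  The angle at which the supremum defining the modulus is attained gives the lower bound. For the
  upper bound, all the \<open>(cos \<theta>) re z + (sin \<theta>) im z\<close> are estimated on the same component.
\<close>

lemma modulus_value:
  assumes F: "ultrafilter F" and z: "cfinite_at F z"
  shows finite_at_modulus: "finite_at F (modulus z)"
    and value_at_modulus: "value_at F (modulus z) = cmod (cvalue_at F z)"
proof -
  define \<alpha> \<beta> m where "\<alpha> = value_at F (re z)" and "\<beta> = value_at F (im z)" and "m = cmod (Complex \<alpha> \<beta>)"
  have fin: "finite_at F (re z)" "finite_at F (im z)"
    using z by (simp_all add: cfinite_at_def)
  obtain \<theta>0 where \<theta>0: "0 \<le> \<theta>0" "\<theta>0 \<le> 2 * pi" "cos \<theta>0 * \<alpha> + sin \<theta>0 * \<beta> = m"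
    using cos_sin_eq_cmod unfolding m_def by metis
  have fin0: "finite_at F (cos \<theta>0 *\<^sub>R re z + sin \<theta>0 *\<^sub>R im z)"
    using F fin by (simp add: finite_at_intros)
  have val0: "value_at F (cos \<theta>0 *\<^sub>R re z + sin \<theta>0 *\<^sub>R im z) = m"
    using F fin \<theta>0(3) by (simp add: finite_at_intros value_at_simps \<alpha>_def \<beta>_def)
  have "has_value F (modulus z) m"
    unfolding has_value_def
  proof (intro allI impI)
    fix \<epsilon> :: real assume "\<epsilon> > 0"
    define \<delta> where "\<delta> = \<epsilon> / 2"
    have \<delta>: "\<delta> > 0" "\<epsilon> = \<delta> + \<delta>"
      using \<open>\<epsilon> > 0\<close> by (simp_all add: \<delta>_def)
    have hv: "has_value F (re z) \<alpha>" "has_value F (im z) \<beta>"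
      unfolding \<alpha>_def \<beta>_def by (rule has_value_at[OF F] fin)+
    obtain p where p: "p \<in> F" "(\<alpha> - \<delta>) *\<^sub>R p \<le> p * re z" "p * re z \<le> (\<alpha> + \<delta>) *\<^sub>R p"
      "(\<beta> - \<delta>) *\<^sub>R p \<le> p * im z" "p * im z \<le> (\<beta> + \<delta>) *\<^sub>R p"
      using has_value_common[OF F hv \<delta>(1)] .
    have cp: "component p"
      using ultrafilterD(1)[OF F p(1)] .
    have coeff: "t *\<^sub>R (p * h) \<le> (t * \<gamma> + \<delta>) *\<^sub>R p"
      if "\<bar>t\<bar> \<le> 1" "(\<gamma> - \<delta>) *\<^sub>R p \<le> p * h" "p * h \<le> (\<gamma> + \<delta>) *\<^sub>R p" for t \<gamma> h
    proof (cases "0 \<le> t")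
      case True
      have "t *\<^sub>R (p * h) \<le> t *\<^sub>R ((\<gamma> + \<delta>) *\<^sub>R p)"
        using True that(3) by (intro scaleR_left_mono)
      also have "\<dots> = (t * \<gamma> + t * \<delta>) *\<^sub>R p"
        by (simp add: distrib_left)
      also have "\<dots> \<le> (t * \<gamma> + \<delta>) *\<^sub>R p"
        using that(1) \<delta>(1) cp mult_right_mono[of t 1 \<delta>] by (intro scaleR_right_mono) (auto simp: componentD)
      finally show ?thesis .
    next
      case False
      have "(- t) *\<^sub>R ((\<gamma> - \<delta>) *\<^sub>R p) \<le> (- t) *\<^sub>R (p * h)"
        using False that(2) by (intro scaleR_left_mono) auto
      then have "t *\<^sub>R (p * h) \<le> t *\<^sub>R ((\<gamma> - \<delta>) *\<^sub>R p)"
        by simp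
      also have "\<dots> = (t * \<gamma> + (- t) * \<delta>) *\<^sub>R p"
        by (simp add: right_diff_distrib)
      also have "\<dots> \<le> (t * \<gamma> + \<delta>) *\<^sub>R p"
        using that(1) \<delta>(1) cp mult_right_mono[of "- t" 1 \<delta>] by (intro scaleR_right_mono) (auto simp: componentD)
      finally show ?thesis .
    qed
    have "modulus z \<le> (m + \<epsilon>) *\<^sub>R p + (1 - p) * modulus z"
    proof (rule modulus_least)
      fix \<theta> :: real assume \<theta>: "0 \<le> \<theta>" "\<theta> \<le> 2 * pi"
      define h where "h = cos \<theta> *\<^sub>R re z + sin \<theta> *\<^sub>R im z"
      have "p * h = cos \<theta> *\<^sub>R (p * re z) + sin \<theta> *\<^sub>R (p * im z)"
        by (simp add: h_def distrib_left)
      also have "\<dots> \<le> (cos \<theta> * \<alpha> + \<delta>) *\<^sub>R p + (sin \<theta> * \<beta> + \<delta>) *\<^sub>R p"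
        using p by (intro add_mono coeff) auto
      also have "\<dots> = (cos \<theta> * \<alpha> + sin \<theta> * \<beta> + \<epsilon>) *\<^sub>R p"
        unfolding \<delta>(2) by (simp only: scaleR_left_distrib[symmetric]) (simp add: algebra_simps)
      also have "\<dots> \<le> (m + \<epsilon>) *\<^sub>R p"
        using cos_sin_le_cmod[of \<theta> \<alpha> \<beta>] cp by (intro scaleR_right_mono) (auto simp: m_def componentD)
      finally have "p * h \<le> (m + \<epsilon>) *\<^sub>R p" .
      moreover have "(1 - p) * h \<le> (1 - p) * modulus z"
        using modulus_upper[OF \<theta>, of z] cp unfolding h_def
        by (intro mult_left_mono) (auto simp: componentD)
      ultimately have "p * h + (1 - p) * h \<le> (m + \<epsilon>) *\<^sub>R p + (1 - p) * modulus z"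
        by (rule add_mono)
      then show "cos \<theta> *\<^sub>R re z + sin \<theta> *\<^sub>R im z \<le> (m + \<epsilon>) *\<^sub>R p + (1 - p) * modulus z"
        by (simp add: h_def flip: distrib_right)
    qed
    then have up: "p * modulus z \<le> (m + \<epsilon>) *\<^sub>R p"
      by (simp add: left_diff_distrib)
    obtain q where q: "q \<in> F" "(m - \<epsilon>) *\<^sub>R q \<le> q * (cos \<theta>0 *\<^sub>R re z + sin \<theta>0 *\<^sub>R im z)"
      using value_at_greater_on[OF F fin0, of "m - \<epsilon>"] val0 \<open>\<epsilon> > 0\<close> by auto
    have cq: "component q"
      using ultrafilterD(1)[OF F q(1)] .
    have "q * (cos \<theta>0 *\<^sub>R re z + sin \<theta>0 *\<^sub>R im z) \<le> q * modulus z"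
      using modulus_upper[OF \<theta>0(1,2), of z] cq by (intro mult_left_mono) (auto simp: componentD)
    with q(2) have low: "(m - \<epsilon>) *\<^sub>R q \<le> q * modulus z"
      by (rule order_trans)
    obtain r where r: "r \<in> F" "component r" "r \<noteq> 0" "r * p = r" "r * q = r"
      using ultrafilter_below[OF F p(1) q(1)] .
    show "\<exists>p\<in>F. (m - \<epsilon>) *\<^sub>R p \<le> p * modulus z \<and> p * modulus z \<le> (m + \<epsilon>) *\<^sub>R p"
      using r(1) component_restrict_upper[OF r(2,4) up] component_restrict_lower[OF r(2,5) low] by blast
  qed
  then show "finite_at F (modulus z)" "value_at F (modulus z) = cmod (cvalue_at F z)"
    using value_atI[OF F] by (auto simp: cvalue_at_def m_def \<alpha>_def \<beta>_def)
qed

lemmas cvalue_at_intros = cfinite_at_add cfinite_at_mult cfinite_at_diff cfinite_at_of_rho finite_at_modulus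

lemmas cvalue_at_simps = cvalue_at_add cvalue_at_mult cvalue_at_diff cvalue_at_of_rho value_at_modulus

lemma modulus_mult:
  fixes z w :: "'a :: {universally_complete_vector_lattice, phi_algebra} complexification"
  shows "modulus (z * w) = modulus z * modulus w"
proof (rule eq_by_values[of "{re z, im z, re w, im w}"])
  fix F :: "'a set"
  assume F: "ultrafilter F" and fin: "\<And>h. h \<in> {re z, im z, re w, im w} \<Longrightarrow> finite_at F h"
  have "cfinite_at F z" "cfinite_at F w"
    using fin by (simp_all add: cfinite_at_def)
  then show "value_at F (modulus (z * w)) = value_at F (modulus z * modulus w)"
    using F by (simp add: cvalue_at_intros cvalue_at_simps value_at_simps norm_mult)
qed simp

lemma modulus_triangle_ineqs:
  fixes z w :: "'a :: {universally_complete_vector_lattice, phi_algebra} complexification"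
  shows modulus_triangle: "modulus (z + w) \<le> modulus z + modulus w"
    and modulus_triangle_diff: "modulus (z - w) \<le> modulus z + modulus w"
proof -
  have *: "value_at F (modulus (z + w)) \<le> value_at F (modulus z + modulus w)"
    "value_at F (modulus (z - w)) \<le> value_at F (modulus z + modulus w)"
    if "ultrafilter F" "\<And>h. h \<in> {re z, im z, re w, im w} \<Longrightarrow> finite_at F h" for F
  proof -
    have "cfinite_at F z" "cfinite_at F w"
      using that(2) by (simp_all add: cfinite_at_def)
    then show "value_at F (modulus (z + w)) \<le> value_at F (modulus z + modulus w)"
      "value_at F (modulus (z - w)) \<le> value_at F (modulus z + modulus w)"
      using that(1) by (simp_all add: cvalue_at_intros cvalue_at_simps value_at_simps
          norm_triangle_ineq norm_triangle_ineq4)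
  qed
  show "modulus (z + w) \<le> modulus z + modulus w" "modulus (z - w) \<le> modulus z + modulus w"
    by (rule le_by_values[of "{re z, im z, re w, im w}"], simp, rule *, assumption, assumption)+
qed

lemma modulus_nonneg:
  fixes z :: "'a :: {universally_complete_vector_lattice, phi_algebra} complexification"
  shows "0 \<le> modulus z"
proof (rule le_by_values[of "{re z, im z}"])
  fix F :: "'a set"
  assume F: "ultrafilter F" and fin: "\<And>h. h \<in> {re z, im z} \<Longrightarrow> finite_at F h"
  then show "value_at F 0 \<le> value_at F (modulus z)"
    by (simp add: cfinite_at_def cvalue_at_simps value_at_simps)
qed simp

lemma modulus_of_rho:
  fixes f :: "'a :: {universally_complete_vector_lattice, phi_algebra}"
  assumes "0 \<le> f"
  shows "modulus (of_rho f) = f"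
proof (rule eq_by_values[of "{f}"])
  fix F :: "'a set"
  assume F: "ultrafilter F" and fin: "\<And>h. h \<in> {f} \<Longrightarrow> finite_at F h"
  then show "value_at F (modulus (of_rho f)) = value_at F f"
    using value_at_nonneg[OF F _ assms] by (simp add: cvalue_at_intros cvalue_at_simps)
qed simp

lemma modulus_0: "modulus (0 :: 'a :: {universally_complete_vector_lattice, phi_algebra} complexification) = 0"
  using modulus_of_rho[of "0 :: 'a"] by (simp add: of_rho_def zero_complexification_def)

lemma modulus_power:
  fixes z :: "'a :: {universally_complete_vector_lattice, phi_algebra} complexification"
  shows "modulus (z ^ n) = modulus z ^ n"
proof (induction n)
  case 0
  show ?case
    using modulus_of_rho[of "1 :: 'a"] by (simp add: of_rho_def one_complexification_def zero_le_one_phi)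
qed (simp add: modulus_mult)

lemma re_im_le_modulus:
  fixes z :: "'a :: {universally_complete_vector_lattice, phi_algebra} complexification"
  shows re_le_modulus: "re z \<le> modulus z" and minus_re_le_modulus: "- re z \<le> modulus z"
    and im_le_modulus: "im z \<le> modulus z" and minus_im_le_modulus: "- im z \<le> modulus z"
proof -
  have "sin (3 / 2 * pi) = -1" "cos (3 / 2 * pi) = 0"
    using sin_3over2_pi cos_3over2_pi by simp_all
  then show "re z \<le> modulus z" "- re z \<le> modulus z" "im z \<le> modulus z" "- im z \<le> modulus z"
    using modulus_upper[of 0 z] modulus_upper[of pi z] modulus_upper[of "pi / 2" z]
      modulus_upper[of "3 / 2 * pi" z] by simp_all
qed

lemma modulus_eq_0_iff:
  fixes z :: "'a :: {universally_complete_vector_lattice, phi_algebra} complexification"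
  shows "modulus z = 0 \<longleftrightarrow> z = 0"
proof
  assume "modulus z = 0"
  then have "re z \<le> 0" "- re z \<le> 0" "im z \<le> 0" "- im z \<le> 0"
    using re_im_le_modulus[of z] by simp_all
  then have "re z = 0" "im z = 0"
    by (simp_all only: order.eq_iff neg_le_0_iff_le simp_thms)
  then show "z = 0"
    by (simp add: complexification_eqI zero_complexification_def)
qed (simp add: modulus_0)

lemma modulus_le_re_im:
  fixes z :: "'a :: {universally_complete_vector_lattice, phi_algebra} complexification"
  assumes "re z \<le> f" "- re z \<le> f" "im z \<le> g" "- im z \<le> g"
  shows "modulus z \<le> f + g"
proof (rule le_by_values[of "{re z, im z, f, g}"])
  fix F :: "'a set"
  assume F: "ultrafilter F" and fin: "\<And>h. h \<in> {re z, im z, f, g} \<Longrightarrow> finite_at F h"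
  have "finite_at F (- re z)" "finite_at F (- im z)"
    "value_at F (- re z) = - value_at F (re z)" "value_at F (- im z) = - value_at F (im z)"
    using finite_at_scaleR[OF F, of _ "-1"] value_at_scaleR[OF F, of _ "-1"] fin by simp_all
  then have "\<bar>value_at F (re z)\<bar> \<le> value_at F f" "\<bar>value_at F (im z)\<bar> \<le> value_at F g"
    using value_at_mono[OF F _ _ assms(1)] value_at_mono[OF F _ _ assms(2)] value_at_mono[OF F _ _ assms(3)]
      value_at_mono[OF F _ _ assms(4)] fin by simp_all
  moreover have "cmod (cvalue_at F z) \<le> \<bar>value_at F (re z)\<bar> + \<bar>value_at F (im z)\<bar>"
    using cmod_le[of "cvalue_at F z"] by (simp add: cvalue_at_def)
  ultimately show "value_at F (modulus z) \<le> value_at F (f + g)"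
    using F fin by (simp add: cfinite_at_def cvalue_at_simps value_at_simps)
qed simp


section \<open>Principal bands\<close>

text \<open>
  For \<open>e = support_component f\<close> this turns out to be the band generated by \<open>f\<close>; membership depends only
  on the modulus.
\<close>

definition support_band :: "'a \<Rightarrow> 'a :: {universally_complete_vector_lattice, phi_algebra} complexification set" where
  "support_band e = {x. e * re x = re x \<and> e * im x = im x}"

lemma modulus_support_band:
  assumes e: "component e"
  shows "x \<in> support_band e \<longleftrightarrow> e * modulus x = modulus x"
proof
  assume x: "x \<in> support_band e"
  have "of_rho e * x = x"
    using x by (simp add: support_band_def of_rho_def times_complexification_def complexification_eqI)
  then show "e * modulus x = modulus x"
    using modulus_mult[of "of_rho e" x] modulus_of_rho[OF componentD(1)[OF e]] by simp
next
  assume m: "e * modulus x = modulus x"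
  have *: "e * f = f" if "f \<le> modulus x" "- f \<le> modulus x" for f
  proof -
    have "(1 - e) * modulus x = 0"
      using m by (simp add: left_diff_distrib)
    then have "(1 - e) * f \<le> 0" "(1 - e) * (- f) \<le> 0"
      using mult_left_mono[OF that(1) componentD(1)[OF component_compl[OF e]]]
        mult_left_mono[OF that(2) componentD(1)[OF component_compl[OF e]]] by simp_all
    then have "(1 - e) * f = 0"
      by (intro order.antisym) (simp_all only: mult_minus_right neg_le_0_iff_le)
    then show ?thesis
      by (simp add: left_diff_distrib)
  qed
  show "x \<in> support_band e"
    using *[of "re x"] *[of "im x"] re_im_le_modulus[of x] by (simp add: support_band_def)
qed

lemma band_support_band:
  fixes e :: "'a :: {universally_complete_vector_lattice, phi_algebra}"
  assumes e: "component e"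
  shows "band (support_band e)"
proof -
  have "order_ideal (support_band e)"
    unfolding order_ideal_def
  proof (intro conjI ballI allI impI)
    show "0 \<in> support_band e"
      by (simp add: support_band_def zero_complexification_def)
    show "x + y \<in> support_band e" if "x \<in> support_band e" "y \<in> support_band e" for x y
      using that by (simp add: support_band_def plus_complexification_def distrib_left)
    show "scaleC t x \<in> support_band e" if "x \<in> support_band e" for t x
      using that by (simp add: support_band_def scaleC_def distrib_left right_diff_distrib)
    fix x y :: "'a complexification"
    assume y: "y \<in> support_band e" and le: "modulus x \<le> modulus y"
    have "(1 - e) * modulus x \<le> (1 - e) * modulus y"
      using le componentD(1)[OF component_compl[OF e]] by (rule mult_left_mono)
    also have "\<dots> = 0"
      using y modulus_support_band[OF e] by (simp add: left_diff_distrib)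
    finally have "(1 - e) * modulus x = 0"
      using componentD(1)[OF component_compl[OF e]] modulus_nonneg[of x]
      by (intro order.antisym mult_nonneg_nonneg)
    then show "x \<in> support_band e"
      using modulus_support_band[OF e] by (simp add: left_diff_distrib)
  qed
  moreover have "of_rho (Sup A) \<in> support_band e"
    if A: "A \<noteq> {}" "bdd_above A" "of_rho ` A \<subseteq> support_band e" for A
  proof -
    have eA: "e * a = a" if "a \<in> A" for a
      using A(3) that by (auto simp: support_band_def of_rho_def)
    obtain a0 where a0: "a0 \<in> A"
      using A(1) by blast
    have "(1 - e) * a0 \<le> (1 - e) * Sup A"
      using cSup_upper[OF a0 A(2)] componentD(1)[OF component_compl[OF e]] by (rule mult_left_mono)
    then have "e * Sup A \<le> Sup A"
      using eA[OF a0] by (simp add: left_diff_distrib)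
    moreover have "Sup A \<le> e * Sup A"
    proof (rule cSup_least[OF A(1)])
      fix a assume a: "a \<in> A"
      show "a \<le> e * Sup A"
        using mult_left_mono[OF cSup_upper[OF a A(2)] componentD(1)[OF e]] eA[OF a] by simp
    qed
    ultimately show ?thesis
      by (simp add: support_band_def of_rho_def)
  qed
  ultimately show ?thesis
    by (simp add: band_def)
qed

text \<open>
  On small components below its support \<open>f\<close> is bounded below by a positive constant and \<open>m\<close> is bounded
  above, so there \<open>m\<close> lies below a multiple of \<open>f\<close>.
\<close>

lemma Sup_below_multiples:
  assumes f: "0 \<le> f" and m: "0 \<le> m" "support_component f * m = m"
  shows "Sup {w. 0 \<le> w \<and> w \<le> m \<and> (\<exists>k\<ge>0. w \<le> k *\<^sub>R f)} = m" (is "Sup ?A = m")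
proof -
  define e where "e = support_component f"
  have e: "component e"
    using component_support[OF f] by (simp add: e_def)
  have A0: "0 \<in> ?A"
    using m(1) by (auto intro: exI[of _ 0])
  have bdd: "bdd_above ?A"
    by (auto simp: bdd_above_def)
  define s where "s = Sup ?A"
  have s0: "0 \<le> s"
    unfolding s_def using A0 bdd by (rule cSup_upper)
  have "m \<le> s"
  proof (rule ccontr)
    assume "\<not> m \<le> s"
    then have "\<not> m - s \<le> 0"
      by simp
    then obtain p t where p: "component p" "p \<noteq> 0" "t > 0" "t *\<^sub>R p \<le> p * (m - s)"
      using positive_on_component by blast
    have c: "component (p * (1 - e))"
      by (intro component_mult component_compl p e)
    have "t *\<^sub>R (p * (1 - e)) \<le> p * (1 - e) * (m - s)"
      using component_restrict_lower[OF c _ p(4)] component_mult_le[OF p(1) component_compl[OF e]]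
      by simp
    also have "\<dots> = - (p * (1 - e) * s)"
      using m(2) by (simp add: e_def mult.assoc left_diff_distrib right_diff_distrib)
    also have "\<dots> \<le> 0"
      using c s0 by (simp add: componentD)
    finally have "p * (1 - e) = 0"
      using component_scaleR_le_iff[OF c, of t 0] p(3) by fastforce
    then have "p * e = p"
      by (simp add: right_diff_distrib)
    then obtain q u where q: "component q" "q \<noteq> 0" "q * p = q" "u > 0" "u *\<^sub>R q \<le> q * f"
      using positive_below_support[OF f p(1,2)] unfolding e_def by blast
    obtain r K where r: "component r" "r \<noteq> 0" "r * q = r" "r * m \<le> K *\<^sub>R r"
      using bounded_above_on_component[OF q(1,2)] by blast
    have "r * m \<le> (max 0 K / u) *\<^sub>R f"
    proof -
      have "K *\<^sub>R r \<le> max 0 K *\<^sub>R r"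
        using r(1) by (intro scaleR_right_mono) (auto simp: componentD)
      also have "\<dots> = (max 0 K / u) *\<^sub>R (u *\<^sub>R r)"
        using q(4) by simp
      also have "\<dots> \<le> (max 0 K / u) *\<^sub>R (r * f)"
        using component_restrict_lower[OF r(1,3) q(5)] q(4) by (intro scaleR_left_mono) auto
      also have "\<dots> \<le> (max 0 K / u) *\<^sub>R f"
        using mult_right_mono[OF componentD(2)[OF r(1)] f] q(4) by (intro scaleR_left_mono) auto
      finally show ?thesis
        using r(4) by simp
    qed
    moreover have "r * m \<le> m" "0 \<le> r * m"
      using mult_right_mono[OF componentD(2)[OF r(1)] m(1)] m(1) componentD(1)[OF r(1)] by simp_all
    moreover have "0 \<le> max 0 K / u"
      using q(4) by simp
    ultimately have "r * m \<in> ?A"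
      by blast
    then have "r * m \<le> s"
      unfolding s_def using bdd by (rule cSup_upper)
    then have "r * (r * m) \<le> r * s"
      using r(1) by (intro mult_left_mono) (auto simp: componentD)
    then have "r * (m - s) \<le> 0"
      using r(1) by (simp add: componentD right_diff_distrib flip: mult.assoc)
    then have "t *\<^sub>R r \<le> 0"
      using component_restrict_lower[OF r(1) component_le_trans[OF r(3) q(3)] p(4)] by (rule order_trans[rotated])
    then show False
      using component_scaleR_le_iff[OF r(1,2), of t 0] p(3) by simp
  qed
  moreover have "s \<le> m"
    unfolding s_def using A0 by (intro cSup_least) auto
  ultimately show ?thesis
    by (simp add: s_def)
qed

text \<open>
  Any band containing \<open>f\<close> contains the multiples of \<open>f\<close> and what they dominate, hence also the suprema
  of such elements, among which is \<open>\<bar>x\<bar>\<close> for every \<open>x\<close> supported where \<open>f\<close> is.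
\<close>

lemma principal_band_of_rho:
  assumes f: "0 \<le> f"
  shows "principal_band (of_rho f) = support_band (support_component f)"
proof
  note e = component_support[OF f]
  have "of_rho f \<in> support_band (support_component f)"
    using support_mult[OF f] by (simp add: support_band_def of_rho_def)
  then show "principal_band (of_rho f) \<subseteq> support_band (support_component f)"
    using band_support_band[OF e] by (auto simp: principal_band_def)
  show "support_band (support_component f) \<subseteq> principal_band (of_rho f)"
    unfolding principal_band_def
  proof (intro subsetI InterI, clarify)
    fix x B
    assume x: "x \<in> support_band (support_component f)" and B: "band B" "of_rho f \<in> B"
    have scale: "\<And>t y. y \<in> B \<Longrightarrow> scaleC t y \<in> B"
      and solid: "\<And>x y. y \<in> B \<Longrightarrow> modulus x \<le> modulus y \<Longrightarrow> x \<in> B"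
      using B(1) by (auto simp: band_def order_ideal_def)
    define A where "A = {w. 0 \<le> w \<and> w \<le> modulus x \<and> (\<exists>k\<ge>0. w \<le> k *\<^sub>R f)}"
    have sup: "Sup A = modulus x"
      unfolding A_def using x by (intro Sup_below_multiples f modulus_nonneg) (simp add: modulus_support_band[OF e])
    have "of_rho w \<in> B" if w: "w \<in> A" for w
    proof -
      obtain k where k: "0 \<le> w" "0 \<le> k" "w \<le> k *\<^sub>R f"
        using w by (auto simp: A_def)
      have "of_rho (k *\<^sub>R f) = scaleC (of_real k) (of_rho f)"
        by (simp add: of_rho_def scaleC_def)
      then have "of_rho (k *\<^sub>R f) \<in> B"
        using scale[OF B(2)] by simp
      moreover have "modulus (of_rho w) \<le> modulus (of_rho (k *\<^sub>R f))"
        using k f by (simp add: modulus_of_rho scaleR_nonneg_nonneg)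
      ultimately show ?thesis
        by (rule solid)
    qed
    moreover have "0 \<in> A" "bdd_above A"
      using modulus_nonneg[of x] by (auto simp: A_def bdd_above_def intro: exI[of _ 0])
    ultimately have "of_rho (Sup A) \<in> B"
      using B(1) unfolding band_def by (metis empty_iff image_subsetI)
    then show "x \<in> B"
      using solid[of "of_rho (modulus x)" x] modulus_of_rho[OF modulus_nonneg[of x]] by (simp add: sup)
  qed
qed

lemma disjoint_by_component:
  assumes e: "component e" "e * u = 0" "e * v = v" and "0 \<le> u" "0 \<le> v"
  shows "inf u v = 0"
proof (rule order.antisym)
  have "e * inf u v \<le> e * u" "(1 - e) * inf u v \<le> (1 - e) * v"
    using componentD(1)[OF e(1)] componentD(1)[OF component_compl[OF e(1)]] by (auto intro!: mult_left_mono)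
  then have "e * inf u v + (1 - e) * inf u v \<le> e * u + (1 - e) * v"
    by (rule add_mono)
  moreover have "(1 - e) * v = 0"
    using e by (simp add: left_diff_distrib)
  ultimately have "e * inf u v + (1 - e) * inf u v \<le> 0"
    using e(2) by simp
  then show "inf u v \<le> 0"
    by (simp flip: distrib_right)
  show "0 \<le> inf u v"
    using assms(4,5) by (rule inf_greatest)
qed

text \<open>
  For uniqueness, let \<open>y\<close> be another candidate and \<open>z = e (x - y)\<close>. Then \<open>z\<close> lies in the band, so it is
  disjoint from \<open>x - y\<close>; but \<open>\<bar>z\<bar> \<le> \<bar>x - y\<bar>\<close>, whence \<open>z = 0\<close>.
\<close>

lemma band_proj_of_rho:
  assumes f: "0 \<le> f"
  shows "band_proj (of_rho f) x = of_rho (support_component f) * x"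
proof -
  define e B where "e = support_component f" and "B = support_band e"
  have e: "component e"
    using component_support[OF f] by (simp add: e_def)
  have band: "principal_band (of_rho f) = B"
    using principal_band_of_rho[OF f] by (simp add: B_def e_def)
  have mult: "of_rho e * y = Cpl (e * re y) (e * im y)" for y
    by (simp add: of_rho_def times_complexification_def)
  have ee: "e * (e * g) = e * g" for g
    using componentD(3)[OF e] by (simp flip: mult.assoc)
  have me: "modulus (of_rho e * y) = e * modulus y" for y
    using modulus_of_rho[OF componentD(1)[OF e]] by (simp add: modulus_mult)
  have inB: "of_rho e * y \<in> B" for y
    by (simp add: B_def support_band_def mult ee)
  have eB: "of_rho e * y = y" if "y \<in> B" for y
    using that by (simp add: B_def support_band_def mult complexification_eqI)
  have "(THE y. y \<in> B \<and> x - y \<in> disjoint_complement B) = of_rho e * x"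
  proof (rule the_equality)
    have "inf (modulus (x - of_rho e * x)) (modulus y) = 0" if "y \<in> B" for y
    proof (rule disjoint_by_component[OF e])
      have "of_rho e * (x - of_rho e * x) = 0"
        by (simp add: of_rho_def times_complexification_def minus_complexification_def
            zero_complexification_def right_diff_distrib ee)
      then show "e * modulus (x - of_rho e * x) = 0"
        using me[of "x - of_rho e * x"] by (simp add: modulus_0)
      show "e * modulus y = modulus y"
        using me[of y] eB[OF that] by simp
    qed (rule modulus_nonneg)+
    then show "of_rho e * x \<in> B \<and> x - of_rho e * x \<in> disjoint_complement B"
      using inB by (simp add: disjoint_complement_def)
    fix y assume y: "y \<in> B \<and> x - y \<in> disjoint_complement B"
    define z where "z = of_rho e * (x - y)"
    have z: "z = of_rho e * x - y"
      using eB[of y] y by (simp add: z_def right_diff_distrib)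
    have "inf (modulus (x - y)) (modulus z) = 0"
      using y inB by (simp add: disjoint_complement_def z_def)
    moreover have "modulus z \<le> modulus (x - y)"
      using mult_right_mono[OF componentD(2)[OF e] modulus_nonneg[of "x - y"]] by (simp add: z_def me)
    ultimately have "modulus z = 0"
      by (simp add: inf_absorb2)
    then show "y = of_rho e * x"
      using z by (simp add: modulus_eq_0_iff)
  qed
  then show ?thesis
    by (simp add: band_proj_def band e_def)
qed

lemma band_proj_of_rho_of_rho:
  assumes "0 \<le> f"
  shows "band_proj (of_rho f) (of_rho g) = of_rho (support_component f * g)"
  using assms by (simp add: band_proj_of_rho) (simp add: of_rho_def times_complexification_def)

lemma band_inverse_of_rho:
  assumes f: "0 \<le> f" and g: "support_component f * g = g" "f * g = support_component f"
  shows "band_inverse (of_rho f) = of_rho g"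
proof (cases "f = 0")
  case True
  have "support_component f = 0"
    using disjoint_support[OF f, of 1] True by simp
  then show ?thesis
    using g True by (simp add: band_inverse_def of_rho_def zero_complexification_def)
next
  case False
  define e where "e = support_component f"
  have one: "band_proj (of_rho f) 1 = of_rho e"
    using band_proj_of_rho_of_rho[OF f, of 1] by (simp add: e_def of_rho_def one_complexification_def)
  have "(THE b. b \<in> support_band e \<and> of_rho f * b = of_rho e \<and> b * of_rho f = of_rho e) = of_rho g"
  proof (rule the_equality)
    show "of_rho g \<in> support_band e \<and> of_rho f * of_rho g = of_rho e \<and> of_rho g * of_rho f = of_rho e"
      using g phi_mult_commute[of g f]
      by (simp add: support_band_def of_rho_def times_complexification_def e_def)
    fix b assume b: "b \<in> support_band e \<and> of_rho f * b = of_rho e \<and> b * of_rho f = of_rho e"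
    then have eb: "e * re b = re b" "e * im b = im b" and fb: "f * re b = e" "f * im b = 0"
      by (auto simp: support_band_def of_rho_def times_complexification_def)
    have e: "e = g * f"
      using g(2) phi_mult_commute[of g f] by (simp add: e_def)
    have "re b = g * (f * re b)" "im b = g * (f * im b)"
      using eb by (simp_all only: e mult.assoc)
    moreover have "g * e = g"
      using g(1) phi_mult_commute[of g e] by (simp add: e_def)
    ultimately show "b = of_rho g"
      using fb by (simp add: of_rho_def complexification_eqI)
  qed
  moreover have "of_rho f \<noteq> 0"
    using False by (simp add: of_rho_def zero_complexification_def)
  ultimately show ?thesis
    using principal_band_of_rho[OF f] one by (simp add: band_inverse_def e_def)
qed

lemma weak_order_unit_iff_support:
  assumes f: "0 \<le> f"
  shows "weak_order_unit f \<longleftrightarrow> support_component f = 1"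
proof
  define e where "e = support_component f"
  have e: "component e" "component (1 - e)" "e * f = f"
    using component_support[OF f] component_compl support_mult[OF f] by (auto simp: e_def)
  assume "weak_order_unit f"
  moreover have "inf (1 - e) f = 0"
    using e f by (intro disjoint_by_component[OF e(1)]) (auto simp: componentD)
  then have "inf f (modulus (of_rho (1 - e))) = 0"
    using componentD(1)[OF e(2)] by (simp add: modulus_of_rho inf_commute)
  ultimately have "of_rho (1 - e) = 0"
    by (simp add: weak_order_unit_def)
  then show "support_component f = 1"
    by (simp add: of_rho_def zero_complexification_def e_def)
next
  assume one: "support_component f = 1"
  obtain g where g: "f * g = 1"
    using support_inverse_exists[OF f] one by metis
  have "x = 0" if x: "inf f (modulus x) = 0" for x
  proof -
    have "f * modulus x = 0"
      using x by (rule disjoint_mult_eq_0)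
    then have "g * f * modulus x = 0"
      by (simp add: mult.assoc)
    then show ?thesis
      using g phi_mult_commute[of g f] by (simp add: modulus_eq_0_iff)
  qed
  then show "weak_order_unit f"
    using f by (simp add: weak_order_unit_def)
qed

lemma support_component_invertible:
  assumes "0 \<le> f" "f * g = 1"
  shows "support_component f = 1"
proof -
  have "support_component f * (f * g) = f * g"
    using support_mult[OF assms(1)] by (simp flip: mult.assoc)
  then show ?thesis
    using assms(2) by simp
qed


section \<open>Power series with bounded terms\<close>

text \<open>
  The limit is the supremum of the lower bounds \<open>g m - p m\<close>, each of which is below every upper bound
  \<open>g k + p k\<close>.
\<close>

lemma order_cauchy_real:
  fixes g p :: "nat \<Rightarrow> 'a :: {universally_complete_vector_lattice, phi_algebra}"
  assumes "\<And>m k. m \<le> k \<Longrightarrow> g k - g m \<le> p m" "\<And>m k. m \<le> k \<Longrightarrow> g m - g k \<le> p m"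
  obtains l where "\<And>m. g m - l \<le> p m" "\<And>m. l - g m \<le> p m"
proof -
  have p0: "0 \<le> p m" for m
    using assms(1)[of m m] by simp
  have le: "g m - p m \<le> g k + p k" for m k
  proof (cases "m \<le> k")
    case True
    have "g m - p m \<le> g k"
      using assms(2)[OF True] by (simp add: diff_le_eq add.commute)
    then show ?thesis
      using p0[of k] by (rule add_increasing2[rotated])
  next
    case False
    then have "g m \<le> g k + p k"
      using assms(1)[of k m] by (simp add: diff_le_eq add.commute)
    moreover have "g m - p m \<le> g m"
      using p0[of m] by simp
    ultimately show ?thesis
      by (rule order_trans[rotated])
  qed
  define l where "l = (SUP m. g m - p m)"
  have bdd: "bdd_above (range (\<lambda>m. g m - p m))"
    using le[of _ 0] by (auto simp: bdd_above_def)
  have "g m - p m \<le> l" for m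
    unfolding l_def using bdd by (rule cSUP_upper[rotated]) simp
  moreover have "l \<le> g m + p m" for m
    unfolding l_def by (rule cSUP_least) (auto intro: le)
  ultimately show thesis
    by (intro that[of l]) (simp_all add: diff_le_eq add.commute)
qed

lemma order_cauchy_limit:
  fixes s :: "nat \<Rightarrow> 'a :: {universally_complete_vector_lattice, phi_algebra} complexification"
  assumes "\<And>m k. m \<le> k \<Longrightarrow> modulus (s k - s m) \<le> p m"
  obtains l where "\<And>m. modulus (s m - l) \<le> p m + p m"
proof -
  have b: "re (s k) - re (s m) \<le> p m" "re (s m) - re (s k) \<le> p m"
    "im (s k) - im (s m) \<le> p m" "im (s m) - im (s k) \<le> p m" if "m \<le> k" for m k
    using re_im_le_modulus[of "s k - s m"] order_trans[OF _ assms[OF that]]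
    by (auto simp: minus_complexification_def)
  obtain x where x: "\<And>m. re (s m) - x \<le> p m" "\<And>m. x - re (s m) \<le> p m"
    using order_cauchy_real[of "\<lambda>m. re (s m)" p] b by metis
  obtain y where y: "\<And>m. im (s m) - y \<le> p m" "\<And>m. y - im (s m) \<le> p m"
    using order_cauchy_real[of "\<lambda>m. im (s m)" p] b by metis
  show thesis
    by (rule that[of "Cpl x y"], rule modulus_le_re_im)
      (use x y in \<open>simp_all add: minus_complexification_def\<close>)
qed

lemma decreases_to_0_geometric:
  fixes C :: "'a :: {universally_complete_vector_lattice, phi_algebra}"
  assumes C: "0 \<le> C" and t: "0 \<le> t" "t < 1"
  shows "decreases_to_0 (\<lambda>m. t ^ m *\<^sub>R C)"
  unfolding decreases_to_0_def
proof (intro conjI allI)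
  show "decseq (\<lambda>m. t ^ m *\<^sub>R C)"
    using C t by (intro decseq_SucI scaleR_right_mono) (auto simp: mult_left_le_one_le)
  show nn: "0 \<le> t ^ m *\<^sub>R C" for m
    using C t by (simp add: scaleR_nonneg_nonneg)
  define i where "i = (INF m. t ^ m *\<^sub>R C)"
  have "bdd_below (range (\<lambda>m. t ^ m *\<^sub>R C))"
    using nn by (auto simp: bdd_below_def)
  then have i: "i \<le> t ^ m *\<^sub>R C" for m
    unfolding i_def by (rule cINF_lower) simp
  have "i \<le> 0"
  proof (rule le_by_values[of "{C, i}"])
    fix F :: "'a set"
    assume F: "ultrafilter F" and fin: "\<And>h. h \<in> {C, i} \<Longrightarrow> finite_at F h"
    have "value_at F i \<le> t ^ m * value_at F C" for m
      using value_at_mono[OF F _ _ i[of m]] F fin by (simp add: finite_at_intros value_at_simps)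
    moreover have "(\<lambda>m. t ^ m * value_at F C) \<longlonglongrightarrow> 0"
      using t by (intro tendsto_mult_left_zero LIMSEQ_realpow_zero)
    ultimately have "value_at F i \<le> 0"
      by (intro LIMSEQ_le_const) auto
    then show "value_at F i \<le> value_at F 0"
      using F by (simp add: value_at_simps)
  qed simp
  moreover have "0 \<le> i"
    unfolding i_def using nn by (intro cINF_greatest) auto
  ultimately show "(INF m. t ^ m *\<^sub>R C) = 0"
    by (simp add: i_def)
qed

lemma power_mono_phi:
  fixes x y :: "'a :: phi_algebra"
  assumes "0 \<le> x" "x \<le> y"
  shows "x ^ n \<le> y ^ n"
proof (induction n)
  case (Suc n)
  then show ?case
    using assms power_nonneg_phi[of x n] power_nonneg_phi[of y n] by (auto intro!: mult_mono)
qed simp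

lemma scaleR_power_phi:
  fixes x :: "'a :: phi_algebra"
  shows "(t *\<^sub>R x) ^ n = t ^ n *\<^sub>R x ^ n"
  by (induction n) auto

text \<open>
  Uniform convergence on the disc of radius \<open>r\<close> is not equivalent to boundedness of the terms at
  \<open>r\<close>, but the two conditions agree up to a factor \<open>t < 1\<close>, which no supremum notices.
\<close>

definition bounded_radii ::
    "(nat \<Rightarrow> 'a :: {universally_complete_vector_lattice, phi_algebra} complexification) \<Rightarrow> 'a set" where
  "bounded_radii a = {r. 0 \<le> r \<and> bdd_above (range (\<lambda>n. modulus (a n) * r ^ n))}"

text \<open>
  Only the point \<open>z = c + r\<close> of the disc is used: there the terms are differences of consecutive partial
  sums, which stay within \<open>p 0\<close> of the limit.
\<close>

lemma convergence_radii_subset_bounded_radii: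
  shows "convergence_radii a c \<subseteq> bounded_radii a"
proof
  fix r assume r: "r \<in> convergence_radii a c"
  then have r0: "0 \<le> r"
    by (simp add: convergence_radii_def)
  obtain S p where p: "decreases_to_0 p"
    "\<And>m z. z \<in> closed_disc c r \<Longrightarrow> modulus (partial_sum a c m z - S z) \<le> p m"
    using r unfolding convergence_radii_def uniformly_order_convergent_on_def by blast
  have p0: "0 \<le> p m" "p m \<le> p 0" for m
    using p(1) by (auto simp: decreases_to_0_def decseq_def)
  define z where "z = c + of_rho r"
  have zc: "z - c = of_rho r"
    by (simp add: z_def)
  have z: "z \<in> closed_disc c r"
    using r0 by (simp add: closed_disc_def zc modulus_of_rho)
  have bound: "modulus (partial_sum a c m z - S z) \<le> p 0" for m
    using p(2)[OF z, of m] p0(2)[of m] by (rule order_trans)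
  have "modulus (a n) * r ^ n \<le> modulus (a 0) + (p 0 + p 0)" for n
  proof (cases n)
    case 0
    then show ?thesis
      using p0(1)[of 0] by (simp add: add_increasing2)
  next
    case (Suc k)
    have "a n * (z - c) ^ n = (partial_sum a c n z - S z) - (partial_sum a c k z - S z)"
      by (simp add: partial_sum_def Suc)
    then have "modulus (a n * (z - c) ^ n) \<le> p 0 + p 0"
      using modulus_triangle_diff[of "partial_sum a c n z - S z" "partial_sum a c k z - S z"]
        add_mono[OF bound bound] order_trans by metis
    then have "modulus (a n) * r ^ n \<le> p 0 + p 0"
      using r0 by (simp add: modulus_mult modulus_power zc modulus_of_rho)
    then show ?thesis
      using modulus_nonneg[of "a 0"] by (rule add_increasing[rotated])
  qed
  then show "r \<in> bounded_radii a"
    using r0 by (auto simp: bounded_radii_def bdd_above_def)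
qed

lemma geometric_partial_sums:
  fixes a :: "nat \<Rightarrow> 'a :: {universally_complete_vector_lattice, phi_algebra} complexification"
  assumes M: "0 \<le> M" "\<And>n. modulus (a n * (z - c) ^ n) \<le> t ^ n *\<^sub>R M"
    and t: "0 \<le> t" "t < 1" and "m \<le> k"
  shows "modulus (partial_sum a c k z - partial_sum a c m z) \<le> (t ^ Suc m / (1 - t)) *\<^sub>R M"
proof -
  have "modulus (partial_sum a c k z - partial_sum a c m z) \<le> ((t ^ Suc m - t ^ Suc k) / (1 - t)) *\<^sub>R M"
    using \<open>m \<le> k\<close>
  proof (induction k rule: dec_induct)
    case base
    then show ?case
      by (simp add: modulus_0)
  next
    case (step k)
    have "partial_sum a c (Suc k) z - partial_sum a c m z =
        (partial_sum a c k z - partial_sum a c m z) + a (Suc k) * (z - c) ^ Suc k"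
      by (simp add: partial_sum_def)
    then have "modulus (partial_sum a c (Suc k) z - partial_sum a c m z) \<le>
        modulus (partial_sum a c k z - partial_sum a c m z) + modulus (a (Suc k) * (z - c) ^ Suc k)"
      using modulus_triangle by metis
    also have "\<dots> \<le> ((t ^ Suc m - t ^ Suc k) / (1 - t)) *\<^sub>R M + t ^ Suc k *\<^sub>R M"
      using step.IH M(2) by (rule add_mono)
    also have "\<dots> = ((t ^ Suc m - t ^ Suc k) / (1 - t) + t ^ Suc k) *\<^sub>R M"
      by (simp only: scaleR_left_distrib)
    also have "(t ^ Suc m - t ^ Suc k) / (1 - t) + t ^ Suc k = (t ^ Suc m - t ^ Suc (Suc k)) / (1 - t)"
      using t by (simp add: field_simps)
    finally show ?case .
  qed
  also have "\<dots> \<le> (t ^ Suc m / (1 - t)) *\<^sub>R M"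
    using M(1) t by (intro scaleR_right_mono divide_right_mono) auto
  finally show ?thesis .
qed

text \<open>
  On the disc of radius \<open>t r\<close> the terms are dominated by the geometric sequence \<open>t\<^sup>n M\<close>, independently of
  \<open>z\<close>.
\<close>

lemma scaled_bounded_radii_converge:
  assumes r: "r \<in> bounded_radii a" and t: "0 \<le> t" "t < 1"
  shows "t *\<^sub>R r \<in> convergence_radii a c"
proof -
  have r0: "0 \<le> r"
    using r by (simp add: bounded_radii_def)
  obtain M where M: "\<And>n. modulus (a n) * r ^ n \<le> M"
    using r by (auto simp: bounded_radii_def bdd_above_def)
  have M0: "0 \<le> M"
    using M[of 0] modulus_nonneg[of "a 0"] by simp
  define D where "D = closed_disc c (t *\<^sub>R r)"
  have term_le: "modulus (a n * (z - c) ^ n) \<le> t ^ n *\<^sub>R M" if "z \<in> D" for z n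
  proof -
    have "modulus (z - c) ^ n \<le> (t *\<^sub>R r) ^ n"
      using that by (intro power_mono_phi modulus_nonneg) (simp add: D_def closed_disc_def)
    then have "modulus (a n) * modulus (z - c) ^ n \<le> modulus (a n) * (t *\<^sub>R r) ^ n"
      using modulus_nonneg by (rule mult_left_mono)
    also have "\<dots> = t ^ n *\<^sub>R (modulus (a n) * r ^ n)"
      by (simp add: scaleR_power_phi)
    also have "\<dots> \<le> t ^ n *\<^sub>R M"
      using M t by (intro scaleR_left_mono) auto
    finally show ?thesis
      by (simp add: modulus_mult modulus_power)
  qed
  (* Twice the tail of the geometric series after the m-th term is t^m C. *)
  define C where "C = (t / (1 - t)) *\<^sub>R M + (t / (1 - t)) *\<^sub>R M"
  have C0: "0 \<le> C"
    unfolding C_def using M0 t by (intro add_nonneg_nonneg scaleR_nonneg_nonneg) auto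
  have "\<exists>l. \<forall>m. modulus (partial_sum a c m z - l) \<le> t ^ m *\<^sub>R C" if z: "z \<in> D" for z
  proof -
    obtain l where l: "\<And>m. modulus (partial_sum a c m z - l) \<le>
        (t ^ Suc m / (1 - t)) *\<^sub>R M + (t ^ Suc m / (1 - t)) *\<^sub>R M"
      using order_cauchy_limit[of "\<lambda>m. partial_sum a c m z" "\<lambda>m. (t ^ Suc m / (1 - t)) *\<^sub>R M"]
        geometric_partial_sums[OF M0 term_le[OF z] t] by blast
    moreover have "(t ^ Suc m / (1 - t)) *\<^sub>R M + (t ^ Suc m / (1 - t)) *\<^sub>R M = t ^ m *\<^sub>R C" for m
      by (simp add: C_def scaleR_right_distrib mult.commute)
    ultimately show ?thesis
      by auto
  qed
  then obtain S where S: "\<And>z m. z \<in> D \<Longrightarrow> modulus (partial_sum a c m z - S z) \<le> t ^ m *\<^sub>R C"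
    by metis
  have "uniformly_order_convergent_on a c D"
    unfolding uniformly_order_convergent_on_def order_converges_def
    using S decreases_to_0_geometric[OF C0 t] by blast
  then show ?thesis
    using r0 t by (simp add: convergence_radii_def D_def scaleR_nonneg_nonneg)
qed

lemma zero_in_convergence_radii: "0 \<in> convergence_radii a c"
proof -
  have "modulus (a n) * 0 ^ n \<le> modulus (a 0)" for n
    using modulus_nonneg by (cases n) auto
  then have "0 \<in> bounded_radii a"
    by (auto simp: bounded_radii_def bdd_above_def)
  from scaled_bounded_radii_converge[OF this, of 0] show ?thesis
    by simp
qed

lemma le_if_all_scaled_le:
  fixes r s :: "'a :: {universally_complete_vector_lattice, phi_algebra}"
  assumes "\<And>t. 0 \<le> t \<Longrightarrow> t < 1 \<Longrightarrow> t *\<^sub>R r \<le> s"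
  shows "r \<le> s"
proof (rule le_by_values[of "{r, s}"])
  fix F :: "'a set"
  assume F: "ultrafilter F" and fin: "\<And>h. h \<in> {r, s} \<Longrightarrow> finite_at F h"
  have le: "t * value_at F r \<le> value_at F s" if "0 \<le> t" "t < 1" for t
    using value_at_mono[OF F _ _ assms[OF that]] F fin by (simp add: finite_at_intros value_at_simps)
  show "value_at F r \<le> value_at F s"
  proof (cases "value_at F r \<le> 0")
    case True
    then show ?thesis
      using le[of 0] by simp
  next
    case False
    show ?thesis
      by (rule field_le_mult_one_interval) (use le in auto)
  qed
qed simp

lemma bounded_radii_le_Sup:
  assumes "bdd_above (convergence_radii a c)" "r \<in> bounded_radii a"
  shows "r \<le> Sup (convergence_radii a c)"
  by (rule le_if_all_scaled_le, rule cSup_upper[OF scaled_bounded_radii_converge[OF assms(2)] assms(1)])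


section \<open>Roots of the coefficients on components\<close>

lemma coeff_root:
  assumes "n \<ge> 1"
  shows coeff_root_nonneg: "0 \<le> coeff_root a n" and coeff_root_power: "coeff_root a n ^ n = modulus (a n)"
  using pos_root[OF modulus_nonneg assms] by (simp_all add: coeff_root_def)

lemma eventually_root_less:
  fixes K v :: real
  assumes "0 < K" "1 < v"
  obtains N where "N \<ge> 1" "\<And>n. n \<ge> N \<Longrightarrow> root n K < v"
proof -
  have "eventually (\<lambda>n. root n K < v) sequentially"
    using LIMSEQ_root_const[OF assms(1)] assms(2) by (rule order_tendstoD)
  then obtain N where "\<And>n. n \<ge> N \<Longrightarrow> root n K < v"
    by (auto simp: eventually_sequentially)
  then show thesis
    using that[of "max N 1"] by simp
qed

text \<open>
  If the terms at \<open>r\<close> are bounded by a constant \<open>K\<close> and \<open>r \<ge> u\<close> on a component, then there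
  \<open>\<bar>a\<^sub>n\<bar>\<^sup>1\<^sup>/\<^sup>n \<le> K\<^sup>1\<^sup>/\<^sup>n / u\<close>, and \<open>K\<^sup>1\<^sup>/\<^sup>n\<close> tends to \<open>1\<close>.
\<close>

lemma coeff_root_bound_if_bounded_radius:
  fixes a :: "nat \<Rightarrow> 'a :: {universally_complete_vector_lattice, phi_algebra} complexification"
  assumes r: "r \<in> bounded_radii a" and p: "component p" "p \<noteq> 0" and u: "0 < u" "u *\<^sub>R p \<le> p * r"
  obtains q K where "component q" "q \<noteq> 0" "q * p = q"
    "\<forall>n\<ge>1. q * coeff_root a n \<le> K *\<^sub>R q"
    "\<forall>v>1 / u. \<exists>N. \<forall>n\<ge>N. q * coeff_root a n \<le> v *\<^sub>R q"
proof -
  obtain M where M: "\<And>n. modulus (a n) * r ^ n \<le> M"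
    using r by (auto simp: bounded_radii_def bdd_above_def)
  have r0: "0 \<le> r"
    using r by (simp add: bounded_radii_def)
  obtain q K0 where q: "component q" "q \<noteq> 0" "q * p = q" "q * M \<le> K0 *\<^sub>R q"
    using bounded_above_on_component[OF p] by blast
  (* With K at least 1, the n-th root of K is at most K, which bounds all roots at once. *)
  define K where "K = max 1 K0"
  have K: "K \<ge> 1" "K0 \<le> K"
    by (auto simp: K_def)
  have le: "q * coeff_root a n \<le> (root n K / u) *\<^sub>R q" if n: "n \<ge> 1" for n
  proof (rule le_by_values[of "{q, coeff_root a n, r, M}"])
    fix F :: "'a set"
    assume F: "ultrafilter F" and fin: "\<And>h. h \<in> {q, coeff_root a n, r, M} \<Longrightarrow> finite_at F h"
    show "value_at F (q * coeff_root a n) \<le> value_at F ((root n K / u) *\<^sub>R q)"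
    proof (cases "q \<in> F")
      case False
      then show ?thesis
        using F fin value_at_component[OF F q(1)] by (simp add: value_at_simps)
    next
      case True
      define x where "x = value_at F (coeff_root a n)"
      have x0: "0 \<le> x"
        unfolding x_def using F fin coeff_root_nonneg[OF n] by (intro value_at_nonneg) auto
      have "u \<le> value_at F r"
        using fin by (intro value_at_ge_on[OF F _ True] component_restrict_lower[OF q(1,3) u(2)]) simp
      then have "(x * u) ^ n \<le> (x * value_at F r) ^ n"
        using u(1) x0 by (intro power_mono mult_left_mono) auto
      also have "\<dots> = value_at F (modulus (a n) * r ^ n)"
        using F fin by (simp add: coeff_root_power[OF n, symmetric] finite_at_intros value_at_simps
            power_mult_distrib x_def)
      also have "\<dots> \<le> value_at F M"
        using F fin by (intro value_at_mono[OF F _ _ M])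
          (auto simp: coeff_root_power[OF n, symmetric] finite_at_intros)
      also have "\<dots> \<le> K0"
        using fin by (intro value_at_le_on[OF F _ True q(4)]) simp
      finally have "(x * u) ^ n \<le> K"
        using K(2) by simp
      then have "root n ((x * u) ^ n) \<le> root n K"
        using n by (intro real_root_le_mono) auto
      then have "x * u \<le> root n K"
        using n x0 u(1) by (simp add: real_root_power_cancel)
      then have "x \<le> root n K / u"
        using u(1) by (simp add: pos_le_divide_eq)
      then show ?thesis
        using F fin True value_at_component[OF F q(1)] by (simp add: value_at_simps x_def)
    qed
  qed simp
  show thesis
  proof (rule that[OF q(1-3), of "K / u"]; intro allI impI)
    fix n :: nat assume n: "n \<ge> 1"
    have "root n K \<le> K"
    proof -
      have "K \<le> K ^ n"
        using K(1) n by (intro self_le_power) auto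
      then have "root n K \<le> root n (K ^ n)"
        using n by (intro real_root_le_mono) auto
      then show ?thesis
        using K(1) n by (simp add: real_root_power_cancel)
    qed
    then have "(root n K / u) *\<^sub>R q \<le> (K / u) *\<^sub>R q"
      using q(1) u(1) by (intro scaleR_right_mono divide_right_mono) (auto simp: componentD)
    with le[OF n] show "q * coeff_root a n \<le> (K / u) *\<^sub>R q"
      by (rule order_trans)
  next
    fix v assume v: "1 / u < v"
    then have "1 < v * u"
      using u(1) by (simp add: field_simps)
    then obtain N where N: "N \<ge> 1" "\<And>n. n \<ge> N \<Longrightarrow> root n K < v * u"
      using eventually_root_less[of K "v * u"] K(1) by auto
    have "q * coeff_root a n \<le> v *\<^sub>R q" if n: "n \<ge> N" for n
    proof -
      have "root n K / u \<le> v"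
        using N(2)[OF n] u(1) by (simp add: pos_divide_le_eq)
      then have "(root n K / u) *\<^sub>R q \<le> v *\<^sub>R q"
        using q(1) by (intro scaleR_right_mono) (auto simp: componentD)
      then show ?thesis
        using le[of n] n N(1) order_trans by force
    qed
    then show "\<exists>N. \<forall>n\<ge>N. q * coeff_root a n \<le> v *\<^sub>R q"
      by blast
  qed
qed

text \<open>
  The terms with \<open>n \<ge> N\<close> are at most \<open>(v R)\<^sup>n \<le> 1\<close>, and the finitely many others at most a power of
  \<open>K R\<close>.
\<close>

lemma terms_bounded_on_component:
  fixes a :: "nat \<Rightarrow> 'a :: {universally_complete_vector_lattice, phi_algebra} complexification"
  assumes q: "component q" and K: "\<And>n. n \<ge> 1 \<Longrightarrow> q * coeff_root a n \<le> K *\<^sub>R q"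
    and v: "\<And>n. n \<ge> N \<Longrightarrow> q * coeff_root a n \<le> v *\<^sub>R q"
    and r: "0 \<le> r" "q * r \<le> R *\<^sub>R q" and vR: "0 \<le> v" "0 \<le> R" "v * R \<le> 1"
    and n: "n \<ge> 1"
  shows "q * (modulus (a n) * r ^ n) \<le> (max 1 (K * R) ^ N) *\<^sub>R q"
proof (rule le_by_values[of "{q, coeff_root a n, r}"])
  fix F :: "'a set"
  assume F: "ultrafilter F" and fin: "\<And>h. h \<in> {q, coeff_root a n, r} \<Longrightarrow> finite_at F h"
  define x \<rho> where "x = value_at F (coeff_root a n)" and "\<rho> = value_at F r"
  define D where "D = max 1 (K * R)"
  have nn: "0 \<le> x" "0 \<le> \<rho>"
    unfolding x_def \<rho>_def using F fin coeff_root_nonneg[OF n] r(1) by (auto intro!: value_at_nonneg)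
  have D: "1 \<le> D ^ N"
    by (simp add: D_def)
  have val: "value_at F (q * (modulus (a n) * r ^ n)) = value_at F q * (x * \<rho>) ^ n"
    using F fin by (simp add: coeff_root_power[OF n, symmetric] finite_at_intros value_at_simps
        power_mult_distrib x_def \<rho>_def)
  have "value_at F q * (x * \<rho>) ^ n \<le> D ^ N * value_at F q"
  proof (cases "q \<in> F")
    case False
    then show ?thesis
      using value_at_component[OF F q(1)] by simp
  next
    case True
    have \<rho>: "\<rho> \<le> R"
      unfolding \<rho>_def using fin by (intro value_at_le_on[OF F _ True r(2)]) simp
    have xK: "x \<le> K"
      unfolding x_def using fin by (intro value_at_le_on[OF F _ True K[OF n]]) simp
    have "(x * \<rho>) ^ n \<le> D ^ N"
    proof (cases "n \<ge> N")
      case nN: True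
      have "x \<le> v"
        unfolding x_def using fin by (intro value_at_le_on[OF F _ True v[OF nN]]) simp
      then have "x * \<rho> \<le> v * R"
        using \<rho> nn vR by (intro mult_mono)
      then have "(x * \<rho>) ^ n \<le> 1"
        using nn vR(3) by (intro power_le_one) auto
      then show ?thesis
        using D by simp
    next
      case False
      have "x * \<rho> \<le> K * R"
        using \<rho> xK nn vR(2) by (intro mult_mono) auto
      then have "x * \<rho> \<le> D"
        by (simp add: D_def)
      then have "(x * \<rho>) ^ n \<le> D ^ n"
        using nn by (intro power_mono) auto
      also have "\<dots> \<le> D ^ N"
        using False by (intro power_increasing) (auto simp: D_def)
      finally show ?thesis .
    qed
    then show ?thesis
      using True value_at_component[OF F q(1)] by simp
  qed
  then show "value_at F (q * (modulus (a n) * r ^ n)) \<le> value_at F (max 1 (K * R) ^ N *\<^sub>R q)"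
    using F fin by (simp add: val value_at_simps D_def)
qed simp

lemma component_multiple_bounded_radius:
  assumes q: "component q" and K: "\<And>n. n \<ge> 1 \<Longrightarrow> q * coeff_root a n \<le> K *\<^sub>R q"
    and v: "\<And>n. n \<ge> N \<Longrightarrow> q * coeff_root a n \<le> v *\<^sub>R q" "0 < v"
  shows "(1 / v) *\<^sub>R q \<in> bounded_radii a"
proof -
  define r where "r = (1 / v) *\<^sub>R q"
  have r0: "0 \<le> r"
    using q v(2) by (simp add: r_def componentD scaleR_nonneg_nonneg)
  have qr: "q * r \<le> (1 / v) *\<^sub>R q"
    using q by (simp add: r_def componentD)
  define D where "D = max 1 (K * (1 / v)) ^ N"
  have D: "0 \<le> D"
    by (simp add: D_def)
  have le: "modulus (a n) * r ^ n \<le> modulus (a 0) + D *\<^sub>R 1" for n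
  proof (cases "n \<ge> 1")
    case True
    have rn: "r ^ n = (1 / v) ^ n *\<^sub>R q"
      unfolding r_def by (rule component_scaleR_power[OF q True])
    have "q * (modulus (a n) * r ^ n) = (modulus (a n) * r ^ n) * q"
      by (rule component_commute[OF q])
    also have "\<dots> = modulus (a n) * r ^ n"
      using q by (simp add: rn componentD mult.assoc)
    finally have "modulus (a n) * r ^ n \<le> D *\<^sub>R q"
      using terms_bounded_on_component[OF q K v(1) r0 qr _ _ _ True] v(2) by (simp add: D_def)
    also have "\<dots> \<le> D *\<^sub>R 1"
      using q D by (intro scaleR_left_mono) (auto simp: componentD)
    finally show ?thesis
      using modulus_nonneg[of "a 0"] by (rule add_increasing[rotated])
  next
    case False
    then have "n = 0"
      by simp
    then show ?thesis
      using D by (simp add: zero_le_one_phi add_increasing2 scaleR_nonneg_nonneg)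
  qed
  then show ?thesis
    using r0 by (auto simp: bounded_radii_def bdd_above_def r_def)
qed


section \<open>The limit superior on components\<close>

lemma tail_Sup_bounds:
  fixes y :: "nat \<Rightarrow> 'a :: {universally_complete_vector_lattice, phi_algebra}"
  assumes y: "\<And>n. n \<ge> 1 \<Longrightarrow> 0 \<le> y n" "bdd_above (y ` {1..})"
  shows "n \<ge> 1 \<Longrightarrow> bdd_above (y ` {n..})" and "n \<ge> 1 \<Longrightarrow> 0 \<le> (SUP m\<in>{n..}. y m)"
    and "bdd_below ((\<lambda>n. SUP m\<in>{n..}. y m) ` {1..})"
proof -
  show bdd: "bdd_above (y ` {n..})" if "n \<ge> 1" for n
    using y(2) that by (elim bdd_above_mono) auto
  show nn: "0 \<le> (SUP m\<in>{n..}. y m)" if "n \<ge> 1" for n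
    using cSUP_upper[OF _ bdd[OF that], of n] y(1)[OF that] order_trans by fastforce
  show "bdd_below ((\<lambda>n. SUP m\<in>{n..}. y m) ` {1..})"
    using nn by (auto simp: bdd_below_def)
qed

lemma order_limsup_nonneg:
  assumes "\<And>n. n \<ge> 1 \<Longrightarrow> 0 \<le> y n" "bdd_above (y ` {1..})"
  shows "0 \<le> order_limsup (y :: nat \<Rightarrow> 'a :: {universally_complete_vector_lattice, phi_algebra})"
  unfolding order_limsup_def using tail_Sup_bounds(2)[OF _ assms(2)] assms(1) by (intro cINF_greatest) auto

text \<open>
  A bound that holds eventually on \<open>q\<close> passes to the tail suprema, because outside \<open>q\<close> these are bounded
  by a global bound of the sequence.
\<close>

lemma order_limsup_upper:
  assumes y: "\<And>n. n \<ge> 1 \<Longrightarrow> 0 \<le> y n" "bdd_above (y ` {1..})"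
    and q: "component q" "\<And>n. n \<ge> N \<Longrightarrow> q * y n \<le> v *\<^sub>R q"
  shows "q * order_limsup y \<le> v *\<^sub>R q"
proof -
  obtain Y where Y: "\<And>n. n \<ge> 1 \<Longrightarrow> y n \<le> Y"
    using y(2) by (auto simp: bdd_above_def)
  have below: "bdd_below ((\<lambda>n. SUP m\<in>{n..}. y m) ` {1..})"
    using y by (rule tail_Sup_bounds(3))
  define n where "n = max N 1"
  have "order_limsup y \<le> (SUP m\<in>{n..}. y m)"
    unfolding order_limsup_def by (rule cINF_lower[OF below]) (simp add: n_def)
  also have "\<dots> \<le> v *\<^sub>R q + (1 - q) * Y"
  proof (rule cSUP_least)
    fix m assume "m \<in> {n..}"
    then have m: "m \<ge> 1" "m \<ge> N"
      by (auto simp: n_def)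
    have "q * y m + (1 - q) * y m \<le> v *\<^sub>R q + (1 - q) * Y"
      using q(2)[OF m(2)] mult_left_mono[OF Y[OF m(1)] componentD(1)[OF component_compl[OF q(1)]]]
      by (rule add_mono)
    then show "y m \<le> v *\<^sub>R q + (1 - q) * Y"
      by (simp flip: distrib_right)
  qed simp
  finally have "q * order_limsup y \<le> q * (v *\<^sub>R q + (1 - q) * Y)"
    using componentD(1)[OF q(1)] by (rule mult_left_mono)
  also have "\<dots> = v *\<^sub>R q"
    using q(1) by (simp add: distrib_left componentD flip: mult.assoc)
  finally show ?thesis .
qed

text \<open>
  The infimum of the tail suprema is approximated by one of them on a smaller component.
\<close>

lemma order_limsup_approximated:
  assumes y: "\<And>n. n \<ge> 1 \<Longrightarrow> 0 \<le> y n" "bdd_above (y ` {1..})"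
    and p: "component p" "p \<noteq> 0" "p * order_limsup y \<le> s *\<^sub>R p" "s < v"
  obtains q K N where "component q" "q \<noteq> 0" "q * p = q"
    "\<And>n. n \<ge> 1 \<Longrightarrow> q * y n \<le> K *\<^sub>R q" "\<And>n. n \<ge> N \<Longrightarrow> q * y n \<le> v *\<^sub>R q"
proof -
  obtain Y where Y: "\<And>n. n \<ge> 1 \<Longrightarrow> y n \<le> Y"
    using y(2) by (auto simp: bdd_above_def)
  have bdd: "bdd_above (y ` {n..})" if "n \<ge> 1" for n
    using y that by (rule tail_Sup_bounds(1))
  have below: "bdd_below ((\<lambda>n. SUP m\<in>{n..}. y m) ` {1..})"
    using y by (rule tail_Sup_bounds(3))
  have ne: "(\<lambda>n. SUP m\<in>{n..}. y m) ` {1..} \<noteq> {}"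
    by simp
  obtain u q0 where u: "u \<in> (\<lambda>n. SUP m\<in>{n..}. y m) ` {1..}"
    and q0: "component q0" "q0 \<noteq> 0" "q0 * p = q0" "q0 * u \<le> v *\<^sub>R q0"
    using Inf_approximated[OF ne below p(1,2) p(3)[unfolded order_limsup_def] p(4)] .
  obtain N where N: "N \<ge> 1" "u = (SUP m\<in>{N..}. y m)"
    using u by auto
  obtain q K where q: "component q" "q \<noteq> 0" "q * q0 = q" "q * Y \<le> K *\<^sub>R q"
    using bounded_above_on_component[OF q0(1,2)] by blast
  show thesis
  proof (rule that[OF q(1,2) component_le_trans[OF q(3) q0(3)]])
    show "q * y n \<le> K *\<^sub>R q" if "n \<ge> 1" for n
      using mult_left_mono[OF Y[OF that] componentD(1)[OF q(1)]] q(4) by (rule order_trans)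
    show "q * y n \<le> v *\<^sub>R q" if "n \<ge> N" for n
    proof (rule component_restrict_upper[OF q(1,3)])
      have "q0 * y n \<le> q0 * (SUP m\<in>{N..}. y m)"
        using that bdd[OF N(1)] componentD(1)[OF q0(1)] by (intro mult_left_mono cSUP_upper) auto
      with q0(4)[unfolded N(2)] show "q0 * y n \<le> v *\<^sub>R q0"
        by (rule order_trans[rotated])
    qed
  qed
qed


section \<open>The Cauchy-Hadamard formula\<close>

text \<open>
  If \<open>e\<close> were not in \<open>F\<close>, its value and hence that of \<open>g = e g\<close> would be \<open>0\<close>.
\<close>

lemma ultrafilter_supported:
  assumes F: "ultrafilter F" and e: "component e" "e * g = g"
    and g: "finite_at F g" "value_at F g \<noteq> 0"
  shows "e \<in> F"
  using value_at_mult[OF F finite_at_component[OF F e(1)] g(1)] value_at_component[OF F e(1)] e(2) g(2)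
  by (auto split: if_splits)

lemma support_inverse_value:
  assumes F: "ultrafilter F" "finite_at F f" "finite_at F g"
    and e: "component e" "e * g = g" "f * g = e" and g: "value_at F g \<noteq> 0"
  shows "e \<in> F" "value_at F f * value_at F g = 1"
proof -
  show eF: "e \<in> F"
    using ultrafilter_supported[OF F(1) e(1,2) F(3) g] .
  show "value_at F f * value_at F g = 1"
    using value_at_mult[OF F] value_at_component[OF F(1) e(1)] e(3) eF by simp
qed

text \<open>
  Where \<open>r > 1/L\<close>, the roots of the coefficients would eventually stay below a constant less than \<open>L\<close>.
\<close>

lemma limsup_mult_bounded_radius:
  assumes bdd: "bdd_above (coeff_root a ` {1..})" and r: "r \<in> bounded_radii a"
  shows "order_limsup (coeff_root a) * r \<le> 1"
proof (rule ccontr)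
  define L where "L = order_limsup (coeff_root a)"
  assume "\<not> order_limsup (coeff_root a) * r \<le> 1"
  then have "\<not> L * r \<le> 1"
    by (simp add: L_def)
  then obtain F where F: "ultrafilter F" "finite_at F L" "finite_at F r"
    "value_at F 1 < value_at F (L * r)"
    by (rule not_le_value_at2)
  have nn: "0 \<le> L" "0 \<le> r"
    using order_limsup_nonneg[OF coeff_root_nonneg bdd] r by (simp_all add: L_def bounded_radii_def)
  have v: "1 < value_at F L * value_at F r" "0 \<le> value_at F L" "0 \<le> value_at F r"
    using F value_at_nonneg[OF F(1)] nn by (auto simp: value_at_simps)
  then have pos: "0 < value_at F L" "0 < value_at F r"
    by (auto simp: less_le)
  then have "1 / value_at F L < value_at F r"
    using v(1) by (simp add: field_simps)
  then obtain u where u: "1 / value_at F L < u" "u < value_at F r"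
    using dense by blast
  have u0: "0 < u"
    using u(1) pos by (smt (verit) divide_pos_pos)
  have "1 / u < value_at F L"
    using u(1) u0 pos by (simp add: field_simps)
  then obtain w l where w: "1 / u < w" "w < l" "l < value_at F L"
    by (meson dense)
  obtain p where p: "p \<in> F" "l *\<^sub>R p \<le> p * L"
    using value_at_greater_on[OF F(1,2) w(3)] .
  obtain p' where p': "p' \<in> F" "u *\<^sub>R p' \<le> p' * r"
    using value_at_greater_on[OF F(1,3) u(2)] .
  obtain q where q: "component q" "q \<noteq> 0" "q * p = q" "q * p' = q"
    using ultrafilter_below[OF F(1) p(1) p'(1)] by blast
  obtain s K where s: "component s" "s \<noteq> 0" "s * q = s"
    "\<forall>n\<ge>1. s * coeff_root a n \<le> K *\<^sub>R s"
    "\<forall>v>1 / u. \<exists>N. \<forall>n\<ge>N. s * coeff_root a n \<le> v *\<^sub>R s"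
    using coeff_root_bound_if_bounded_radius[OF r q(1,2) u0 component_restrict_lower[OF q(1,4) p'(2)]] .
  obtain N where N: "\<And>n. n \<ge> N \<Longrightarrow> s * coeff_root a n \<le> w *\<^sub>R s"
    using s(5) w(1) by blast
  have "s * L \<le> w *\<^sub>R s"
    unfolding L_def by (rule order_limsup_upper[OF coeff_root_nonneg bdd s(1) N])
  moreover have "l *\<^sub>R s \<le> s * L"
    by (rule component_restrict_lower[OF s(1) component_le_trans[OF s(3) q(3)] p(2)])
  ultimately have "l *\<^sub>R s \<le> w *\<^sub>R s"
    by (rule order_trans[rotated])
  then show False
    using component_scaleR_le_iff[OF s(1,2)] w(2) by simp
qed

text \<open>
  Since \<open>L r \<le> 1\<close> for every radius \<open>r\<close>, multiplication by \<open>g = L\<^sup>*\<close> gives \<open>e r \<le> g\<close>. Conversely, where the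
  supremum were less than \<open>s < g\<close>, one would have \<open>L < 1/s\<close>, and a constant radius larger than \<open>s\<close> on
  some component would be admissible.
\<close>

lemma inverse_limsup_eq_Sup:
  fixes a :: "nat \<Rightarrow> 'a :: {universally_complete_vector_lattice, phi_algebra} complexification"
    and c :: "'a complexification"
  defines "L \<equiv> order_limsup (coeff_root a)" and "\<Omega> \<equiv> convergence_radii a c"
  defines "e \<equiv> support_component L"
  assumes bdd: "bdd_above (coeff_root a ` {1..})" and g: "0 \<le> g" "e * g = g" "L * g = e"
  shows "\<And>r. r \<in> \<Omega> \<Longrightarrow> e * r \<le> g" and "(SUP r\<in>\<Omega>. e * r) = g"
proof -
  have L0: "0 \<le> L"
    using order_limsup_nonneg[OF coeff_root_nonneg bdd] by (simp add: L_def)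
  have e: "component e"
    unfolding e_def by (rule component_support[OF L0])
  have gL: "g * L = e"
    using g(3) phi_mult_commute[of g L] by simp
  show le: "e * r \<le> g" if "r \<in> \<Omega>" for r
  proof -
    have "L * r \<le> 1"
      using limsup_mult_bounded_radius[OF bdd] convergence_radii_subset_bounded_radii that
      unfolding L_def \<Omega>_def by blast
    then have "g * (L * r) \<le> g * 1"
      using g(1) by (rule mult_left_mono)
    then show ?thesis
      using gL by (simp flip: mult.assoc)
  qed
  have ne: "\<Omega> \<noteq> {}"
    using zero_in_convergence_radii unfolding \<Omega>_def by blast
  have bddS: "bdd_above ((\<lambda>r. e * r) ` \<Omega>)"
    using le by (auto simp: bdd_above_def)
  define S where "S = (SUP r\<in>\<Omega>. e * r)"
  have S0: "0 \<le> S"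
    using cSUP_upper[OF zero_in_convergence_radii[of a c, folded \<Omega>_def] bddS] by (simp add: S_def)
  have "g \<le> S"
  proof (rule ccontr)
    assume "\<not> g \<le> S"
    then obtain F where F: "ultrafilter F" "finite_at F S" "finite_at F L" "value_at F S < value_at F g"
      "finite_at F g"
      using not_le_value_at[of g S "{L}"] by auto
    have vS: "0 \<le> value_at F S"
      using value_at_nonneg[OF F(1,2) S0] .
    have "value_at F g \<noteq> 0"
      using vS F(4) by simp
    then have v1: "e \<in> F" "value_at F L * value_at F g = 1"
      using support_inverse_value[OF F(1,3,5) e g(2,3)] by auto
    (* L is below 1/u near F, so 1/v with s < 1/v < u is an admissible radius there, yet above S. *)
    obtain s u where su: "value_at F S < s" "s < u" "u < value_at F g"
      using F(4) by (meson dense)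
    have pos: "0 < s" "0 < u"
      using su vS by auto
    have "value_at F L = 1 / value_at F g"
      using v1(2) by (metis mult_zero_right nonzero_eq_divide_eq zero_neq_one)
    also have "\<dots> < 1 / u"
      using su(3) pos by (simp add: frac_less2)
    finally have Lu: "value_at F L < 1 / u" .
    have "1 / u < 1 / s"
      using su(2) pos by (simp add: frac_less2)
    then obtain v where v: "1 / u < v" "v < 1 / s"
      using dense by blast
    have v0: "0 < v"
      using v(1) pos by (smt (verit) divide_pos_pos)
    obtain p where p: "p \<in> F" "p * S \<le> s *\<^sub>R p"
      using value_at_less_on[OF F(1,2) su(1)] .
    obtain p' where p': "p' \<in> F" "p' * L \<le> (1 / u) *\<^sub>R p'"
      using value_at_less_on[OF F(1,3) Lu] .
    obtain p'' where p'': "p'' \<in> F" "component p''" "p'' * p = p''" "p'' * p' = p''"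
      using ultrafilter_below[OF F(1) p(1) p'(1)] by blast
    obtain q where q: "q \<in> F" "component q" "q \<noteq> 0" "q * p'' = q" "q * e = q"
      using ultrafilter_below[OF F(1) p''(1) v1(1)] by blast
    have "q * L \<le> (1 / u) *\<^sub>R q"
      by (rule component_restrict_upper[OF q(2) component_le_trans[OF q(4) p''(4)] p'(2)])
    then obtain r K N where r: "component r" "r \<noteq> 0" "r * q = r"
      "\<And>n. n \<ge> 1 \<Longrightarrow> r * coeff_root a n \<le> K *\<^sub>R r" "\<And>n. n \<ge> N \<Longrightarrow> r * coeff_root a n \<le> v *\<^sub>R r"
      using order_limsup_approximated[OF coeff_root_nonneg bdd q(2,3) _ v(1)] unfolding L_def by blast
    have "(1 / v) *\<^sub>R r \<in> bounded_radii a"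
      by (rule component_multiple_bounded_radius[OF r(1) r(4) r(5) v0])
    have er: "e * r = r"
      using component_le_trans[OF r(3) q(5)] component_commute[OF r(1), of e] by simp
    have "(1 / v) *\<^sub>R r \<le> S"
    proof (rule le_if_all_scaled_le)
      fix t :: real assume t: "0 \<le> t" "t < 1"
      have "t *\<^sub>R (1 / v) *\<^sub>R r \<in> \<Omega>"
        unfolding \<Omega>_def by (rule scaled_bounded_radii_converge) fact+
      then have "e * (t *\<^sub>R (1 / v) *\<^sub>R r) \<le> S"
        unfolding S_def using bddS by (rule cSUP_upper)
      then show "t *\<^sub>R (1 / v) *\<^sub>R r \<le> S"
        by (simp add: er)
    qed
    then have "r * ((1 / v) *\<^sub>R r) \<le> r * S"
      using componentD(1)[OF r(1)] by (rule mult_left_mono)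
    also have "\<dots> \<le> s *\<^sub>R r"
      by (rule component_restrict_upper[OF r(1) component_le_trans[OF r(3) component_le_trans[OF q(4) p''(3)]] p(2)])
    finally have "1 / v \<le> s"
      using component_scaleR_le_iff[OF r(1,2)] r(1) by (simp add: componentD)
    then show False
      using v(2) v0 pos by (simp add: field_simps)
  qed
  moreover have "S \<le> g"
    unfolding S_def using ne le by (rule cSUP_least)
  ultimately show "(SUP r\<in>\<Omega>. e * r) = g"
    by (simp add: S_def)
qed

text \<open>
  Where the supremum of the radii is at least \<open>t > 0\<close>, some radius is at least \<open>t/2\<close> on a smaller
  component, which bounds the roots there. Universal completeness turns this into a global bound.
\<close>

lemma coeff_root_bounded_on_support:
  fixes a :: "nat \<Rightarrow> 'a :: {universally_complete_vector_lattice, phi_algebra} complexification"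
    and c :: "'a complexification"
  defines "\<Omega> \<equiv> convergence_radii a c"
  defines "e \<equiv> support_component (Sup \<Omega>)"
  assumes bdd: "bdd_above \<Omega>"
  shows "bdd_above ((\<lambda>n. e * coeff_root a n) ` {1..})"
proof (rule bdd_above_if_locally_bounded)
  fix p :: 'a assume p: "component p" "p \<noteq> 0"
  have \<Omega>0: "0 \<in> \<Omega>"
    unfolding \<Omega>_def by (rule zero_in_convergence_radii)
  have \<rho>0: "0 \<le> Sup \<Omega>"
    using \<Omega>0 bdd by (rule cSup_upper)
  have e: "component e"
    unfolding e_def by (rule component_support[OF \<rho>0])
  show "\<exists>q K. component q \<and> q \<noteq> 0 \<and> q * p = q \<and> (\<forall>x\<in>(\<lambda>n. e * coeff_root a n) ` {1..}. q * x \<le> K *\<^sub>R q)"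
  proof (cases "p * e = 0")
    case True
    then have "p * (e * x) = 0" for x
      by (simp flip: mult.assoc)
    then show ?thesis
      using p by (intro exI[of _ p] exI[of _ 0]) (auto simp: componentD)
  next
    case False
    obtain q t where q: "component q" "q \<noteq> 0" "q * (p * e) = q" "t > 0" "t *\<^sub>R q \<le> q * Sup \<Omega>"
      using positive_below_support[OF \<rho>0 component_mult[OF p(1) e] False]
        component_mult_le(2)[OF p(1) e] unfolding e_def by blast
    have qe: "q * e = q" and qp: "q * p = q"
      using component_le_trans[OF q(3)] component_mult_le[OF p(1) e] by blast+
    have "\<Omega> \<noteq> {}" "t / 2 < t"
      using \<Omega>0 q(4) by auto
    then obtain r q' where r: "r \<in> \<Omega>" and q': "component q'" "q' \<noteq> 0" "q' * q = q'" "(t / 2) *\<^sub>R q' \<le> q' * r"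
      using Sup_approximated[OF _ bdd q(1,2,5)] by blast
    have rb: "r \<in> bounded_radii a"
      using r convergence_radii_subset_bounded_radii unfolding \<Omega>_def by blast
    have t2: "0 < t / 2"
      using q(4) by simp
    obtain s K where s: "component s" "s \<noteq> 0" "s * q' = s"
      "\<forall>n\<ge>1. s * coeff_root a n \<le> K *\<^sub>R s"
      "\<forall>v>1 / (t / 2). \<exists>N. \<forall>n\<ge>N. s * coeff_root a n \<le> v *\<^sub>R s"
      using coeff_root_bound_if_bounded_radius[OF rb q'(1,2) t2 q'(4)] .
    have sq: "s * q = s"
      using component_le_trans[OF s(3) q'(3)] .
    have "s * (e * x) = s * x" for x
      using component_le_trans[OF sq qe] by (simp flip: mult.assoc)
    then show ?thesis
      using s component_le_trans[OF sq qp] by (intro exI[of _ s] exI[of _ K]) auto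
  qed
qed

text \<open>
  Where the limit superior exceeded \<open>g = \<rho>\<^sup>*\<close>, some radius close to \<open>\<rho>\<close> would force smaller roots. Where it fell
  short of \<open>g\<close>, a constant radius greater than \<open>\<rho>\<close> would be admissible on some component.
\<close>

lemma limsup_eq_inverse_Sup:
  fixes a :: "nat \<Rightarrow> 'a :: {universally_complete_vector_lattice, phi_algebra} complexification"
    and c :: "'a complexification"
  defines "\<Omega> \<equiv> convergence_radii a c"
  defines "e \<equiv> support_component (Sup \<Omega>)"
  assumes bdd: "bdd_above \<Omega>" and g: "0 \<le> g" "e * g = g" "Sup \<Omega> * g = e"
  shows "order_limsup (\<lambda>n. e * coeff_root a n) = g"
proof (rule order.antisym)
  define \<rho> y L where "\<rho> = Sup \<Omega>" and "y = (\<lambda>n. e * coeff_root a n)" and "L = order_limsup y"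
  have \<Omega>0: "0 \<in> \<Omega>"
    unfolding \<Omega>_def by (rule zero_in_convergence_radii)
  have \<rho>0: "0 \<le> \<rho>"
    unfolding \<rho>_def using \<Omega>0 bdd by (rule cSup_upper)
  have e: "component e"
    unfolding e_def \<rho>_def[symmetric] by (rule component_support[OF \<rho>0])
  have y0: "0 \<le> y n" if "n \<ge> 1" for n
    unfolding y_def by (intro mult_nonneg_nonneg componentD(1)[OF e] coeff_root_nonneg that)
  have ybdd: "bdd_above (y ` {1..})"
    unfolding y_def e_def \<Omega>_def by (rule coeff_root_bounded_on_support[OF bdd[unfolded \<Omega>_def]])
  have L0: "0 \<le> L"
    unfolding L_def by (rule order_limsup_nonneg[OF y0 ybdd])
  have supported: "q * y n = q * coeff_root a n" if "q * e = q" for q n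
    using that by (simp add: y_def flip: mult.assoc)
  have eL: "e * L = L"
  proof -
    have "(1 - e) * L \<le> 0 *\<^sub>R (1 - e)"
      unfolding L_def
    proof (rule order_limsup_upper[OF y0 ybdd component_compl[OF e]])
      show "(1 - e) * y n \<le> 0 *\<^sub>R (1 - e)" for n
        using e by (simp add: y_def flip: mult.assoc)
    qed
    moreover have "0 \<le> (1 - e) * L"
      using L0 componentD(1)[OF component_compl[OF e]] by simp
    ultimately have "(1 - e) * L = 0"
      by (intro order.antisym) simp_all
    then show ?thesis
      by (simp add: left_diff_distrib)
  qed
  have L_le: "L \<le> g"
  proof (rule ccontr)
    assume "\<not> L \<le> g"
    then obtain F where F: "ultrafilter F" "finite_at F \<rho>" "finite_at F L" "finite_at F g"
      "value_at F g < value_at F L"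
      using not_le_value_at[of L g "{\<rho>}"] by auto
    have vg: "0 \<le> value_at F g"
      using value_at_nonneg[OF F(1,4) g(1)] .
    have eF: "e \<in> F"
      using ultrafilter_supported[OF F(1) e eL F(3)] vg F(5) by simp
    have v1: "value_at F \<rho> * value_at F g = 1"
      using value_at_mult[OF F(1,2,4)] value_at_component[OF F(1) e] eF g(3) by (simp add: \<rho>_def)
    then have "0 < value_at F \<rho>"
      using value_at_nonneg[OF F(1,2) \<rho>0] by (auto simp: less_le)
    with v1 have v: "0 < value_at F \<rho>" "value_at F g = 1 / value_at F \<rho>"
      by (simp_all add: field_simps)
    have vL: "0 < value_at F L"
      using vg F(5) by simp
    have "1 / value_at F L < value_at F \<rho>"
      using F(5) v vL by (simp add: field_simps)
    then obtain u u' where u: "1 / value_at F L < u" "u < u'" "u' < value_at F \<rho>"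
      by (meson dense)
    have u0: "0 < u"
      using u(1) vL by (smt (verit) divide_pos_pos)
    have "1 / u < value_at F L"
      using u(1) u0 vL by (simp add: field_simps)
    then obtain w l where w: "1 / u < w" "w < l" "l < value_at F L"
      by (meson dense)
    obtain p where p: "p \<in> F" "l *\<^sub>R p \<le> p * L"
      using value_at_greater_on[OF F(1,3) w(3)] .
    obtain p' where p': "p' \<in> F" "u' *\<^sub>R p' \<le> p' * \<rho>"
      using value_at_greater_on[OF F(1,2) u(3)] .
    obtain p'' where p'': "p'' \<in> F" "component p''" "p'' * p = p''" "p'' * p' = p''"
      using ultrafilter_below[OF F(1) p(1) p'(1)] by blast
    obtain q where q: "q \<in> F" "component q" "q \<noteq> 0" "q * p'' = q" "q * e = q"
      using ultrafilter_below[OF F(1) p''(1) eF] by blast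
    have "u' *\<^sub>R q \<le> q * Sup \<Omega>"
      using component_restrict_lower[OF q(2) component_le_trans[OF q(4) p''(4)] p'(2)] by (simp add: \<rho>_def)
    moreover have "\<Omega> \<noteq> {}"
      using \<Omega>0 by blast
    ultimately obtain r q' where r: "r \<in> \<Omega>" and q': "component q'" "q' \<noteq> 0" "q' * q = q'" "u *\<^sub>R q' \<le> q' * r"
      using Sup_approximated[OF _ bdd q(2,3) _ u(2)] by blast
    have rb: "r \<in> bounded_radii a"
      using r convergence_radii_subset_bounded_radii unfolding \<Omega>_def by blast
    obtain s K where s: "component s" "s \<noteq> 0" "s * q' = s"
      "\<forall>n\<ge>1. s * coeff_root a n \<le> K *\<^sub>R s"
      "\<forall>v>1 / u. \<exists>N. \<forall>n\<ge>N. s * coeff_root a n \<le> v *\<^sub>R s"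
      using coeff_root_bound_if_bounded_radius[OF rb q'(1,2) u0 q'(4)] .
    have sq: "s * q = s"
      using component_le_trans[OF s(3) q'(3)] .
    obtain N where N: "\<And>n. n \<ge> N \<Longrightarrow> s * coeff_root a n \<le> w *\<^sub>R s"
      using s(5) w(1) by blast
    then have Ny: "\<And>n. n \<ge> N \<Longrightarrow> s * y n \<le> w *\<^sub>R s"
      using supported[OF component_le_trans[OF sq q(5)]] by simp
    have "s * L \<le> w *\<^sub>R s"
      unfolding L_def by (rule order_limsup_upper[OF y0 ybdd s(1) Ny])
    moreover have "l *\<^sub>R s \<le> s * L"
      by (rule component_restrict_lower[OF s(1) component_le_trans[OF sq component_le_trans[OF q(4) p''(3)]] p(2)])
    ultimately have "l *\<^sub>R s \<le> w *\<^sub>R s"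
      by (rule order_trans[rotated])
    then show False
      using component_scaleR_le_iff[OF s(1,2)] w(2) by simp
  qed
  have L_ge: "g \<le> L"
  proof (rule ccontr)
    assume "\<not> g \<le> L"
    then obtain F where F: "ultrafilter F" "finite_at F \<rho>" "finite_at F L" "finite_at F g"
      "value_at F L < value_at F g"
      using not_le_value_at[of g L "{\<rho>}"] by auto
    have vL: "0 \<le> value_at F L"
      using value_at_nonneg[OF F(1,3) L0] .
    have "value_at F g \<noteq> 0"
      using vL F(5) by simp
    then have v1: "e \<in> F" "value_at F \<rho> * value_at F g = 1"
      using support_inverse_value[OF F(1,2,4) e g(2)] g(3) by (auto simp: \<rho>_def)
    (* rho is below 1/u near F, while the roots are eventually below v < u: so
       the admissible radius 1/v exceeds rho. *)
    obtain s v u where svu: "value_at F L < s" "s < v" "v < u" "u < value_at F g"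
      using F(5) by (meson dense)
    have pos: "0 < s" "0 < v" "0 < u"
      using svu vL by auto
    have "value_at F \<rho> = 1 / value_at F g"
      using v1(2) by (metis mult_zero_right nonzero_eq_divide_eq zero_neq_one)
    also have "\<dots> < 1 / u"
      using svu pos by (simp add: frac_less2)
    finally have \<rho>u: "value_at F \<rho> < 1 / u" .
    obtain p where p: "p \<in> F" "p * L \<le> s *\<^sub>R p"
      using value_at_less_on[OF F(1,3) svu(1)] .
    obtain p' where p': "p' \<in> F" "p' * \<rho> \<le> (1 / u) *\<^sub>R p'"
      using value_at_less_on[OF F(1,2) \<rho>u] .
    obtain p'' where p'': "p'' \<in> F" "component p''" "p'' * p = p''" "p'' * p' = p''"
      using ultrafilter_below[OF F(1) p(1) p'(1)] by blast
    obtain q where q: "q \<in> F" "component q" "q \<noteq> 0" "q * p'' = q" "q * e = q"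
      using ultrafilter_below[OF F(1) p''(1) v1(1)] by blast
    have "q * L \<le> s *\<^sub>R q"
      by (rule component_restrict_upper[OF q(2) component_le_trans[OF q(4) p''(3)] p(2)])
    then obtain r K N where r: "component r" "r \<noteq> 0" "r * q = r"
      "\<And>n. n \<ge> 1 \<Longrightarrow> r * y n \<le> K *\<^sub>R r" "\<And>n. n \<ge> N \<Longrightarrow> r * y n \<le> v *\<^sub>R r"
      using order_limsup_approximated[OF y0 ybdd q(2,3) _ svu(2)] unfolding L_def by blast
    note ry = supported[OF component_le_trans[OF r(3) q(5)]]
    have "(1 / v) *\<^sub>R r \<in> bounded_radii a"
      using component_multiple_bounded_radius[OF r(1) r(4)[unfolded ry] r(5)[unfolded ry] pos(2)] .
    then have "(1 / v) *\<^sub>R r \<le> \<rho>"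
      using bounded_radii_le_Sup bdd unfolding \<Omega>_def \<rho>_def by blast
    then have "r * ((1 / v) *\<^sub>R r) \<le> r * \<rho>"
      using componentD(1)[OF r(1)] by (rule mult_left_mono)
    also have "\<dots> \<le> (1 / u) *\<^sub>R r"
      by (rule component_restrict_upper[OF r(1) component_le_trans[OF r(3) component_le_trans[OF q(4) p''(4)]] p'(2)])
    finally have "1 / v \<le> 1 / u"
      using component_scaleR_le_iff[OF r(1,2)] r(1) by (simp add: componentD)
    then show False
      using svu(3) pos by (simp add: field_simps)
  qed
  show "order_limsup (\<lambda>n. e * coeff_root a n) \<le> g" "g \<le> order_limsup (\<lambda>n. e * coeff_root a n)"
    using L_le L_ge by (simp_all add: L_def y_def)
qed

text \<open>
  Wherever \<open>r\<close> is at most \<open>R / 2\<close>, the roots eventually stay below \<open>1/R\<close>, so the terms at \<open>2 r\<close> are locally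
  bounded, hence bounded.
\<close>

lemma limsup_0_imp_everywhere_convergent:
  fixes a :: "nat \<Rightarrow> 'a :: {universally_complete_vector_lattice, phi_algebra} complexification"
  assumes bdd: "bdd_above (coeff_root a ` {1..})" and L: "order_limsup (coeff_root a) = 0" and r: "0 \<le> r"
  shows "r \<in> convergence_radii a c"
proof -
  (* Terms bounded at 2 r give convergence at the radius r = (1/2) (2 r). *)
  define r2 where "r2 = 2 *\<^sub>R r"
  have r2: "0 \<le> r2"
    using r by (simp add: r2_def scaleR_nonneg_nonneg)
  have "bdd_above (range (\<lambda>n. modulus (a n) * r2 ^ n))"
  proof (rule bdd_above_if_locally_bounded)
    fix p :: 'a assume p: "component p" "p \<noteq> 0"
    obtain q1 R0 where q1: "component q1" "q1 \<noteq> 0" "q1 * p = q1" "q1 * r2 \<le> R0 *\<^sub>R q1"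
      using bounded_above_on_component[OF p] by blast
    (* The maximum makes R positive, so that 1/R is a legitimate level. *)
    define R where "R = max 1 R0"
    have R: "0 < R" "R0 \<le> R"
      by (auto simp: R_def)
    obtain q2 K0 where q2: "component q2" "q2 \<noteq> 0" "q2 * q1 = q2" "q2 * modulus (a 0) \<le> K0 *\<^sub>R q2"
      using bounded_above_on_component[OF q1(1,2)] by blast
    have "q2 * order_limsup (coeff_root a) \<le> 0 *\<^sub>R q2" "0 < 1 / R"
      using L R(1) by simp_all
    then obtain q K N where q: "component q" "q \<noteq> 0" "q * q2 = q"
      "\<And>n. n \<ge> 1 \<Longrightarrow> q * coeff_root a n \<le> K *\<^sub>R q" "\<And>n. n \<ge> N \<Longrightarrow> q * coeff_root a n \<le> (1 / R) *\<^sub>R q"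
      using order_limsup_approximated[OF coeff_root_nonneg bdd q2(1,2)] by blast
    define C where "C = max 1 (K * R) ^ N"
    have "q * r2 \<le> R0 *\<^sub>R q"
      by (rule component_restrict_upper[OF q(1) component_le_trans[OF q(3) q2(3)] q1(4)])
    also have "\<dots> \<le> R *\<^sub>R q"
      using R(2) q(1) by (intro scaleR_right_mono) (auto simp: componentD)
    finally have qR: "q * r2 \<le> R *\<^sub>R q" .
    have "q * (modulus (a n) * r2 ^ n) \<le> max K0 C *\<^sub>R q" for n
    proof (cases "n \<ge> 1")
      case True
      have "q * (modulus (a n) * r2 ^ n) \<le> C *\<^sub>R q"
        unfolding C_def
        using terms_bounded_on_component[OF q(1) q(4) q(5) r2 qR _ _ _ True] R(1) by simp
      also have "\<dots> \<le> max K0 C *\<^sub>R q"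
        using q(1) by (intro scaleR_right_mono) (auto simp: componentD)
      finally show ?thesis .
    next
      case False
      then have "q * (modulus (a n) * r2 ^ n) \<le> K0 *\<^sub>R q"
        using component_restrict_upper[OF q(1,3) q2(4)] by (simp add: not_le)
      also have "\<dots> \<le> max K0 C *\<^sub>R q"
        using q(1) by (intro scaleR_right_mono) (auto simp: componentD)
      finally show ?thesis .
    qed
    then show "\<exists>q K. component q \<and> q \<noteq> 0 \<and> q * p = q \<and>
        (\<forall>x\<in>range (\<lambda>n. modulus (a n) * r2 ^ n). q * x \<le> K *\<^sub>R q)"
      using q(1,2) component_le_trans[OF q(3) component_le_trans[OF q2(3) q1(3)]] by blast
  qed
  then have "r2 \<in> bounded_radii a"
    using r2 by (simp add: bounded_radii_def)
  from scaled_bounded_radii_converge[OF this, of "1 / 2"] show ?thesis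
    by (simp add: r2_def)
qed

text \<open>
  The radius \<open>1\<close> bounds the roots. If \<open>L \<ge> t > 0\<close> on a component, the constant radius \<open>2/t\<close> forces
  \<open>L \<le> (3/4) t\<close> on a smaller one.
\<close>

lemma everywhere_convergent_imp_limsup_0:
  fixes a :: "nat \<Rightarrow> 'a :: {universally_complete_vector_lattice, phi_algebra} complexification"
  assumes \<Omega>: "\<And>r. 0 \<le> r \<Longrightarrow> r \<in> convergence_radii a c"
  shows "bdd_above (coeff_root a ` {1..})" and "order_limsup (coeff_root a) = 0"
proof -
  have bounded: "r \<in> bounded_radii a" if "0 \<le> r" for r
    using \<Omega>[OF that] convergence_radii_subset_bounded_radii by blast
  obtain M where M: "\<And>n. modulus (a n) * 1 ^ n \<le> M"
    using bounded[OF zero_le_one_phi] by (auto simp: bounded_radii_def bdd_above_def)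
  have M0: "0 \<le> M"
    using M[of 0] modulus_nonneg[of "a 0"] by simp
  have "coeff_root a n \<le> M + 1" if n: "n \<ge> 1" for n
    using M[of n] coeff_root_power[OF n, of a] by (intro le_add_1_if_power_le[OF _ M0 n]) simp
  then show bdd: "bdd_above (coeff_root a ` {1..})"
    by (intro bdd_aboveI[of _ "M + 1"]) auto
  define L where "L = order_limsup (coeff_root a)"
  have "L \<le> 0"
  proof (rule ccontr)
    assume "\<not> L \<le> 0"
    then obtain p t where p: "component p" "p \<noteq> 0" "t > 0" "t *\<^sub>R p \<le> p * L"
      using positive_on_component by blast
    have r: "(2 / t) *\<^sub>R 1 \<in> bounded_radii a"
      using p(3) zero_le_one_phi by (intro bounded scaleR_nonneg_nonneg) auto
    have u: "0 < 2 / t" "(2 / t) *\<^sub>R p \<le> p * ((2 / t) *\<^sub>R 1)"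
      using p(3) by simp_all
    obtain s K where s: "component s" "s \<noteq> 0" "s * p = s"
      "\<forall>n\<ge>1. s * coeff_root a n \<le> K *\<^sub>R s"
      "\<forall>v>1 / (2 / t). \<exists>N. \<forall>n\<ge>N. s * coeff_root a n \<le> v *\<^sub>R s"
      using coeff_root_bound_if_bounded_radius[OF r p(1,2) u] .
    have "1 / (2 / t) < 3 / 4 * t"
      using p(3) by simp
    then obtain N where N: "\<And>n. n \<ge> N \<Longrightarrow> s * coeff_root a n \<le> (3 / 4 * t) *\<^sub>R s"
      using s(5) by blast
    have "s * L \<le> (3 / 4 * t) *\<^sub>R s"
      unfolding L_def by (rule order_limsup_upper[OF coeff_root_nonneg bdd s(1) N])
    moreover have "t *\<^sub>R s \<le> s * L"
      by (rule component_restrict_lower[OF s(1,3) p(4)])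
    ultimately have "t *\<^sub>R s \<le> (3 / 4 * t) *\<^sub>R s"
      by (rule order_trans[rotated])
    then show False
      using component_scaleR_le_iff[OF s(1,2)] p(3) by simp
  qed
  then show "order_limsup (coeff_root a) = 0"
    using order_limsup_nonneg[OF coeff_root_nonneg bdd] by (intro order.antisym) (simp_all add: L_def)
qed

theorem theorem3p11:
  fixes a :: "nat \<Rightarrow> 'a :: {universally_complete_vector_lattice, phi_algebra} complexification"
    and c :: "'a complexification"
  defines "\<Omega> \<equiv> convergence_radii a c"
    and "\<rho> \<equiv> radius_of_convergence a c"
    and "L \<equiv> order_limsup (coeff_root a)"
  shows
    "(order_bounded (coeff_root a ` {1..}) \<longrightarrow>
        order_bounded_rho ((\<lambda>r. band_proj (of_rho L) (of_rho r)) ` \<Omega>) \<and>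
        band_inverse (of_rho L) = of_rho (SUP r\<in>\<Omega>. re (band_proj (of_rho L) (of_rho r)))) \<and>
     (order_bounded \<Omega> \<longrightarrow>
        order_bounded_rho ((\<lambda>n. band_proj (of_rho \<rho>) (of_rho (coeff_root a n))) ` {1..}) \<and>
        of_rho (order_limsup (\<lambda>n. re (band_proj (of_rho \<rho>) (of_rho (coeff_root a n))))) =
          band_inverse (of_rho \<rho>)) \<and>
     ((order_bounded (coeff_root a ` {1..}) \<and> weak_order_unit L \<longleftrightarrow>
        order_bounded \<Omega> \<and> weak_order_unit \<rho>) \<and>
      ((order_bounded (coeff_root a ` {1..}) \<and> weak_order_unit L) \<or>
       (order_bounded \<Omega> \<and> weak_order_unit \<rho>) \<longrightarrow>
         L * \<rho> = 1 \<and> \<rho> * L = 1)) \<and>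
     (order_bounded (coeff_root a ` {1..}) \<and> L = 0 \<longleftrightarrow> \<Omega> = {0..})"
proof -
  have bounded_roots: "order_bounded (coeff_root a ` {1..}) \<longleftrightarrow> bdd_above (coeff_root a ` {1..})"
    using coeff_root_nonneg by (auto simp: order_bounded_def intro!: bdd_belowI[of _ 0])
  have \<Omega>0: "0 \<in> \<Omega>" and \<Omega>nn: "\<And>r. r \<in> \<Omega> \<Longrightarrow> 0 \<le> r"
    using zero_in_convergence_radii by (auto simp: \<Omega>_def convergence_radii_def)
  have bounded_\<Omega>: "order_bounded \<Omega> \<longleftrightarrow> bdd_above \<Omega>"
    using \<Omega>nn by (auto simp: order_bounded_def intro!: bdd_belowI[of _ 0])
  have \<rho>: "\<rho> = Sup \<Omega>"
    by (simp add: \<rho>_def \<Omega>_def radius_of_convergence_def)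
  have L0: "0 \<le> L" if "bdd_above (coeff_root a ` {1..})"
    unfolding L_def using order_limsup_nonneg[OF coeff_root_nonneg that] by simp
  have \<rho>0: "0 \<le> \<rho>" if "bdd_above \<Omega>"
    unfolding \<rho> using \<Omega>0 that by (rule cSup_upper)
  have re_of_rho: "re (of_rho f) = f" for f :: 'a
    by (simp add: of_rho_def)
  have i: "order_bounded_rho ((\<lambda>r. band_proj (of_rho L) (of_rho r)) ` \<Omega>) \<and>
      band_inverse (of_rho L) = of_rho (SUP r\<in>\<Omega>. re (band_proj (of_rho L) (of_rho r)))"
    if bdd: "bdd_above (coeff_root a ` {1..})"
  proof -
    obtain g where g: "0 \<le> g" "support_component L * g = g" "L * g = support_component L"
      using support_inverse_exists[OF L0[OF bdd]] .
    note * = inverse_limsup_eq_Sup[OF bdd g[unfolded L_def], where c = c, folded L_def \<Omega>_def]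
    have "0 \<le> support_component L * r" if "r \<in> \<Omega>" for r
      using \<Omega>nn[OF that] component_support[OF L0[OF bdd]] by (simp add: componentD)
    then have "order_bounded_rho ((\<lambda>r. of_rho (support_component L * r)) ` \<Omega>)"
      unfolding order_bounded_rho_def using *(1) by (intro exI[of _ 0] exI[of _ g]) auto
    then show ?thesis
      using band_inverse_of_rho[OF L0[OF bdd] g(2,3)] *(2) L0[OF bdd]
      by (simp add: band_proj_of_rho_of_rho re_of_rho)
  qed
  have ii: "order_bounded_rho ((\<lambda>n. band_proj (of_rho \<rho>) (of_rho (coeff_root a n))) ` {1..}) \<and>
      of_rho (order_limsup (\<lambda>n. re (band_proj (of_rho \<rho>) (of_rho (coeff_root a n))))) = band_inverse (of_rho \<rho>)"
    if bdd: "bdd_above \<Omega>"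
  proof -
    obtain g where g: "0 \<le> g" "support_component \<rho> * g = g" "\<rho> * g = support_component \<rho>"
      using support_inverse_exists[OF \<rho>0[OF bdd]] .
    have limsup: "order_limsup (\<lambda>n. support_component \<rho> * coeff_root a n) = g"
      using limsup_eq_inverse_Sup[OF bdd[unfolded \<Omega>_def], of g] g by (simp add: \<rho> \<Omega>_def)
    obtain Y where Y: "\<And>n. n \<ge> 1 \<Longrightarrow> support_component \<rho> * coeff_root a n \<le> Y"
      using coeff_root_bounded_on_support[OF bdd[unfolded \<Omega>_def]] by (auto simp: bdd_above_def \<rho> \<Omega>_def)
    have "0 \<le> support_component \<rho> * coeff_root a n" if "n \<ge> 1" for n
      by (intro mult_nonneg_nonneg componentD(1)[OF component_support[OF \<rho>0[OF bdd]]] coeff_root_nonneg that)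
    then have "order_bounded_rho ((\<lambda>n. of_rho (support_component \<rho> * coeff_root a n)) ` {1..})"
      unfolding order_bounded_rho_def using Y by (intro exI[of _ 0] exI[of _ Y]) auto
    then show ?thesis
      using band_inverse_of_rho[OF \<rho>0[OF bdd] g(2,3)] limsup \<rho>0[OF bdd]
      by (simp add: band_proj_of_rho_of_rho re_of_rho)
  qed
  have iii1: "bdd_above \<Omega> \<and> weak_order_unit \<rho> \<and> L * \<rho> = 1"
    if bdd: "bdd_above (coeff_root a ` {1..})" and unit: "weak_order_unit L"
  proof -
    have e: "support_component L = 1"
      using unit weak_order_unit_iff_support[OF L0[OF bdd]] by simp
    obtain g where g: "0 \<le> g" "support_component L * g = g" "L * g = support_component L"
      using support_inverse_exists[OF L0[OF bdd]] .
    note * = inverse_limsup_eq_Sup[OF bdd g[unfolded L_def], where c = c, folded L_def \<Omega>_def, unfolded e mult_1_left]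
    have \<Omega>: "bdd_above \<Omega>"
      using *(1) by (intro bdd_aboveI)
    have "\<rho> = g"
      using *(2) by (simp add: \<rho>)
    then have "L * \<rho> = 1"
      using g(3) e by simp
    moreover have "weak_order_unit \<rho>"
      using support_component_invertible[OF \<rho>0[OF \<Omega>], of L] calculation phi_mult_commute[of \<rho> L]
        weak_order_unit_iff_support[OF \<rho>0[OF \<Omega>]] by simp
    ultimately show ?thesis
      using \<Omega> by simp
  qed
  have iii2: "bdd_above (coeff_root a ` {1..}) \<and> weak_order_unit L \<and> L * \<rho> = 1"
    if bdd: "bdd_above \<Omega>" and unit: "weak_order_unit \<rho>"
  proof -
    have e: "support_component \<rho> = 1"
      using unit weak_order_unit_iff_support[OF \<rho>0[OF bdd]] by simp
    obtain g where g: "0 \<le> g" "support_component \<rho> * g = g" "\<rho> * g = support_component \<rho>"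
      using support_inverse_exists[OF \<rho>0[OF bdd]] .
    have "L = g"
      using limsup_eq_inverse_Sup[OF bdd[unfolded \<Omega>_def], of g] g e by (simp add: \<rho> \<Omega>_def L_def)
    then have "L * \<rho> = 1"
      using g(3) e phi_mult_commute[of L \<rho>] by simp
    moreover have roots: "bdd_above (coeff_root a ` {1..})"
      using coeff_root_bounded_on_support[OF bdd[unfolded \<Omega>_def]] e by (simp add: \<rho> \<Omega>_def)
    moreover have "weak_order_unit L"
      using support_component_invertible[OF L0[OF roots] \<open>L * \<rho> = 1\<close>]
        weak_order_unit_iff_support[OF L0[OF roots]] by simp
    ultimately show ?thesis
      by simp
  qed
  have iii3: "\<rho> * L = 1" if "L * \<rho> = 1"
    using that phi_mult_commute[of \<rho> L] by simp
  have iv: "bdd_above (coeff_root a ` {1..}) \<and> L = 0 \<longleftrightarrow> \<Omega> = {0..}"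
  proof
    assume "bdd_above (coeff_root a ` {1..}) \<and> L = 0"
    then show "\<Omega> = {0..}"
      using limsup_0_imp_everywhere_convergent[of a _ c] \<Omega>nn by (auto simp: \<Omega>_def L_def)
  next
    assume "\<Omega> = {0..}"
    then have "\<And>r. 0 \<le> r \<Longrightarrow> r \<in> convergence_radii a c"
      by (auto simp: \<Omega>_def)
    then show "bdd_above (coeff_root a ` {1..}) \<and> L = 0"
      using everywhere_convergent_imp_limsup_0[of a c] by (simp add: L_def)
  qed
  have iii: "bdd_above (coeff_root a ` {1..}) \<and> weak_order_unit L \<longleftrightarrow> bdd_above \<Omega> \<and> weak_order_unit \<rho>"
    using iii1 iii2 by auto
  have inverse: "(bdd_above (coeff_root a ` {1..}) \<and> weak_order_unit L) \<or> (bdd_above \<Omega> \<and> weak_order_unit \<rho>) \<longrightarrow>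
      L * \<rho> = 1 \<and> \<rho> * L = 1"
    using iii1 iii2 iii3 by auto
  show ?thesis
    unfolding bounded_roots bounded_\<Omega>
    by (rule conjI[OF impI[OF i] conjI[OF impI[OF ii] conjI[OF conjI[OF iii inverse] iv]]])
qed

end
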